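(* Let $p_0 = \left(1-\frac{\log \pi}{\log 4}\right)^{-1}$. For every real number $p > p_0$ there exists a symbol $\varphi \in L^2(\mathbb{T}^\infty)$ such that the multiplicative Hankel form $H_\varphi$ belongs to the Schatten class $\mathcal{S}_p$ and does not have a bounded symbol, i.e. there is no $\psi \in L^\infty(\mathbb{T}^\infty)$ with $H_\psi = H_\varphi$.
   Context: $\mathbb{T}^\infty$ is the countably infinite product of unit circles $\mathbb{T}=\{z\in\mathbb{C}:|z|=1\}$, with coordinates $z=(z_1,z_2,\ldots)$, equipped with its normalized Haar measure (the product of the normalized Lebesgue measures in each variable). $\langle u,v\rangle=\int_{\mathbb{T}^\infty}u\overline{v}$ denotes the inner product of $L^2(\mathbb{T}^\infty)$. For $n\in\mathbb{N}$ with prime factorization $n=\prod_j p_j^{\kappa_j}$ ($p_j$ the $j$th prime), put $\kappa(n)=(\kappa_1,\kappa_2,\ldots)$ and $z^{\kappa(n)}=\prod_j z_j^{\kappa_j}$. The Hardy space $H^2(\mathbb{D}^\infty)$ is identified with the closed subspace of $L^2(\mathbb{T}^\infty)$ having orthonormal basis $\{z^{\kappa(n)}\}_{n\ge1}$. A polynomial is a finite linear combination of the monomials $z^{\kappa(n)}$. Each $\varphi\in L^2(\mathbb{T}^\infty)$ induces a (possibly unbounded) multiplicative Hankel form on $H^2(\mathbb{D}^\infty)\times H^2(\mathbb{D}^\infty)$, $H_\varphi(fg)=\langle fg,\varphi\rangle$, defined at least for polynomials $f,g$. Two forms are equal, $H_\varphi=H_\psi$, if they agree on all pairs of polynomials;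 equivalently $P\varphi=P\psi$ where $P$ is the orthogonal projection of $L^2(\mathbb{T}^\infty)$ onto $H^2(\mathbb{D}^\infty)$. In the basis $\{z^{\kappa(n)}\}$ the form has the infinite matrix $M_\varrho=(\varrho_{mn})_{m,n\ge1}$ (index of the entry is the product $mn$), where $\varrho_n=\langle z^{\kappa(n)},\varphi\rangle$. The form $H_\varphi$ belongs to the Schatten class $\mathcal{S}_p$, $0<p<\infty$, if $M_\varrho$ defines a compact operator on $\ell^2(\mathbb{N})$ whose singular value sequence $\Lambda$ (with multiplicity) is in $\ell^p$, and then $\|H_\varphi\|_{\mathcal{S}_p}=\|\Lambda\|_{\ell^p}$. *)

theory Defs
  imports
    "HOL-Probability.Probability"
    "HOL-Library.Function_Algebras"
    "HOL-Library.Infinite_Set"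
    "HOL-Computational_Algebra.Primes"
begin

section \<open>The infinite torus\<close>

definition circle_measure :: "complex measure" where
  "circle_measure =
     distr (uniform_measure lborel {0..2*pi}) (restrict_space borel (sphere 0 1)) cis"

lemma prob_space_circle_measure: "prob_space circle_measure"
proof -
  have "prob_space (uniform_measure lborel {0..2*pi})"
    by (rule prob_space_uniform_measure) (auto simp: ennreal_eq_0_iff not_le)
  moreover have "cis \<in> uniform_measure lborel {0..2*pi} \<rightarrow>\<^sub>M restrict_space borel (sphere 0 1)"
  proof (rule measurable_restrict_space2)
    have "cis \<in> borel_measurable borel"
      by (auto intro!: borel_measurable_continuous_onI continuous_intros)
    then show "cis \<in> borel_measurable (uniform_measure lborel {0..2*pi})"
      by (simp cong: measurable_cong_sets)
  qed auto
  ultimately show ?thesis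
    unfolding circle_measure_def by (rule prob_space.prob_space_distr)
qed

text \<open>Coordinates are numbered from 0, so \<open>z j\<close> belongs to the \<open>(j+1)\<close>-st prime.\<close>

definition torus :: "(nat \<Rightarrow> complex) measure" where
  "torus = Pi\<^sub>M UNIV (\<lambda>_. circle_measure)"

lemma prob_space_torus: "prob_space torus"
  unfolding torus_def by (rule prob_space_PiM) (rule prob_space_circle_measure)

text \<open>Elements of \<open>L\<^sup>2\<close> and \<open>L\<^sup>\<infinity>\<close> are represented by functions, not by classes modulo null sets.\<close>

definition L2 :: "'a measure \<Rightarrow> ('a \<Rightarrow> complex) set" where
  "L2 M = {f \<in> borel_measurable M. integrable M (\<lambda>x. (cmod (f x))\<^sup>2)}"

definition Linf :: "'a measure \<Rightarrow> ('a \<Rightarrow> complex) set" where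
  "Linf M = {f \<in> borel_measurable M. \<exists>C. AE x in M. cmod (f x) \<le> C}"

definition torus_inner ::
    "((nat \<Rightarrow> complex) \<Rightarrow> complex) \<Rightarrow> ((nat \<Rightarrow> complex) \<Rightarrow> complex) \<Rightarrow> complex" where
  "torus_inner u v = (\<integral>z. u z * cnj (v z) \<partial>torus)"


section \<open>Multiplicative Hankel forms\<close>

definition nth_prime :: "nat \<Rightarrow> nat" where
  "nth_prime j = enumerate {p. prime p} j"

definition kappa :: "nat \<Rightarrow> nat \<Rightarrow> nat" where
  "kappa n j = multiplicity (nth_prime j) n"

definition torus_monomial :: "nat \<Rightarrow> (nat \<Rightarrow> complex) \<Rightarrow> complex" where
  "torus_monomial n z = (\<Prod>j | kappa n j \<noteq> 0. z j ^ kappa n j)"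

definition torus_polynomials :: "((nat \<Rightarrow> complex) \<Rightarrow> complex) set" where
  "torus_polynomials =
     {f. \<exists>S c. finite S \<and> 0 \<notin> S \<and> f = (\<lambda>z. \<Sum>n\<in>S. c n * torus_monomial n z)}"

definition hankel_form ::
    "((nat \<Rightarrow> complex) \<Rightarrow> complex) \<Rightarrow> ((nat \<Rightarrow> complex) \<Rightarrow> complex) \<Rightarrow>
     ((nat \<Rightarrow> complex) \<Rightarrow> complex) \<Rightarrow> complex" where
  "hankel_form \<phi> f g = torus_inner (\<lambda>z. f z * g z) \<phi>"

definition same_hankel_form ::
    "((nat \<Rightarrow> complex) \<Rightarrow> complex) \<Rightarrow> ((nat \<Rightarrow> complex) \<Rightarrow> complex) \<Rightarrow> bool" where
  "same_hankel_form \<phi> \<psi> \<longleftrightarrow>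
     (\<forall>f\<in>torus_polynomials. \<forall>g\<in>torus_polynomials. hankel_form \<phi> f g = hankel_form \<psi> f g)"

definition hankel_coeff :: "((nat \<Rightarrow> complex) \<Rightarrow> complex) \<Rightarrow> nat \<Rightarrow> complex" where
  "hankel_coeff \<phi> n = torus_inner (torus_monomial n) \<phi>"

text \<open>Rows and columns are numbered from 0, so index \<open>m\<close> stands for the integer \<open>m + 1\<close>.\<close>

definition hankel_matrix :: "((nat \<Rightarrow> complex) \<Rightarrow> complex) \<Rightarrow> nat \<Rightarrow> nat \<Rightarrow> complex" where
  "hankel_matrix \<phi> m n = hankel_coeff \<phi> (Suc m * Suc n)"


section \<open>Schatten classes of infinite matrices\<close>

definition ell2 :: "(nat \<Rightarrow> complex) set" where
  "ell2 = {x. summable (\<lambda>n. (cmod (x n))\<^sup>2)}"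

definition ell2_norm :: "(nat \<Rightarrow> complex) \<Rightarrow> real" where
  "ell2_norm x = sqrt (\<Sum>n. (cmod (x n))\<^sup>2)"

definition mat_apply :: "(nat \<Rightarrow> nat \<Rightarrow> complex) \<Rightarrow> (nat \<Rightarrow> complex) \<Rightarrow> nat \<Rightarrow> complex" where
  "mat_apply A x m = (\<Sum>n. A m n * x n)"

definition mat_adj :: "(nat \<Rightarrow> nat \<Rightarrow> complex) \<Rightarrow> nat \<Rightarrow> nat \<Rightarrow> complex" where
  "mat_adj A m n = cnj (A n m)"

definition defines_operator :: "(nat \<Rightarrow> nat \<Rightarrow> complex) \<Rightarrow> bool" where
  "defines_operator A \<longleftrightarrow>
     (\<forall>x\<in>ell2. (\<forall>m. summable (\<lambda>n. A m n * x n)) \<and> mat_apply A x \<in> ell2)"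

definition defines_compact_operator :: "(nat \<Rightarrow> nat \<Rightarrow> complex) \<Rightarrow> bool" where
  "defines_compact_operator A \<longleftrightarrow> defines_operator A \<and>
     (\<forall>X :: nat \<Rightarrow> nat \<Rightarrow> complex. (\<forall>k. X k \<in> ell2 \<and> ell2_norm (X k) \<le> 1) \<longrightarrow>
        (\<exists>y\<in>ell2. \<exists>r :: nat \<Rightarrow> nat. strict_mono r \<and>
           (\<lambda>k. ell2_norm (\<lambda>m. mat_apply A (X (r k)) m - y m)) \<longlonglongrightarrow> 0))"

text \<open>
  The eigenspace of \<open>A\<^sup>* A\<close> for the eigenvalue \<open>\<sigma>\<^sup>2\<close>, that is, for \<open>\<sigma> \<ge> 0\<close>, the eigenspace of
  \<open>(A\<^sup>* A)\<^bsup>1/2\<^esup>\<close> for the eigenvalue \<open>\<sigma>\<close>.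
\<close>

definition singular_space :: "(nat \<Rightarrow> nat \<Rightarrow> complex) \<Rightarrow> real \<Rightarrow> (nat \<Rightarrow> complex) set" where
  "singular_space A \<sigma> =
     {x \<in> ell2. mat_apply (mat_adj A) (mat_apply A x) = (\<lambda>n. of_real (\<sigma>\<^sup>2) * x n)}"

definition cseq_scale :: "complex \<Rightarrow> (nat \<Rightarrow> complex) \<Rightarrow> nat \<Rightarrow> complex" where
  "cseq_scale c x = (\<lambda>n. c * x n)"

lemma vector_space_cseq_scale: "vector_space cseq_scale"
  by unfold_locales (auto simp: cseq_scale_def fun_eq_iff algebra_simps)

text \<open>
  The singular values in decreasing order, each positive one repeated according to its
  multiplicity, and padded with zeros if there are only finitely many positive ones. For a
  compact operator every \<open>singular_space A \<sigma>\<close> with \<open>\<sigma> > 0\<close> is finite-dimensional, so \<open>dim\<close> is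
  its true dimension (it is 0 for infinite-dimensional spaces), and exactly one sequence \<open>s\<close>
  has this property.
\<close>

definition singular_value_sequence :: "(nat \<Rightarrow> nat \<Rightarrow> complex) \<Rightarrow> (nat \<Rightarrow> real) \<Rightarrow> bool" where
  "singular_value_sequence A s \<longleftrightarrow>
     decseq s \<and> (\<forall>k. 0 \<le> s k) \<and> s \<longlonglongrightarrow> 0 \<and>
     (\<forall>\<sigma>>0. card {k. s k = \<sigma>} = vector_space.dim cseq_scale (singular_space A \<sigma>))"

definition schatten_class :: "real \<Rightarrow> (nat \<Rightarrow> nat \<Rightarrow> complex) \<Rightarrow> bool" where
  "schatten_class p A \<longleftrightarrow> defines_compact_operator A \<and>
     (\<exists>s. singular_value_sequence A s \<and> summable (\<lambda>k. s k powr p))"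

end

theory Submission
  imports Defs
begin

text \<open>
  Let \<open>S\<close> be a sum of \<open>d\<close> independent coordinates. Its Hankel form has rank two with both singular
  values \<open>sqrt d\<close>, while \<open>S\<close> has squared \<open>L\<^sup>2\<close>-norm \<open>d\<close> and, by the central limit theorem, \<open>L\<^sup>1\<close>-norm
  \<open>r sqrt d\<close> with \<open>r\<close> tending to \<open>sqrt pi / 2\<close>. The condition on \<open>p\<close> says precisely that \<open>r\<close> can be made smaller
  than \<open>2 powr (-1/p)\<close>; fix \<open>\<theta>\<close> strictly between the two. Let \<open>\<Phi> k\<close> be the product of \<open>k\<close> copies of
  \<open>S / sqrt d\<close> in disjoint sets of variables, again disjoint for different \<open>k\<close>, and take the symbol
  \<open>\<phi> = (\<Sum>k\<ge>1. \<theta> ^ k * \<Phi> k)\<close>. The form of \<open>\<Phi> k\<close> is a partial isometry of rank \<open>2 ^ k\<close>. These ranges meet only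
  in the constants, so the matrix of \<open>\<phi>\<close> has an explicit singular value decomposition, with singular
  values \<open>\<theta> ^ k\<close> of multiplicity \<open>2 ^ k - 2\<close> and two equal exceptional ones, and \<open>2 * \<theta> powr p < 1\<close> gives the
  Schatten bound. A bounded symbol \<open>\<psi>\<close> would give
  \<open>\<theta> ^ k = \<langle>\<Phi> k, \<phi>\<rangle> = \<langle>\<Phi> k, \<psi>\<rangle> \<le> C * r ^ k\<close> for all \<open>k\<close>, contradicting \<open>r < \<theta>\<close>.
\<close>

text \<open>Why products: \<open>S / sqrt d\<close> alone has two singular values 1, and pairing it
  with itself shows that each of its bounded symbols has sup norm at least \<open>1 / r\<close>. One
  level therefore only compares \<open>1 / r\<close> with the Schatten norm
  \<open>2 powr (1/p)\<close>. Disjoint variables make the singular values and the L^1 norm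
  multiplicative, so a gain of \<open>1 / (r * 2 powr (1/p)) > 1\<close> becomes its k-th power at
  level k, and a series over the levels turns unbounded ratios into nonexistence. After taking
  logarithms, \<open>sqrt pi / 2 < 2 powr (-1/p)\<close> reads
  \<open>1/p < 1 - ln pi / ln 4\<close>.

  The partial isometry of a level comes from unique factorization: if a product of one prime from
  each block is written as a row number times a column number, the column takes the primes of a set
  T of blocks and the row those of the complement. Each T contributes one rank-one piece, and
  distinct T give disjointly supported vectors.

  The Schatten class is defined through dimensions of eigenspaces, so left and right singular
  vectors are exhibited for the whole sum at once instead of adding up the norms of the
  levels.\<close>

section \<open>Square-summable sequences\<close>

definition ell2_inner :: "(nat \<Rightarrow> complex) \<Rightarrow> (nat \<Rightarrow> complex) \<Rightarrow> complex" where
  "ell2_inner x y = (\<Sum>n. x n * cnj (y n))"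

lemma ell2_summable_inner:
  assumes "x \<in> ell2" "y \<in> ell2"
  shows "summable (\<lambda>n. cmod (x n * cnj (y n)))"
proof (rule summable_comparison_test')
  show "summable (\<lambda>n. (cmod (x n))\<^sup>2 + (cmod (y n))\<^sup>2)"
    using assms by (auto simp: ell2_def intro: summable_add)
  fix n :: nat
  have "2 * (cmod (x n) * cmod (y n)) \<le> (cmod (x n))\<^sup>2 + (cmod (y n))\<^sup>2"
    using sum_squares_bound[of "cmod (x n)" "cmod (y n)"] by (simp add: mult_ac)
  moreover have "0 \<le> cmod (x n) * cmod (y n)" by simp
  ultimately show "norm (cmod (x n * cnj (y n))) \<le> (cmod (x n))\<^sup>2 + (cmod (y n))\<^sup>2"
    unfolding norm_mult complex_mod_cnj real_norm_def abs_mult abs_norm_cancel by linarith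
qed

lemma ell2_summable_inner':
  assumes "x \<in> ell2" "y \<in> ell2"
  shows "summable (\<lambda>n. x n * cnj (y n))"
  using ell2_summable_inner[OF assms] by (rule summable_norm_cancel)

lemma ell2_add:
  assumes "x \<in> ell2" "y \<in> ell2"
  shows "(\<lambda>n. x n + y n) \<in> ell2"
proof -
  have "summable (\<lambda>n. 2 * (cmod (x n))\<^sup>2 + 2 * (cmod (y n))\<^sup>2)"
    using assms by (auto simp: ell2_def intro!: summable_add summable_mult)
  moreover have "(cmod (x n + y n))\<^sup>2 \<le> 2 * (cmod (x n))\<^sup>2 + 2 * (cmod (y n))\<^sup>2" for n
  proof -
    have "(cmod (x n + y n))\<^sup>2 \<le> (cmod (x n) + cmod (y n))\<^sup>2"
      by (intro power_mono norm_triangle_ineq) auto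
    also have "\<dots> \<le> 2 * (cmod (x n))\<^sup>2 + 2 * (cmod (y n))\<^sup>2"
      using sum_squares_bound[of "cmod (x n)" "cmod (y n)"] by (simp add: power2_sum)
    finally show ?thesis .
  qed
  ultimately show ?thesis
    unfolding ell2_def by (auto intro: summable_comparison_test')
qed

lemma ell2_scale: "x \<in> ell2 \<Longrightarrow> (\<lambda>n. c * x n) \<in> ell2"
  by (auto simp: ell2_def norm_mult power_mult_distrib intro: summable_mult)

lemma ell2_diff:
  assumes "x \<in> ell2" "y \<in> ell2"
  shows "(\<lambda>n. x n - y n) \<in> ell2"
  using ell2_add[OF assms(1) ell2_scale[OF assms(2), of "-1"]] by simp

lemma ell2_zero: "(\<lambda>_. 0) \<in> ell2"
  by (simp add: ell2_def)

lemma ell2_sum: "(\<And>i. i \<in> J \<Longrightarrow> x i \<in> ell2) \<Longrightarrow> (\<lambda>n. \<Sum>i\<in>J. x i n) \<in> ell2"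
  by (induction J rule: infinite_finite_induct) (auto intro: ell2_zero ell2_add)

lemma ell2_norm_square: "x \<in> ell2 \<Longrightarrow> (ell2_norm x)\<^sup>2 = (\<Sum>n. (cmod (x n))\<^sup>2)"
  by (simp add: ell2_norm_def ell2_def suminf_nonneg)

lemma ell2_norm_nonneg: "x \<in> ell2 \<Longrightarrow> 0 \<le> ell2_norm x"
  by (simp add: ell2_norm_def ell2_def suminf_nonneg)

lemma ell2_partial_le: "x \<in> ell2 \<Longrightarrow> finite J \<Longrightarrow> (\<Sum>n\<in>J. (cmod (x n))\<^sup>2) \<le> (ell2_norm x)\<^sup>2"
  unfolding ell2_norm_square by (rule sum_le_suminf) (auto simp: ell2_def)

lemma ell2_inner_self: "x \<in> ell2 \<Longrightarrow> ell2_inner x x = of_real ((ell2_norm x)\<^sup>2)"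
  unfolding ell2_norm_square ell2_inner_def
  by (subst suminf_of_real) (auto simp: ell2_def complex_norm_square simp del: of_real_power)

lemma ell2_boundedI:
  assumes "\<And>M. (\<Sum>n<M. (cmod (x n))\<^sup>2) \<le> C"
  shows "x \<in> ell2" "(ell2_norm x)\<^sup>2 \<le> C"
proof -
  show "x \<in> ell2"
    unfolding ell2_def using assms
    by (auto intro!: summableI_nonneg_bounded[where x = C])
  then show "(ell2_norm x)\<^sup>2 \<le> C"
    unfolding ell2_norm_square[OF \<open>x \<in> ell2\<close>] using assms
    by (intro suminf_le_const) (auto simp: ell2_def)
qed

lemma ell2_Cauchy_Schwarz:
  assumes "x \<in> ell2" "y \<in> ell2"
  shows "cmod (ell2_inner x y) \<le> ell2_norm x * ell2_norm y"
proof -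
  have "(\<lambda>N. cmod (\<Sum>n<N. x n * cnj (y n))) \<longlonglongrightarrow> cmod (ell2_inner x y)"
    unfolding ell2_inner_def
    by (intro tendsto_norm summable_LIMSEQ ell2_summable_inner' assms)
  moreover have "cmod (\<Sum>n<N. x n * cnj (y n)) \<le> ell2_norm x * ell2_norm y" for N
  proof -
    have bound: "L2_set (\<lambda>n. cmod (z n)) {..<N} \<le> ell2_norm z" if "z \<in> ell2" for z
      using ell2_partial_le[OF that, of "{..<N}"] ell2_norm_nonneg[OF that]
      by (auto simp: L2_set_def intro: real_le_lsqrt)
    have "cmod (\<Sum>n<N. x n * cnj (y n)) \<le> (\<Sum>n<N. \<bar>cmod (x n)\<bar> * \<bar>cmod (y n)\<bar>)"
      by (rule order_trans[OF norm_sum]) (simp add: norm_mult)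
    also have "\<dots> \<le> L2_set (\<lambda>n. cmod (x n)) {..<N} * L2_set (\<lambda>n. cmod (y n)) {..<N}"
      by (rule L2_set_mult_ineq)
    also have "\<dots> \<le> ell2_norm x * ell2_norm y"
      by (intro mult_mono bound assms L2_set_nonneg ell2_norm_nonneg)
    finally show ?thesis .
  qed
  ultimately show ?thesis
    by (intro LIMSEQ_le_const2) auto
qed

lemma ell2_inner_commute:
  assumes "x \<in> ell2" "y \<in> ell2"
  shows "ell2_inner y x = cnj (ell2_inner x y)"
proof -
  have "(\<lambda>n. cnj (x n * cnj (y n))) sums cnj (ell2_inner x y)"
    unfolding ell2_inner_def
    using ell2_summable_inner'[OF assms] by (simp only: sums_cnj summable_sums)
  then show ?thesis
    unfolding ell2_inner_def by (simp add: sums_iff mult.commute)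
qed

lemma ell2_inner_add_left:
  assumes "x \<in> ell2" "x' \<in> ell2" "y \<in> ell2"
  shows "ell2_inner (\<lambda>n. x n + x' n) y = ell2_inner x y + ell2_inner x' y"
  unfolding ell2_inner_def
  by (simp add: ring_distribs suminf_add[symmetric] ell2_summable_inner' assms)

lemma ell2_inner_scale_left:
  assumes "x \<in> ell2" "y \<in> ell2"
  shows "ell2_inner (\<lambda>n. c * x n) y = c * ell2_inner x y"
  unfolding ell2_inner_def
  by (simp add: mult.assoc suminf_mult ell2_summable_inner' assms)

lemma ell2_inner_diff_left:
  assumes "x \<in> ell2" "x' \<in> ell2" "y \<in> ell2"
  shows "ell2_inner (\<lambda>n. x n - x' n) y = ell2_inner x y - ell2_inner x' y"
  unfolding ell2_inner_def
  by (simp add: ring_distribs suminf_diff[symmetric] ell2_summable_inner' assms)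

lemma ell2_inner_zero_left: "ell2_inner (\<lambda>_. 0) y = 0"
  by (simp add: ell2_inner_def)

lemma ell2_inner_sum_left:
  assumes "\<And>i. i \<in> J \<Longrightarrow> x i \<in> ell2" "y \<in> ell2"
  shows "ell2_inner (\<lambda>n. \<Sum>i\<in>J. c i * x i n) y = (\<Sum>i\<in>J. c i * ell2_inner (x i) y)"
  using assms(1)
proof (induction J rule: infinite_finite_induct)
  case (insert i J)
  then show ?case
    using assms(2)
    by (simp add: ell2_inner_add_left ell2_inner_scale_left ell2_scale ell2_sum)
qed (auto simp: ell2_inner_zero_left)

definition ell2_orthonormal :: "(nat \<Rightarrow> nat \<Rightarrow> complex) \<Rightarrow> bool" where
  "ell2_orthonormal e \<longleftrightarrow>
     (\<forall>i. e i \<in> ell2) \<and> (\<forall>i j. ell2_inner (e i) (e j) = (if i = j then 1 else 0))"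

lemma ell2_orthonormalD:
  assumes "ell2_orthonormal e"
  shows "e i \<in> ell2" "ell2_inner (e i) (e j) = (if i = j then 1 else 0)"
  using assms by (auto simp: ell2_orthonormal_def)

lemma ell2_orthonormal_norm:
  assumes "ell2_orthonormal f"
  shows "ell2_norm (f j) = 1"
proof -
  have "complex_of_real ((ell2_norm (f j))\<^sup>2) = 1"
    using ell2_inner_self[OF ell2_orthonormalD(1)[OF assms], of j]
      ell2_orthonormalD(2)[OF assms, of j j] by simp
  then have "(ell2_norm (f j))\<^sup>2 = 1" by (simp only: of_real_eq_1_iff)
  then show ?thesis
    using ell2_norm_nonneg[OF ell2_orthonormalD(1)[OF assms], of j] by (simp add: power2_eq_1_iff)
qed

lemma ell2_finite_combination:
  fixes c :: "nat \<Rightarrow> complex"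
  assumes e: "ell2_orthonormal e" and J: "finite J"
  defines "p \<equiv> \<lambda>n. \<Sum>i\<in>J. c i * e i n"
  shows "p \<in> ell2" "ell2_inner p (e j) = (if j \<in> J then c j else 0)"
    "(ell2_norm p)\<^sup>2 = (\<Sum>i\<in>J. (cmod (c i))\<^sup>2)"
proof -
  show p: "p \<in> ell2"
    unfolding p_def by (intro ell2_sum ell2_scale ell2_orthonormalD[OF e])
  show ip: "ell2_inner p (e j) = (if j \<in> J then c j else 0)" for j
    unfolding p_def using J
    by (subst ell2_inner_sum_left)
       (auto simp: ell2_orthonormalD[OF e] if_distrib sum.delta cong: if_cong)
  have "of_real ((ell2_norm p)\<^sup>2) = (\<Sum>i\<in>J. c i * ell2_inner (e i) p)"
    using ell2_inner_sum_left[where x = e and J = J and c = c, OF ell2_orthonormalD(1)[OF e] p]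
    by (simp add: ell2_inner_self[OF p, symmetric] p_def[symmetric] del: of_real_power)
  also have "\<dots> = (\<Sum>i\<in>J. of_real ((cmod (c i))\<^sup>2))"
  proof (intro sum.cong refl)
    fix i assume "i \<in> J"
    then have "ell2_inner (e i) p = cnj (c i)"
      using ell2_inner_commute[OF p ell2_orthonormalD(1)[OF e], of i] ip[of i] by simp
    then show "c i * ell2_inner (e i) p = of_real ((cmod (c i))\<^sup>2)"
      by (simp add: complex_norm_square del: of_real_power)
  qed
  finally show "(ell2_norm p)\<^sup>2 = (\<Sum>i\<in>J. (cmod (c i))\<^sup>2)"
    by (simp only: of_real_sum[symmetric] of_real_eq_iff)
qed

lemma ell2_Bessel:
  assumes e: "ell2_orthonormal e" and J: "finite J" and x: "x \<in> ell2"
  shows "(\<Sum>i\<in>J. (cmod (ell2_inner x (e i)))\<^sup>2) \<le> (ell2_norm x)\<^sup>2"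
proof -
  define c where "c i = ell2_inner x (e i)" for i
  define p where "p = (\<lambda>n. \<Sum>i\<in>J. c i * e i n)"
  define q where "q = (\<lambda>n. x n - p n)"
  note fc = ell2_finite_combination[OF e J, of c, folded p_def]
  have q: "q \<in> ell2" unfolding q_def by (intro ell2_diff x fc)
  have pq: "ell2_inner p q = 0"
  proof -
    have "ell2_inner p q = (\<Sum>i\<in>J. c i * ell2_inner (e i) q)"
      unfolding p_def by (simp add: ell2_inner_sum_left q ell2_orthonormalD[OF e])
    also have "\<dots> = 0"
    proof (intro sum.neutral ballI)
      fix i assume "i \<in> J"
      then have "ell2_inner q (e i) = 0"
        unfolding q_def by (simp add: ell2_inner_diff_left x fc ell2_orthonormalD[OF e] c_def)
      then show "c i * ell2_inner (e i) q = 0"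
        using ell2_inner_commute[OF q ell2_orthonormalD(1)[OF e], of i] by simp
    qed
    finally show ?thesis .
  qed
  have xpq: "x = (\<lambda>n. p n + q n)" by (simp add: q_def)
  have "ell2_inner x x = ell2_inner p x + ell2_inner q x"
    by (subst xpq) (simp add: ell2_inner_add_left fc q x)
  also have "ell2_inner p x = ell2_inner p p"
    using ell2_inner_add_left[OF fc(1) q fc(1)] pq ell2_inner_commute[OF fc(1) q]
      ell2_inner_commute[OF x fc(1)] ell2_inner_commute[OF fc(1) fc(1)] xpq by simp
  also have "ell2_inner q x = ell2_inner q q"
    using ell2_inner_add_left[OF fc(1) q q] pq
      ell2_inner_commute[OF x q] ell2_inner_commute[OF q q] xpq by simp
  finally have "(ell2_norm x)\<^sup>2 = (ell2_norm p)\<^sup>2 + (ell2_norm q)\<^sup>2"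
    unfolding ell2_inner_self[OF x] ell2_inner_self[OF q] ell2_inner_self[OF fc(1)]
    by (simp only: of_real_add[symmetric] of_real_eq_iff)
  then show ?thesis
    using fc(3) by (simp add: c_def)
qed

lemma ell2_Bessel_summable:
  assumes e: "ell2_orthonormal e" and x: "x \<in> ell2"
  shows "summable (\<lambda>i. (cmod (ell2_inner x (e i)))\<^sup>2)"
  using ell2_Bessel[OF e _ x] by (intro summableI_nonneg_bounded) auto

text \<open>
  All orthonormal systems that occur here have only finitely many members that do not vanish at a
  given index, so that infinite linear combinations can be formed coordinatewise as finite sums.
\<close>

definition locally_finite :: "(nat \<Rightarrow> nat \<Rightarrow> complex) \<Rightarrow> bool" where
  "locally_finite f \<longleftrightarrow> (\<forall>m. finite {i. f i m \<noteq> 0})"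

definition lincomb :: "(nat \<Rightarrow> complex) \<Rightarrow> (nat \<Rightarrow> nat \<Rightarrow> complex) \<Rightarrow> nat \<Rightarrow> complex" where
  "lincomb c f m = (\<Sum>i | f i m \<noteq> 0. c i * f i m)"

lemma lincomb_superset:
  assumes "finite J" "{i. f i m \<noteq> 0} \<subseteq> J"
  shows "lincomb c f m = (\<Sum>i\<in>J. c i * f i m)"
  unfolding lincomb_def using assms by (intro sum.mono_neutral_left) auto

lemma lincomb_diff: "lincomb c f m - lincomb d f m = lincomb (\<lambda>i. c i - d i) f m"
  by (simp add: lincomb_def sum_subtractf ring_distribs)

lemma lincomb_finite_support:
  assumes "locally_finite f" "finite J" "\<And>i. i \<notin> J \<Longrightarrow> c i = 0"
  shows "lincomb c f m = (\<Sum>i\<in>J. c i * f i m)"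
proof -
  have "lincomb c f m = (\<Sum>i\<in>J \<union> {i. f i m \<noteq> 0}. c i * f i m)"
    using assms(1,2) by (intro lincomb_superset) (auto simp: locally_finite_def)
  also have "\<dots> = (\<Sum>i\<in>J. c i * f i m)"
    using assms by (intro sum.mono_neutral_right) (auto simp: locally_finite_def)
  finally show ?thesis .
qed

text \<open>The first M coordinates see only finitely many of the vectors, so there the combination
  agrees with a finite one, whose norm Pythagoras gives. The bound does not depend on M.\<close>

lemma lincomb_ell2:
  assumes f: "ell2_orthonormal f" and lf: "locally_finite f"
    and c: "summable (\<lambda>i. (cmod (c i))\<^sup>2)"
  shows "lincomb c f \<in> ell2" "(ell2_norm (lincomb c f))\<^sup>2 \<le> (\<Sum>i. (cmod (c i))\<^sup>2)"
proof -
  have "(\<Sum>m<M. (cmod (lincomb c f m))\<^sup>2) \<le> (\<Sum>i. (cmod (c i))\<^sup>2)" for M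
  proof -
    define J where "J = (\<Union>m<M. {i. f i m \<noteq> 0})"
    have J: "finite J" using lf by (auto simp: J_def locally_finite_def)
    note fc = ell2_finite_combination[OF f J, of c]
    have "(\<Sum>m<M. (cmod (lincomb c f m))\<^sup>2) = (\<Sum>m<M. (cmod (\<Sum>i\<in>J. c i * f i m))\<^sup>2)"
      using J by (intro sum.cong refl arg_cong[where f = "\<lambda>z. (cmod z)\<^sup>2"] lincomb_superset)
                 (auto simp: J_def)
    also have "\<dots> \<le> (\<Sum>i\<in>J. (cmod (c i))\<^sup>2)"
      using ell2_partial_le[OF fc(1), of "{..<M}"] fc(3) by simp
    also have "\<dots> \<le> (\<Sum>i. (cmod (c i))\<^sup>2)"
      using c J by (intro sum_le_suminf) auto
    finally show ?thesis .
  qed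
  from ell2_boundedI[OF this]
  show "lincomb c f \<in> ell2" "(ell2_norm (lincomb c f))\<^sup>2 \<le> (\<Sum>i. (cmod (c i))\<^sup>2)" .
qed

text \<open>The combination is defined coordinatewise, so its inner products are not termwise by
  definition. After splitting off the first K terms, Cauchy-Schwarz bounds the remainder by the tail
  of the square sum of the coefficients.\<close>

lemma lincomb_inner:
  assumes f: "ell2_orthonormal f" and lf: "locally_finite f"
    and c: "summable (\<lambda>i. (cmod (c i))\<^sup>2)"
  shows "ell2_inner (lincomb c f) (f j) = c j"
proof -
  define r where "r K = (\<lambda>i. if i < K then 0 else c i)" for K :: nat
  define t where "t K = (\<Sum>i. (cmod (r K i))\<^sup>2)" for K
  have t_eq: "t K = (\<Sum>i. (cmod (c (i + K)))\<^sup>2)" and rs: "summable (\<lambda>i. (cmod (r K i))\<^sup>2)" for K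
  proof -
    have "summable (\<lambda>i. (cmod (c (i + K)))\<^sup>2)"
      using c by (subst summable_iff_shift) simp_all
    then have "summable (\<lambda>i. (cmod (r K (i + K)))\<^sup>2)"
      by (simp add: r_def)
    then show s: "summable (\<lambda>i. (cmod (r K i))\<^sup>2)"
      by (subst (asm) summable_iff_shift)
    show "t K = (\<Sum>i. (cmod (c (i + K)))\<^sup>2)"
      unfolding t_def using suminf_split_initial_segment[OF s, of K] by (simp add: r_def)
  qed
  have t0: "t \<longlonglongrightarrow> 0"
    using suminf_exist_split2[OF c] unfolding t_eq .
  have bound: "cmod (ell2_inner (lincomb c f) (f j) - c j) \<le> sqrt (t K)" if "j < K" for K
  proof -
    define p where "p = (\<lambda>n. \<Sum>i<K. c i * f i n)"
    note fc = ell2_finite_combination[OF f, of "{..<K}" c, folded p_def, simplified]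
    have "p n = lincomb (\<lambda>i. c i - r K i) f n" for n
      unfolding p_def by (subst lincomb_finite_support[OF lf, of "{..<K}"]) (auto simp: r_def)
    then have dec: "lincomb c f = (\<lambda>n. p n + lincomb (r K) f n)"
      by (auto simp: fun_eq_iff lincomb_diff[symmetric])
    note lr = lincomb_ell2[OF f lf rs[of K]]
    have "ell2_inner (lincomb c f) (f j) = c j + ell2_inner (lincomb (r K) f) (f j)"
      unfolding dec using that
      by (simp add: ell2_inner_add_left fc lr ell2_orthonormalD[OF f])
    moreover have "cmod (ell2_inner (lincomb (r K) f) (f j)) \<le> ell2_norm (lincomb (r K) f) * ell2_norm (f j)"
      by (intro ell2_Cauchy_Schwarz lr ell2_orthonormalD[OF f])
    moreover have "ell2_norm (f j) = 1" by (rule ell2_orthonormal_norm[OF f])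
    moreover have "ell2_norm (lincomb (r K) f) \<le> sqrt (t K)"
      using lr by (intro real_le_rsqrt) (auto simp: t_def)
    ultimately show ?thesis by simp
  qed
  have "(\<lambda>K. sqrt (t K)) \<longlonglongrightarrow> sqrt 0"
    by (intro tendsto_intros t0)
  then have "cmod (ell2_inner (lincomb c f) (f j) - c j) \<le> sqrt 0"
    using bound by (intro LIMSEQ_le_const[where X = "\<lambda>K. sqrt (t K)"]) (auto intro!: exI[of _ "Suc j"])
  then show ?thesis by simp
qed

section \<open>Singular value decompositions of infinite matrices\<close>

text \<open>The sum of the rank-one matrices with weight \<open>s i\<close>, left vector
  \<open>f i\<close> and right vector \<open>e i\<close>. Each entry is a finite sum when
  \<open>f\<close> is locally finite.\<close>

definition svd_matrix ::
    "(nat \<Rightarrow> real) \<Rightarrow> (nat \<Rightarrow> nat \<Rightarrow> complex) \<Rightarrow> (nat \<Rightarrow> nat \<Rightarrow> complex) \<Rightarrow> nat \<Rightarrow> nat \<Rightarrow> complex" where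
  "svd_matrix s f e m n = lincomb (\<lambda>i. of_real (s i) * cnj (e i n)) f m"

lemma svd_matrix_adj:
  assumes "locally_finite e" "locally_finite f"
  shows "mat_adj (svd_matrix s f e) = svd_matrix s e f"
proof (intro ext)
  fix m n
  \<comment> \<open>The two matrices sum over different finite index sets; on the union the terms
    are symmetric in \<open>e\<close> and \<open>f\<close>.\<close>
  have fin: "finite ({i. f i n \<noteq> 0} \<union> {i. e i m \<noteq> 0})"
    using assms by (auto simp: locally_finite_def)
  show "mat_adj (svd_matrix s f e) m n = svd_matrix s e f m n"
    unfolding mat_adj_def svd_matrix_def
    by (subst (1 2) lincomb_superset[OF fin]) (auto simp: mult_ac)
qed

lemma svd_matrix_apply:
  assumes e: "\<And>i. e i \<in> ell2" and lf: "locally_finite f" and x: "x \<in> ell2"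
  shows "summable (\<lambda>n. svd_matrix s f e m n * x n)"
    "mat_apply (svd_matrix s f e) x m = lincomb (\<lambda>i. of_real (s i) * ell2_inner x (e i)) f m"
proof -
  have eq: "svd_matrix s f e m n * x n =
      (\<Sum>i | f i m \<noteq> 0. of_real (s i) * f i m * (x n * cnj (e i n)))" for n
    unfolding svd_matrix_def lincomb_def sum_distrib_right by (intro sum.cong) auto
  show "summable (\<lambda>n. svd_matrix s f e m n * x n)"
    unfolding eq by (intro summable_sum summable_mult ell2_summable_inner' x e)
  show "mat_apply (svd_matrix s f e) x m = lincomb (\<lambda>i. of_real (s i) * ell2_inner x (e i)) f m"
    unfolding mat_apply_def eq lincomb_def ell2_inner_def
    by (subst suminf_sum, intro summable_mult ell2_summable_inner' x e)
       (auto intro!: sum.cong simp: suminf_mult ell2_summable_inner' x e)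
qed

lemma bounded_weight_summable:
  assumes s: "\<And>i. 0 \<le> s i" "\<And>i. s i \<le> (B::real)" and c: "summable (\<lambda>i. (cmod (c i))\<^sup>2)"
  shows "summable (\<lambda>i. (cmod (of_real (s i) * c i))\<^sup>2)"
proof (rule summable_comparison_test')
  show "summable (\<lambda>i. B\<^sup>2 * (cmod (c i))\<^sup>2)"
    by (intro summable_mult c)
  show "norm ((cmod (of_real (s i) * c i))\<^sup>2) \<le> B\<^sup>2 * (cmod (c i))\<^sup>2" for i
    using s[of i] by (auto simp: norm_mult power_mult_distrib intro!: mult_right_mono power_mono)
qed

text \<open>Tychonoff replaces the diagonal argument: a countable product of closed discs is
  compact, hence sequentially compact, and convergence in it is coordinatewise.\<close>

lemma bounded_sequences_diagonal:
  fixes c :: "nat \<Rightarrow> nat \<Rightarrow> complex"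
  assumes "\<And>k i. cmod (c k i) \<le> 1"
  obtains l r where "strict_mono (r :: nat \<Rightarrow> nat)" "\<And>i. (\<lambda>k. c (r k) i) \<longlonglongrightarrow> l i"
proof -
  have "compact (PiE UNIV (\<lambda>_::nat. cball (0::complex) 1))"
    using compactin_PiE[of "\<lambda>_. euclidean" UNIV "\<lambda>_::nat. cball (0::complex) 1"]
    by (simp add: euclidean_product_topology)
  then have "seq_compact (PiE UNIV (\<lambda>_::nat. cball (0::complex) 1))"
    by (rule compact_imp_seq_compact)
  moreover have "\<forall>k. c k \<in> PiE UNIV (\<lambda>_. cball 0 1)"
    using assms by auto
  ultimately obtain l and r :: "nat \<Rightarrow> nat" where r: "strict_mono r" "(c \<circ> r) \<longlonglongrightarrow> l"
    by (rule seq_compactE) auto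
  have "(\<lambda>k. (c \<circ> r) k i) \<longlonglongrightarrow> l i" for i
    using continuous_on_tendsto_compose[OF continuous_on_product_coordinates[of i] r(2)] by simp
  then show ?thesis
    using r(1) by (intro that[of r l]) simp_all
qed

text \<open>Along a subsequence all coefficients with respect to \<open>e\<close> converge. The
  images then converge in norm, because the weights beyond index K are at most \<open>s K\<close>,
  which is small, while finitely many coefficients are controlled directly.\<close>

lemma svd_matrix_compact:
  assumes e: "ell2_orthonormal e" and f: "ell2_orthonormal f" and lf: "locally_finite f"
    and s: "decseq s" "\<And>i. 0 \<le> s i" "s \<longlonglongrightarrow> 0"
  shows "defines_compact_operator (svd_matrix s f e)"
proof -
  have s0: "s i \<le> s 0" for i using s(1) by (simp add: decseq_def)
  note e2 = ell2_orthonormalD(1)[OF e]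
  have app: "mat_apply (svd_matrix s f e) x = lincomb (\<lambda>i. of_real (s i) * ell2_inner x (e i)) f"
    if "x \<in> ell2" for x using svd_matrix_apply(2)[OF e2 lf that] by auto
  have "defines_operator (svd_matrix s f e)"
    unfolding defines_operator_def
    using svd_matrix_apply(1)[OF e2 lf] app
      lincomb_ell2(1)[OF f lf bounded_weight_summable[OF s(2) s0 ell2_Bessel_summable[OF e]]]
    by auto
  moreover have "\<exists>y\<in>ell2. \<exists>r :: nat \<Rightarrow> nat. strict_mono r \<and>
      (\<lambda>k. ell2_norm (\<lambda>m. mat_apply (svd_matrix s f e) (X (r k)) m - y m)) \<longlonglongrightarrow> 0"
    if X: "\<And>k. X k \<in> ell2" "\<And>k. ell2_norm (X k) \<le> 1" for X
  proof -
    define c where "c k i = ell2_inner (X k) (e i)" for k i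
    have bes: "(\<Sum>i\<in>J. (cmod (c k i))\<^sup>2) \<le> 1" if "finite J" for k J
    proof -
      have "(ell2_norm (X k))\<^sup>2 \<le> 1"
        using X(2)[of k] ell2_norm_nonneg[OF X(1)] by (simp add: power_le_one)
      then show ?thesis
        using ell2_Bessel[OF e that X(1)[of k]] by (simp add: c_def)
    qed
    have "cmod (c k i) \<le> 1" for k i
      using bes[of "{i}" k] by (simp add: abs_square_le_1)
    then obtain l r where r: "strict_mono (r :: nat \<Rightarrow> nat)" and lim: "\<And>i. (\<lambda>k. c (r k) i) \<longlonglongrightarrow> l i"
      using bounded_sequences_diagonal by blast
    have l_bes: "(\<Sum>i\<in>J. (cmod (l i))\<^sup>2) \<le> 1" if "finite J" for J
    proof (rule LIMSEQ_le_const2)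
      show "(\<lambda>k. \<Sum>i\<in>J. (cmod (c (r k) i))\<^sup>2) \<longlonglongrightarrow> (\<Sum>i\<in>J. (cmod (l i))\<^sup>2)"
        by (intro tendsto_intros lim)
    qed (use bes[OF that] in auto)
    define d where "d k i = c (r k) i - l i" for k i
    \<comment> \<open>The 4 comes from \<open>(a + b)^2 <= 2 a^2 + 2 b^2\<close> and square sums at
      most 1 for both \<open>c (r k)\<close> and the limit \<open>l\<close>.\<close>
    have d_bes: "(\<Sum>i\<in>J. (cmod (d k i))\<^sup>2) \<le> 4" if "finite J" for J k
    proof -
      have "(cmod (d k i))\<^sup>2 \<le> 2 * (cmod (c (r k) i))\<^sup>2 + 2 * (cmod (l i))\<^sup>2" for i
      proof -
        have "(cmod (d k i))\<^sup>2 \<le> (cmod (c (r k) i) + cmod (l i))\<^sup>2"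
          unfolding d_def by (intro power_mono norm_triangle_ineq4) auto
        also have "\<dots> \<le> 2 * (cmod (c (r k) i))\<^sup>2 + 2 * (cmod (l i))\<^sup>2"
          using sum_squares_bound[of "cmod (c (r k) i)" "cmod (l i)"] by (simp add: power2_sum)
        finally show ?thesis .
      qed
      then have "(\<Sum>i\<in>J. (cmod (d k i))\<^sup>2) \<le> (\<Sum>i\<in>J. 2 * (cmod (c (r k) i))\<^sup>2 + 2 * (cmod (l i))\<^sup>2)"
        by (intro sum_mono)
      then show ?thesis
        using bes[OF that, of "r k"] l_bes[OF that] by (simp add: sum.distrib sum_distrib_left[symmetric])
    qed
    have l_sum: "summable (\<lambda>i. (cmod (l i))\<^sup>2)"
      using l_bes by (intro summableI_nonneg_bounded[where x = 1]) auto
    have d_sum: "summable (\<lambda>i. (cmod (d k i))\<^sup>2)" for k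
      using d_bes by (intro summableI_nonneg_bounded[where x = 4]) auto
    define y where "y = lincomb (\<lambda>i. of_real (s i) * l i) f"
    have y: "y \<in> ell2"
      unfolding y_def by (intro lincomb_ell2(1)[OF f lf] bounded_weight_summable[OF s(2) s0] l_sum)
    define u where "u k = (\<lambda>m. mat_apply (svd_matrix s f e) (X (r k)) m - y m)" for k
    have u_eq: "u k = lincomb (\<lambda>i. of_real (s i) * d k i) f" for k
      unfolding u_def y_def app[OF X(1)] lincomb_diff by (simp add: d_def c_def ring_distribs)
    have wd: "summable (\<lambda>i. (cmod (of_real (s i) * d k i))\<^sup>2)" for k
      by (intro bounded_weight_summable[OF s(2) s0] d_sum)
    have u2: "u k \<in> ell2" for k
      unfolding u_eq by (rule lincomb_ell2(1)[OF f lf wd])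
    \<comment> \<open>The second term is uniform in \<open>k\<close>: K is chosen first to make it
      small, then \<open>k\<close> to make the finite sum small.\<close>
    have split: "(ell2_norm (u k))\<^sup>2 \<le> (\<Sum>i<K. (cmod (of_real (s i) * d k i))\<^sup>2) + 4 * (s K)\<^sup>2" for k K
    proof -
      have "(ell2_norm (u k))\<^sup>2 \<le> (\<Sum>i. (cmod (of_real (s i) * d k i))\<^sup>2)"
        unfolding u_eq by (rule lincomb_ell2(2)[OF f lf wd])
      also have "\<dots> = (\<Sum>i<K. (cmod (of_real (s i) * d k i))\<^sup>2) + (\<Sum>i. (cmod (of_real (s (i + K)) * d k (i + K)))\<^sup>2)"
        using suminf_split_initial_segment[OF wd, of k K] by simp
      also have "(\<Sum>i. (cmod (of_real (s (i + K)) * d k (i + K)))\<^sup>2) \<le> 4 * (s K)\<^sup>2"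
      proof (rule suminf_le_const)
        show "summable (\<lambda>i. (cmod (of_real (s (i + K)) * d k (i + K)))\<^sup>2)"
          using wd[of k] by (subst summable_iff_shift[where f = "\<lambda>i. (cmod (of_real (s i) * d k i))\<^sup>2"])
        fix N
        have "(\<Sum>i<N. (cmod (of_real (s (i + K)) * d k (i + K)))\<^sup>2) \<le> (\<Sum>i<N. (s K)\<^sup>2 * (cmod (d k (i + K)))\<^sup>2)"
          using s(1,2) by (intro sum_mono)
            (auto simp: norm_mult power_mult_distrib decseq_def intro!: mult_right_mono power_mono)
        also have "\<dots> = (s K)\<^sup>2 * (\<Sum>i\<in>(\<lambda>i. i + K) ` {..<N}. (cmod (d k i))\<^sup>2)"
          by (subst sum.reindex) (auto simp: sum_distrib_left inj_on_def)
        also have "\<dots> \<le> (s K)\<^sup>2 * 4"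
          by (intro mult_left_mono d_bes) auto
        finally show "(\<Sum>i<N. (cmod (of_real (s (i + K)) * d k (i + K)))\<^sup>2) \<le> 4 * (s K)\<^sup>2" by simp
      qed
      finally show ?thesis by simp
    qed
    have d0: "(\<lambda>k. d k i) \<longlonglongrightarrow> 0" for i
      unfolding d_def using tendsto_diff[OF lim[of i] tendsto_const[of "l i"]] by simp
    have fin0: "(\<lambda>k. \<Sum>i<K. (cmod (of_real (s i) * d k i))\<^sup>2) \<longlonglongrightarrow> 0" for K
      by (rule tendsto_eq_intros d0 | simp)+
    have s20: "(\<lambda>K. 4 * (s K)\<^sup>2) \<longlonglongrightarrow> 0"
      by (rule tendsto_eq_intros s(3) | simp)+
    have "(\<lambda>k. (ell2_norm (u k))\<^sup>2) \<longlonglongrightarrow> 0"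
    proof (rule LIMSEQ_I)
      fix \<epsilon> :: real assume \<epsilon>: "\<epsilon> > 0"
      have "eventually (\<lambda>K. 4 * (s K)\<^sup>2 < \<epsilon> / 2) sequentially"
        using order_tendstoD(2)[OF s20, of "\<epsilon> / 2"] \<epsilon> by simp
      then obtain K where K: "4 * (s K)\<^sup>2 < \<epsilon> / 2"
        by (auto simp: eventually_sequentially)
      have "eventually (\<lambda>k. (\<Sum>i<K. (cmod (of_real (s i) * d k i))\<^sup>2) < \<epsilon> / 2) sequentially"
        using order_tendstoD(2)[OF fin0, of "\<epsilon> / 2"] \<epsilon> by simp
      then have "eventually (\<lambda>k. norm ((ell2_norm (u k))\<^sup>2 - 0) < \<epsilon>) sequentially"
      proof eventually_elim
        case (elim k)
        then show ?case using split[of k K] K by simp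
      qed
      then show "\<exists>no. \<forall>n\<ge>no. norm ((ell2_norm (u n))\<^sup>2 - 0) < \<epsilon>"
        by (simp add: eventually_sequentially)
    qed
    then have "(\<lambda>k. sqrt ((ell2_norm (u k))\<^sup>2)) \<longlonglongrightarrow> sqrt 0"
      by (rule tendsto_real_sqrt)
    then have "(\<lambda>k. ell2_norm (u k)) \<longlonglongrightarrow> 0"
      by (simp add: ell2_norm_nonneg[OF u2])
    then show ?thesis
      using y r unfolding u_def by blast
  qed
  ultimately show ?thesis
    unfolding defines_compact_operator_def by blast
qed

section \<open>Eigenspaces and the singular value sequence\<close>

interpretation cseq: vector_space cseq_scale
  by (rule vector_space_cseq_scale)

lemma ell2_orthonormal_inj:
  assumes "ell2_orthonormal e"
  shows "inj e"
proof (rule injI, rule ccontr)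
  fix i j assume "e i = e j" "i \<noteq> j"
  then show False
    using ell2_orthonormalD(2)[OF assms, of i j] ell2_orthonormalD(2)[OF assms, of j j] by simp
qed

lemma ell2_sum_fun: "(\<Sum>i\<in>J. (x i :: nat \<Rightarrow> complex)) = (\<lambda>n. \<Sum>i\<in>J. x i n)"
  by (induction J rule: infinite_finite_induct) auto

lemma ell2_orthonormal_independent:
  assumes e: "ell2_orthonormal e" and J: "finite J"
  shows "\<not> cseq.dependent (e ` J)"
proof
  assume "cseq.dependent (e ` J)"
  then obtain u where u: "(\<Sum>v\<in>e ` J. cseq_scale (u v) v) = 0" "\<exists>v\<in>e ` J. u v \<noteq> 0"
    using J by (subst (asm) cseq.dependent_finite) auto
  define p where "p = (\<lambda>n. \<Sum>i\<in>J. u (e i) * e i n)"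
  have "(\<Sum>v\<in>e ` J. cseq_scale (u v) v) = p"
    using ell2_orthonormal_inj[OF e]
    by (subst sum.reindex) (auto simp: inj_on_def inj_def ell2_sum_fun cseq_scale_def p_def)
  then have p0: "p = (\<lambda>_. 0)"
    using u(1) by (auto simp: fun_eq_iff)
  have "u (e j) = 0" if "j \<in> J" for j
    using ell2_finite_combination(2)[OF e J, of "\<lambda>i. u (e i)" j] that
    unfolding p_def[symmetric] p0 by (simp add: ell2_inner_zero_left)
  then show False using u(2) by auto
qed

text \<open>The adjoint times the matrix acts diagonally on \<open>e\<close> with eigenvalues
  \<open>(s i)^2\<close>. Comparing coefficients kills those with
  \<open>s i \<noteq> \<sigma>\<close>. The system \<open>e\<close> may be incomplete, but since
  \<open>\<sigma> > 0\<close> the eigenvalue equation itself writes the eigenvector as a combination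
  of the \<open>e i\<close>.\<close>

lemma svd_matrix_singular_space:
  assumes e: "ell2_orthonormal e" and f: "ell2_orthonormal f"
    and lfe: "locally_finite e" and lf: "locally_finite f"
    and s: "decseq s" "\<And>i. 0 \<le> s i" and fin: "finite {i. s i = \<sigma>}" and \<sigma>: "\<sigma> > 0"
  shows "singular_space (svd_matrix s f e) \<sigma> = cseq.span (e ` {i. s i = \<sigma>})"
proof -
  define J where "J = {i. s i = \<sigma>}"
  have s0: "s i \<le> s 0" for i using s(1) by (simp add: decseq_def)
  note e2 = ell2_orthonormalD(1)[OF e] and f2 = ell2_orthonormalD(1)[OF f]
  have AA: "mat_apply (mat_adj (svd_matrix s f e)) (mat_apply (svd_matrix s f e) x) =
      lincomb (\<lambda>i. of_real ((s i)\<^sup>2) * ell2_inner x (e i)) e"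
    and sm: "summable (\<lambda>i. (cmod (of_real ((s i)\<^sup>2) * ell2_inner x (e i)))\<^sup>2)"
    if x: "x \<in> ell2" for x
  proof -
    have A: "mat_apply (svd_matrix s f e) x = lincomb (\<lambda>i. of_real (s i) * ell2_inner x (e i)) f"
      using svd_matrix_apply(2)[OF e2 lf x] by auto
    have w: "summable (\<lambda>i. (cmod (of_real (s i) * ell2_inner x (e i)))\<^sup>2)"
      by (intro bounded_weight_summable[OF s(2) s0] ell2_Bessel_summable[OF e x])
    note Ax = lincomb_ell2(1)[OF f lf w]
    show "mat_apply (mat_adj (svd_matrix s f e)) (mat_apply (svd_matrix s f e) x) =
      lincomb (\<lambda>i. of_real ((s i)\<^sup>2) * ell2_inner x (e i)) e"
      unfolding A svd_matrix_adj[OF lfe lf]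
      by (rule ext) (simp add: svd_matrix_apply(2)[OF f2 lfe Ax] lincomb_inner[OF f lf w]
          power2_eq_square mult.assoc)
    show "summable (\<lambda>i. (cmod (of_real ((s i)\<^sup>2) * ell2_inner x (e i)))\<^sup>2)"
      using bounded_weight_summable[OF s(2) s0 w] by (simp add: power2_eq_square mult.assoc)
  qed
  show ?thesis
    unfolding J_def[symmetric]
  proof (intro equalityI subsetI)
    fix x assume "x \<in> singular_space (svd_matrix s f e) \<sigma>"
    then have x: "x \<in> ell2"
      and eq: "lincomb (\<lambda>i. of_real ((s i)\<^sup>2) * ell2_inner x (e i)) e = (\<lambda>n. of_real (\<sigma>\<^sup>2) * x n)"
      using AA by (auto simp: singular_space_def)
    have zero: "ell2_inner x (e j) = 0" if "j \<notin> J" for j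
    proof -
      have "of_real ((s j)\<^sup>2) * ell2_inner x (e j) = of_real (\<sigma>\<^sup>2) * ell2_inner x (e j)"
        using lincomb_inner[OF e lfe sm[OF x], of j] ell2_inner_scale_left[OF x e2[of j], of "of_real (\<sigma>\<^sup>2)"]
        unfolding eq by simp
      moreover have "(s j)\<^sup>2 \<noteq> \<sigma>\<^sup>2"
        using that s(2)[of j] \<sigma> by (auto simp: J_def power2_eq_iff)
      ultimately show ?thesis
        by (metis mult_cancel_right of_real_eq_iff)
    qed
    have xn: "x n = (\<Sum>i\<in>J. ell2_inner x (e i) * e i n)" for n
    proof -
      have "of_real (\<sigma>\<^sup>2) * x n = lincomb (\<lambda>i. of_real ((s i)\<^sup>2) * ell2_inner x (e i)) e n"
        using eq by simp
      also have "\<dots> = (\<Sum>i\<in>J. of_real ((s i)\<^sup>2) * ell2_inner x (e i) * e i n)"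
        using zero fin by (intro lincomb_finite_support[OF lfe]) (auto simp: J_def)
      also have "\<dots> = of_real (\<sigma>\<^sup>2) * (\<Sum>i\<in>J. ell2_inner x (e i) * e i n)"
        unfolding sum_distrib_left by (intro sum.cong) (auto simp: J_def)
      finally show ?thesis using \<sigma> by simp
    qed
    have "x = (\<Sum>i\<in>J. cseq_scale (ell2_inner x (e i)) (e i))"
      unfolding ell2_sum_fun using xn by (auto simp: cseq_scale_def)
    also have "\<dots> \<in> cseq.span (e ` J)"
      by (intro cseq.span_sum cseq.span_scale cseq.span_base) auto
    finally show "x \<in> cseq.span (e ` J)" .
  next
    fix x assume "x \<in> cseq.span (e ` J)"
    then obtain u where "x = (\<Sum>v\<in>e ` J. cseq_scale (u v) v)"
      using fin by (subst (asm) cseq.span_finite) (auto simp: J_def)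
    then have x_eq: "x = (\<lambda>n. \<Sum>i\<in>J. u (e i) * e i n)"
      using ell2_orthonormal_inj[OF e]
      by (subst (asm) sum.reindex) (auto simp: inj_on_def inj_def ell2_sum_fun cseq_scale_def)
    have J: "finite J" using fin by (simp add: J_def)
    note fc = ell2_finite_combination[OF e J, of "\<lambda>i. u (e i)", folded x_eq]
    have "lincomb (\<lambda>i. of_real ((s i)\<^sup>2) * ell2_inner x (e i)) e n = of_real (\<sigma>\<^sup>2) * x n" for n
    proof -
      have "lincomb (\<lambda>i. of_real ((s i)\<^sup>2) * ell2_inner x (e i)) e n =
          (\<Sum>i\<in>J. of_real ((s i)\<^sup>2) * ell2_inner x (e i) * e i n)"
        using fc(2) by (intro lincomb_finite_support[OF lfe J]) simp
      also have "\<dots> = of_real (\<sigma>\<^sup>2) * x n"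
        unfolding fc(2) by (subst x_eq) (auto simp: J_def sum_distrib_left mult.assoc intro!: sum.cong)
      finally show ?thesis .
    qed
    then show "x \<in> singular_space (svd_matrix s f e) \<sigma>"
      using AA[OF fc(1)] fc(1) by (auto simp: singular_space_def)
  qed
qed

text \<open>Since \<open>s\<close> tends to 0, each positive value is taken finitely often, and the
  corresponding vectors \<open>e i\<close> form a basis of the eigenspace. This matches
  multiplicities with dimensions.\<close>

lemma svd_matrix_schatten:
  assumes e: "ell2_orthonormal e" and f: "ell2_orthonormal f"
    and lfe: "locally_finite e" and lf: "locally_finite f"
    and s: "decseq s" "\<And>i. 0 \<le> s i" "s \<longlonglongrightarrow> 0" and sp: "summable (\<lambda>i. s i powr p)"
  shows "schatten_class p (svd_matrix s f e)"
proof -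
  have "card {k. s k = \<sigma>} = cseq.dim (singular_space (svd_matrix s f e) \<sigma>)" if \<sigma>: "\<sigma> > 0" for \<sigma>
  proof -
    have "eventually (\<lambda>k. s k < \<sigma>) sequentially"
      using order_tendstoD(2)[OF s(3) \<sigma>] .
    then obtain K where "\<And>k. k \<ge> K \<Longrightarrow> s k < \<sigma>"
      by (auto simp: eventually_sequentially)
    then have "{k. s k = \<sigma>} \<subseteq> {..<K}"
      by (metis (mono_tags, lifting) lessThan_iff less_irrefl mem_Collect_eq not_less subsetI)
    then have fin: "finite {k. s k = \<sigma>}"
      by (rule finite_subset) simp
    have "cseq.dim (singular_space (svd_matrix s f e) \<sigma>) = card (e ` {k. s k = \<sigma>})"
      unfolding svd_matrix_singular_space[OF e f lfe lf s(1,2) fin \<sigma>] cseq.dim_span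
      by (rule cseq.dim_eq_card_independent[OF ell2_orthonormal_independent[OF e fin]])
    also have "\<dots> = card {k. s k = \<sigma>}"
      using ell2_orthonormal_inj[OF e] by (intro card_image) (auto simp: inj_on_def inj_def)
    finally show ?thesis by simp
  qed
  then have "singular_value_sequence (svd_matrix s f e) s"
    unfolding singular_value_sequence_def using s by auto
  then show ?thesis
    unfolding schatten_class_def using svd_matrix_compact[OF e f lf s] sp by blast
qed

text \<open>Ties between equal weights are broken by the enumeration of the countable index set.\<close>

lemma decreasing_enumeration:
  fixes w :: "'a \<Rightarrow> real"
  assumes inf: "infinite I" and count: "countable I" and pos: "\<And>i. i \<in> I \<Longrightarrow> 0 < w i"
    and fin: "\<And>\<epsilon>. \<epsilon> > 0 \<Longrightarrow> finite {i \<in> I. \<epsilon> \<le> w i}"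
  obtains r :: "nat \<Rightarrow> 'a" where "bij_betw r UNIV I" "decseq (\<lambda>n. w (r n))" "(\<lambda>n. w (r n)) \<longlonglongrightarrow> 0"
proof -
  define prec where "prec i j \<longleftrightarrow> w i > w j \<or> w i = w j \<and> to_nat_on I i < to_nat_on I j" for i j
  \<comment> \<open>The rank of \<open>i\<close>: everything preceding \<open>i\<close> has weight
    at least \<open>w i > 0\<close>, so only finitely many elements are counted.\<close>
  define g where "g i = card {j \<in> I. prec j i}" for i
  have seg: "finite {j \<in> I. prec j i}" if "i \<in> I" for i
    by (rule finite_subset[OF _ fin[OF pos[OF that]]]) (auto simp: prec_def)
  have g_mono: "g i < g j" if "i \<in> I" "j \<in> I" "prec i j" for i j
    unfolding g_def using that by (intro psubset_card_mono seg) (auto simp: prec_def)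
  have total: "prec i j \<or> prec j i" if "i \<in> I" "j \<in> I" "i \<noteq> j" for i j
    using that inj_on_to_nat_on[OF count] unfolding prec_def inj_on_def
    by (metis linorder_neqE)
  have inj: "inj_on g I"
    using g_mono total by (metis inj_onI less_irrefl)
  have gw: "w j \<le> w i" if "i \<in> I" "j \<in> I" "g i \<le> g j" for i j
    using g_mono[of j i] that by (cases "prec j i") (auto simp: prec_def)
  define r where "r = inv_into I g \<circ> enumerate (g ` I)"
  have infg: "infinite (g ` I)"
    using inf inj finite_imageD by blast
  have bij: "bij_betw r UNIV I"
    unfolding r_def
    by (intro bij_betw_trans[OF bij_enumerate[OF infg]] bij_betw_inv_into inj_on_imp_bij_betw inj)
  have rI: "r n \<in> I" for n using bij by (auto simp: bij_betw_def)
  have gr: "g (r n) = enumerate (g ` I) n" for n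
    unfolding r_def by (simp add: f_inv_into_f enumerate_in_set[OF infg])
  have dec: "decseq (\<lambda>n. w (r n))"
    unfolding decseq_def
  proof (intro allI impI)
    fix m n :: nat assume "m \<le> n"
    then have "enumerate (g ` I) m \<le> enumerate (g ` I) n"
      by (intro enumerate_mono_le_iff[OF infg, THEN iffD2])
    then show "w (r n) \<le> w (r m)"
      by (intro gw rI) (simp add: gr)
  qed
  have "(\<lambda>n. w (r n)) \<longlonglongrightarrow> 0"
  proof (rule LIMSEQ_I)
    fix \<epsilon> :: real assume \<epsilon>: "\<epsilon> > 0"
    have "\<exists>n. w (r n) < \<epsilon>"
    proof (rule ccontr)
      assume "\<nexists>n. w (r n) < \<epsilon>"
      then have "range r \<subseteq> {i \<in> I. \<epsilon> \<le> w i}"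
        using rI by (auto simp: not_less)
      then have "finite I"
        using fin[OF \<epsilon>] bij finite_subset by (auto simp: bij_betw_def)
      then show False using inf by simp
    qed
    then obtain N where "w (r N) < \<epsilon>" by blast
    then have "\<forall>n\<ge>N. norm (w (r n) - 0) < \<epsilon>"
      using dec pos[OF rI] by (fastforce simp: decseq_def abs_of_pos)
    then show "\<exists>N. \<forall>n\<ge>N. norm (w (r n) - 0) < \<epsilon>" by blast
  qed
  with bij dec show ?thesis by (rule that)
qed

section \<open>Integration over the infinite torus\<close>

interpretation circle: prob_space circle_measure
  by (rule prob_space_circle_measure)

interpretation torus: prob_space torus
  by (rule prob_space_torus)

lemma sets_circle_measure [measurable_cong]:
  "sets circle_measure = sets (restrict_space borel (sphere 0 1))"
  by (simp add: circle_measure_def)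

lemma space_circle_measure [simp]: "space circle_measure = sphere 0 1"
  by (simp add: circle_measure_def space_restrict_space)

lemma measurable_circle_measure: "f \<in> borel_measurable borel \<Longrightarrow> f \<in> borel_measurable circle_measure"
  unfolding measurable_cong_sets[OF sets_circle_measure refl]
  by (rule measurable_restrict_space1)

lemma circle_integral:
  fixes f :: "complex \<Rightarrow> 'a::euclidean_space"
  assumes f: "continuous_on UNIV f"
  shows "(\<integral>z. f z \<partial>circle_measure) = (1 / (2 * pi)) *\<^sub>R integral {0..2*pi} (\<lambda>t. f (cis t))"
proof -
  have [measurable]: "f \<in> borel_measurable borel"
    by (rule borel_measurable_continuous_onI[OF f])
  have cis: "cis \<in> uniform_measure lborel {0..2*pi} \<rightarrow>\<^sub>M restrict_space borel (sphere 0 1)"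
  proof (rule measurable_restrict_space2)
    have "cis \<in> borel_measurable borel"
      by (auto intro!: borel_measurable_continuous_onI continuous_intros)
    then show "cis \<in> borel_measurable (uniform_measure lborel {0..2*pi})"
      by (simp cong: measurable_cong_sets)
  qed auto
  have cont: "continuous_on {0..2*pi} (\<lambda>t. f (cis t))"
    by (intro continuous_on_compose2[OF f] continuous_intros) auto
  have cont': "continuous_on UNIV (\<lambda>t. f (cis t))"
    by (intro continuous_on_compose2[OF f] continuous_intros) auto
  have "(\<integral>z. f z \<partial>circle_measure) = (\<integral>t. f (cis t) \<partial>uniform_measure lborel {0..2*pi})"
    unfolding circle_measure_def
    by (intro integral_distr cis measurable_restrict_space1) measurable
  also have "uniform_measure lborel {0..2*pi} =
      density lborel (\<lambda>t. ennreal (indicator {0..2*pi} t / (2 * pi)))"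
    unfolding uniform_measure_def
    by (intro density_cong) (auto simp: indicator_def divide_ennreal[symmetric])
  also have "(\<integral>t. f (cis t) \<partial>\<dots>) = (\<integral>t. (indicator {0..2*pi} t / (2 * pi)) *\<^sub>R f (cis t) \<partial>lborel)"
    using borel_measurable_continuous_onI[OF cont'] by (intro integral_density) auto
  also have "\<dots> = (1 / (2 * pi)) *\<^sub>R (\<integral>t. indicator {0..2*pi} t *\<^sub>R f (cis t) \<partial>lborel)"
    by (subst integral_scaleR_right[symmetric]) simp
  also have "(\<integral>t. indicator {0..2*pi} t *\<^sub>R f (cis t) \<partial>lborel) = integral {0..2*pi} (\<lambda>t. f (cis t))"
    using set_borel_integral_eq_integral(2)[OF borel_integrable_atLeastAtMost'[OF cont]]
    by (simp add: set_lebesgue_integral_def)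
  finally show ?thesis .
qed

lemma circle_integral_power:
  "(\<integral>z. z ^ a * cnj z ^ b \<partial>circle_measure) = (if a = b then 1 else 0)"
proof -
  have "(\<integral>z. z ^ a * cnj z ^ b \<partial>circle_measure) =
      (1 / (2 * pi)) *\<^sub>R integral {0..2*pi} (\<lambda>t. cis t ^ a * cnj (cis t) ^ b)"
    by (rule circle_integral) (intro continuous_intros)
  also have "(\<lambda>t. cis t ^ a * cnj (cis t) ^ b) = (\<lambda>t. cis ((real a - real b) * t))"
    by (simp add: cis_cnj Complex.DeMoivre cis_mult left_diff_distrib)
  also have "integral {0..2*pi} (\<lambda>t. cis ((real a - real b) * t)) = (if a = b then 2 * pi else 0)"
  proof (cases "a = b")
    case False
    define k where "k = real a - real b"
    have k: "k \<noteq> 0" using False by (simp add: k_def)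
    have "((\<lambda>t. cis (k * t)) has_integral
        (cis (k * (2 * pi)) / (\<i> * k) - cis (k * 0) / (\<i> * k))) {0..2*pi}"
    proof (rule fundamental_theorem_of_calculus)
      fix t :: real
      have "((\<lambda>z. exp (\<i> * k * z) / (\<i> * k)) has_field_derivative exp (\<i> * k * of_real t)) (at (of_real t))"
        using k by (auto intro!: derivative_eq_intros)
      from has_vector_derivative_real_field[OF this]
      show "((\<lambda>t. cis (k * t) / (\<i> * k)) has_vector_derivative cis (k * t)) (at t within {0..2*pi})"
        by (simp add: cis_conv_exp mult_ac)
    qed simp
    moreover have "cis (k * (2 * pi)) = 1"
      using cis_multiple_2pi[of k] by (simp add: k_def mult_ac)
    ultimately show ?thesis
      using False by (simp add: k_def integral_unique)
  qed (simp add: scaleR_conv_of_real)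
  finally show ?thesis by (simp add: scaleR_conv_of_real)
qed

lemma integral_abs_cos_period:
  assumes a: "0 \<le> a" "a \<le> 2*pi"
  shows "integral {a..a + 2*pi} (\<lambda>t. \<bar>cos t\<bar>) = 4"
proof -
  have int: "(\<lambda>t. \<bar>cos t\<bar>) integrable_on {c..d}" for c d :: real
    by (intro integrable_continuous_real continuous_intros)
  have "integral {a..a + 2*pi} (\<lambda>t. \<bar>cos t\<bar>) =
      integral {a..2*pi} (\<lambda>t. \<bar>cos t\<bar>) + integral {2*pi..a + 2*pi} (\<lambda>t. \<bar>cos t\<bar>)"
    using a int by (intro Henstock_Kurzweil_Integration.integral_combine[symmetric]) auto
  also have "integral {2*pi..a + 2*pi} (\<lambda>t. \<bar>cos t\<bar>) = integral {0..a} (\<lambda>t. \<bar>cos t\<bar>)"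
    using integral_shift_real_ivl[of "2*pi" "2*pi" "a + 2*pi" "\<lambda>t. \<bar>cos t\<bar>"] by simp
  also have "integral {a..2*pi} (\<lambda>t. \<bar>cos t\<bar>) + \<dots> = integral {0..2*pi} (\<lambda>t. \<bar>cos t\<bar>)"
    using a int
      Henstock_Kurzweil_Integration.integral_combine[of 0 a "2*pi" "\<lambda>t. \<bar>cos t\<bar>"] by auto
  also have "\<dots> = 4"
  proof (rule integral_unique)
    have 1: "((\<lambda>t. \<bar>cos t\<bar>) has_integral (sin (pi/2) - sin 0)) {0..pi/2}"
    proof (rule fundamental_theorem_of_calculus)
      fix t assume t: "t \<in> {0..pi/2}"
      then have "cos t \<ge> 0" by (intro cos_ge_zero) auto
      then show "(sin has_vector_derivative \<bar>cos t\<bar>) (at t within {0..pi/2})"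
        by (auto simp flip: has_real_derivative_iff_has_vector_derivative intro!: derivative_eq_intros)
    qed simp
    have 2: "((\<lambda>t. \<bar>cos t\<bar>) has_integral (- sin (3*pi/2) - - sin (pi/2))) {pi/2..3*pi/2}"
    proof (rule fundamental_theorem_of_calculus)
      fix t assume t: "t \<in> {pi/2..3*pi/2}"
      then have "cos (t - pi) \<ge> 0" by (intro cos_ge_zero) auto
      then have "cos t \<le> 0" by simp
      then show "((\<lambda>t. - sin t) has_vector_derivative \<bar>cos t\<bar>) (at t within {pi/2..3*pi/2})"
        by (auto simp flip: has_real_derivative_iff_has_vector_derivative intro!: derivative_eq_intros)
    qed simp
    have 3: "((\<lambda>t. \<bar>cos t\<bar>) has_integral (sin (2*pi) - sin (3*pi/2))) {3*pi/2..2*pi}"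
    proof (rule fundamental_theorem_of_calculus)
      fix t assume t: "t \<in> {3*pi/2..2*pi}"
      then have "cos (t - 2*pi) \<ge> 0" by (intro cos_ge_zero) auto
      then have "cos t \<ge> 0" by (simp add: cos_diff)
      then show "(sin has_vector_derivative \<bar>cos t\<bar>) (at t within {3*pi/2..2*pi})"
        by (auto simp flip: has_real_derivative_iff_has_vector_derivative intro!: derivative_eq_intros)
    qed simp
    have s: "sin (3*pi/2) = -1"
      using sin_periodic_pi[of "pi/2"] by (simp add: field_simps)
    have "((\<lambda>t. \<bar>cos t\<bar>) has_integral (1 + 2)) {0..3*pi/2}"
      using has_integral_combine[OF _ _ 1 2] s by simp
    from has_integral_combine[OF _ _ this 3]
    show "((\<lambda>t. \<bar>cos t\<bar>) has_integral 4) {0..2*pi}" using s by simp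
  qed
  finally show ?thesis .
qed

text \<open>Rotating by the argument of \<open>w\<close> turns the integrand into
  \<open>cmod w\<close> times the absolute cosine, whose mean over a period is
  \<open>4 / (2 * pi)\<close>.\<close>

lemma circle_integral_abs_Re:
  "(\<integral>\<zeta>. \<bar>Re (\<zeta> * w)\<bar> \<partial>circle_measure) = 2 / pi * cmod w"
proof -
  define a where "a = Arg2pi w"
  have a: "0 \<le> a" "a \<le> 2*pi"
    unfolding a_def using Arg2pi_ge_0[of w] Arg2pi_lt_2pi[of w] by auto
  have w: "w = of_real (cmod w) * cis a"
    unfolding a_def using Arg2pi_eq[of w] by (simp add: cis_conv_exp)
  have "(\<integral>\<zeta>. \<bar>Re (\<zeta> * w)\<bar> \<partial>circle_measure) =
      (1 / (2 * pi)) *\<^sub>R integral {0..2*pi} (\<lambda>t. \<bar>Re (cis t * w)\<bar>)"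
    by (rule circle_integral) (intro continuous_intros)
  also have "(\<lambda>t. \<bar>Re (cis t * w)\<bar>) = (\<lambda>t. cmod w * \<bar>cos (t + a)\<bar>)"
  proof
    fix t
    have "cis t * w = of_real (cmod w) * cis (t + a)"
      by (subst w) (simp add: cis_mult[symmetric])
    then show "\<bar>Re (cis t * w)\<bar> = cmod w * \<bar>cos (t + a)\<bar>"
      by (simp add: abs_mult)
  qed
  also have "integral {0..2*pi} \<dots> = cmod w * integral {a..a+2*pi} (\<lambda>t. \<bar>cos t\<bar>)"
    using integral_shift_real_ivl[of a a "a + 2*pi" "\<lambda>t. \<bar>cos t\<bar>"] by simp
  also have "\<dots> = cmod w * 4"
    by (simp add: integral_abs_cos_period a)
  finally show ?thesis by simp
qed

lemma torus_coordinate_measurable: "(\<lambda>z. z j) \<in> torus \<rightarrow>\<^sub>M circle_measure"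
  unfolding torus_def by (rule measurable_component_singleton) simp

lemma measurable_torus_coordinate [measurable]: "(\<lambda>z. z j) \<in> borel_measurable torus"
  using measurable_compose[OF torus_coordinate_measurable measurable_circle_measure[of "\<lambda>z. z"]]
  by simp

lemma space_torus: "z \<in> space torus \<Longrightarrow> cmod (z j) = 1"
  by (auto simp: torus_def space_PiM PiE_def Pi_def)

lemma torus_distr_coordinate: "distr torus circle_measure (\<lambda>z. z j) = circle_measure"
  unfolding torus_def by (rule distr_PiM_component) (auto simp: prob_space_circle_measure)

lemma torus_integral_coordinate:
  fixes f :: "complex \<Rightarrow> 'a::{banach, second_countable_topology}"
  assumes "f \<in> borel_measurable borel"
  shows "(\<integral>z. f (z j) \<partial>torus) = (\<integral>z. f z \<partial>circle_measure)"
proof -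
  have "(\<integral>z. f z \<partial>circle_measure) = (\<integral>z. f z \<partial>distr torus circle_measure (\<lambda>z. z j))"
    by (simp add: torus_distr_coordinate)
  also have "\<dots> = (\<integral>z. f (z j) \<partial>torus)"
    by (intro integral_distr torus_coordinate_measurable measurable_circle_measure assms)
  finally show ?thesis ..
qed

lemma torus_indep_coordinates: "torus.indep_vars (\<lambda>_. circle_measure) (\<lambda>j z. z j) UNIV"
proof (subst torus.indep_vars_iff_distr_eq_PiM)
  show "distr torus (Pi\<^sub>M UNIV (\<lambda>_. circle_measure)) (\<lambda>x. \<lambda>i\<in>UNIV. x i) =
      Pi\<^sub>M UNIV (\<lambda>i. distr torus circle_measure (\<lambda>z. z i))"
    unfolding torus_distr_coordinate by (simp add: torus_def distr_id2 restrict_UNIV)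
qed (auto simp: torus_coordinate_measurable)

text \<open>Any injectively chosen family of coordinates has the same joint law; this later
  identifies each block of \<open>d\<close> variables with the first \<open>d\<close>
  variables.\<close>

lemma torus_distr_reindex:
  assumes "inj h"
  shows "distr torus torus (\<lambda>z n. z (h n)) = torus"
  using distr_PiM_reindex[of UNIV "\<lambda>_. circle_measure" h UNIV] assms
  by (simp add: torus_def prob_space_circle_measure restrict_UNIV)

lemma torus_integrable_bounded:
  fixes f :: "(nat \<Rightarrow> complex) \<Rightarrow> 'a::{banach, second_countable_topology}"
  assumes "f \<in> borel_measurable torus" "\<And>z. z \<in> space torus \<Longrightarrow> norm (f z) \<le> B"
  shows "integrable torus f"
  using assms by (intro torus.integrable_const_bound[of f B]) auto

section \<open>Monomials and unique factorization\<close>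

lemma prime_nth_prime: "prime (nth_prime j)"
  using enumerate_in_set[OF primes_infinite, of j] by (simp add: nth_prime_def)

lemma inj_nth_prime: "inj nth_prime"
  using bij_enumerate[OF primes_infinite] by (simp add: nth_prime_def[abs_def] bij_betw_def)

lemma nth_prime_surj: "prime p \<Longrightarrow> \<exists>j. p = nth_prime j"
  using enumerate_Ex[OF primes_infinite, of p] by (auto simp: nth_prime_def)

lemma finite_kappa:
  assumes "n > 0"
  shows "finite {j. kappa n j \<noteq> 0}"
proof -
  have "{j. kappa n j \<noteq> 0} \<subseteq> nth_prime -` prime_factors n"
    using prime_nth_prime assms by (auto simp: kappa_def prime_factors_multiplicity)
  then show ?thesis
    by (rule finite_subset) (intro finite_vimageI inj_nth_prime, simp)
qed

lemma kappa_inject: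
  assumes "m > 0" "n > 0" "\<And>j. kappa m j = kappa n j"
  shows "m = n"
proof (rule multiplicity_eq_nat)
  fix p :: nat assume "prime p"
  then obtain j where "p = nth_prime j" using nth_prime_surj by blast
  then show "multiplicity p m = multiplicity p n"
    using assms(3)[of j] by (simp add: kappa_def)
qed (use assms in auto)

lemma kappa_mult: "m > 0 \<Longrightarrow> n > 0 \<Longrightarrow> kappa (m * n) j = kappa m j + kappa n j"
  using prime_nth_prime[of j] by (simp add: kappa_def prime_elem_multiplicity_mult_distrib)

lemma torus_monomial_superset:
  assumes "finite J" "{j. kappa n j \<noteq> 0} \<subseteq> J"
  shows "torus_monomial n z = (\<Prod>j\<in>J. z j ^ kappa n j)"
  unfolding torus_monomial_def using assms by (intro prod.mono_neutral_left) auto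

lemma measurable_torus_monomial [measurable]: "(\<lambda>z. torus_monomial n z) \<in> borel_measurable torus"
  unfolding torus_monomial_def
  by (intro borel_measurable_prod borel_measurable_power measurable_torus_coordinate)

lemma norm_torus_monomial: "z \<in> space torus \<Longrightarrow> cmod (torus_monomial n z) = 1"
  by (simp add: torus_monomial_def prod_norm[symmetric] norm_power space_torus)

lemma measurable_cnj: "cnj \<in> borel_measurable borel"
  by (intro borel_measurable_continuous_onI continuous_intros)

text \<open>By independence the integral is a product over the finitely many active coordinates. For
  \<open>m \<noteq> n\<close> unique factorization yields a coordinate with different exponents,
  whose factor is 0.\<close>

lemma torus_monomial_orthonormal:
  assumes "m > 0" "n > 0"
  shows "torus_inner (torus_monomial m) (torus_monomial n) = (if m = n then 1 else 0)"
proof -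
  define J where "J = {j. kappa m j \<noteq> 0} \<union> {j. kappa n j \<noteq> 0}"
  have J: "finite J" using finite_kappa[OF assms(1)] finite_kappa[OF assms(2)] by (simp add: J_def)
  define Y where "Y j = (\<lambda>w::complex. w ^ kappa m j * cnj w ^ kappa n j)" for j
  have Y[measurable]: "Y j \<in> borel_measurable borel" for j
    unfolding Y_def by (intro borel_measurable_continuous_onI continuous_intros)
  have "torus.indep_vars (\<lambda>_. borel) (\<lambda>j z. Y j (z j)) J"
    by (rule torus.indep_vars_compose2[where Y = Y, OF
          torus.indep_vars_subset[OF torus_indep_coordinates subset_UNIV]
          measurable_circle_measure[OF Y]])
  then have "(\<integral>z. (\<Prod>j\<in>J. Y j (z j)) \<partial>torus) = (\<Prod>j\<in>J. \<integral>z. Y j (z j) \<partial>torus)"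
  proof (rule torus.indep_vars_lebesgue_integral[OF J])
    fix j
    show "integrable torus (\<lambda>z. Y j (z j))"
      by (rule torus_integrable_bounded[where B = 1])
         (use measurable_compose[OF measurable_torus_coordinate Y] in
           \<open>auto simp: Y_def norm_mult norm_power space_torus\<close>)
  qed
  also have "\<dots> = (\<Prod>j\<in>J. if kappa m j = kappa n j then 1 else 0)"
    by (intro prod.cong refl, subst torus_integral_coordinate)
       (auto simp: Y_def circle_integral_power intro!: Y[unfolded Y_def])
  also have "\<dots> = (if m = n then 1 else 0)"
  proof (cases "m = n")
    case False
    then obtain j where j: "kappa m j \<noteq> kappa n j"
      using kappa_inject assms by blast
    then have "j \<in> J" by (auto simp: J_def)
    then show ?thesis using J False j by (auto simp: prod_zero_iff)
  qed simp
  also have "(\<integral>z. (\<Prod>j\<in>J. Y j (z j)) \<partial>torus) = torus_inner (torus_monomial m) (torus_monomial n)"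
    unfolding torus_inner_def
    by (subst (1 2) torus_monomial_superset[OF J])
       (auto simp: J_def Y_def prod.distrib)
  finally show ?thesis .
qed

lemma torus_polynomial_inner:
  assumes S: "finite S" "0 \<notin> S" and T: "finite T" "0 \<notin> T"
  shows "torus_inner (\<lambda>z. \<Sum>n\<in>S. c n * torus_monomial n z) (\<lambda>z. \<Sum>n\<in>T. d n * torus_monomial n z) =
    (\<Sum>n\<in>S \<inter> T. c n * cnj (d n))"
proof -
  have int: "integrable torus (\<lambda>z. torus_monomial n z * cnj (torus_monomial m z))" for m n
    by (intro torus_integrable_bounded[where B = 1] borel_measurable_times
          measurable_compose[OF measurable_torus_monomial measurable_cnj] measurable_torus_monomial)
       (simp add: norm_mult norm_torus_monomial)
  have "torus_inner (\<lambda>z. \<Sum>n\<in>S. c n * torus_monomial n z) (\<lambda>z. \<Sum>n\<in>T. d n * torus_monomial n z) =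
    (\<integral>z. (\<Sum>n\<in>S. \<Sum>m\<in>T. c n * cnj (d m) * (torus_monomial n z * cnj (torus_monomial m z))) \<partial>torus)"
    unfolding torus_inner_def by (simp add: sum_product mult_ac)
  also have "\<dots> = (\<Sum>n\<in>S. \<Sum>m\<in>T. c n * cnj (d m) * torus_inner (torus_monomial n) (torus_monomial m))"
    using int by (simp add: torus_inner_def)
  also have "\<dots> = (\<Sum>n\<in>S. \<Sum>m\<in>T. if n = m then c n * cnj (d m) else 0)"
  proof (intro sum.cong refl)
    fix n m assume "n \<in> S" "m \<in> T"
    then have "n > 0" "m > 0" using S T by (auto intro: gr0I)
    then show "c n * cnj (d m) * torus_inner (torus_monomial n) (torus_monomial m) =
        (if n = m then c n * cnj (d m) else 0)"
      by (simp add: torus_monomial_orthonormal)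
  qed
  also have "\<dots> = (\<Sum>n\<in>S. if n \<in> T then c n * cnj (d n) else 0)"
    using T by (simp add: sum.delta)
  also have "\<dots> = (\<Sum>n\<in>S \<inter> T. c n * cnj (d n))"
    using S by (simp add: sum.inter_restrict)
  finally show ?thesis .
qed

lemma torus_inner_self: "torus_inner f f = of_real (\<integral>z. (cmod (f z))\<^sup>2 \<partial>torus)"
  unfolding torus_inner_def complex_norm_square[symmetric] by (rule integral_complex_of_real)

lemma kappa_prime: "kappa (nth_prime i) j = (if i = j then 1 else 0)"
  using prime_nth_prime[of i] prime_nth_prime[of j] inj_nth_prime
  by (cases "i = j") (auto simp: kappa_def inj_eq prime_multiplicity_other)

lemma torus_monomial_prime: "torus_monomial (nth_prime i) z = z i"
  by (subst torus_monomial_superset[of "{i}"]) (auto simp: kappa_prime split: if_splits)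

text \<open>The coordinates are the monomials of the primes, so this is Pythagoras for
  \<open>d\<close> orthonormal functions.\<close>

lemma torus_integral_norm_sum_square:
  "(\<integral>z. (cmod (\<Sum>i<d. z i))\<^sup>2 \<partial>torus) = real d"
proof -
  have eq: "(\<Sum>i<d. z i) = (\<Sum>n\<in>nth_prime ` {..<d}. 1 * torus_monomial n z)" for z
    by (subst sum.reindex) (auto intro: inj_on_subset[OF inj_nth_prime] simp: torus_monomial_prime)
  have z: "0 \<notin> nth_prime ` {..<d}"
    using prime_nth_prime by (metis imageE not_prime_0)
  have "complex_of_real (\<integral>z. (cmod (\<Sum>i<d. z i))\<^sup>2 \<partial>torus) = torus_inner (\<lambda>z. \<Sum>i<d. z i) (\<lambda>z. \<Sum>i<d. z i)"
    by (rule torus_inner_self[symmetric])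
  also have "\<dots> = of_nat (card (nth_prime ` {..<d}))"
    unfolding eq using z by (subst torus_polynomial_inner) auto
  also have "card (nth_prime ` {..<d}) = d"
    using inj_on_subset[OF inj_nth_prime] by (subst card_image) auto
  finally show ?thesis
    by (metis of_real_eq_iff of_real_of_nat_eq)
qed

section \<open>The mean modulus of a sum of coordinates\<close>

text \<open>On the circle \<open>(Re u)^2 = 1/2 + Re (u^2) / 2\<close>, and the second term has mean
  zero, so every rotated coordinate has variance 1/2. The limit does not depend on the
  rotation.\<close>

lemma rotated_coordinate_sum_weak_limit:
  assumes \<zeta>: "cmod \<zeta> = 1"
  shows "weak_conv_m (\<lambda>d. distr torus borel (\<lambda>z. (\<Sum>i<d. Re (\<zeta> * z i)) / sqrt (real d * (sqrt (1/2))\<^sup>2)))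
    std_normal_distribution"
proof (rule torus.central_limit_theorem_zero_mean)
  have m[measurable]: "(\<lambda>w. Re (\<zeta> * w)) \<in> borel_measurable borel" by measurable
  show "torus.indep_vars (\<lambda>_. borel) (\<lambda>i z. Re (\<zeta> * z i)) UNIV"
    by (rule torus.indep_vars_compose2[OF torus_indep_coordinates measurable_circle_measure[OF m]])
  have int: "integrable circle_measure (\<lambda>w. w ^ k)" for k
    by (rule circle.integrable_const_bound[where B = 1])
       (auto simp: norm_power intro: measurable_circle_measure)
  show mean: "torus.expectation (\<lambda>z. Re (\<zeta> * z n)) = 0" for n
  proof -
    have "torus.expectation (\<lambda>z. Re (\<zeta> * z n)) = (\<integral>w. Re (\<zeta> * w) \<partial>circle_measure)"
      by (rule torus_integral_coordinate[OF m])
    also have "\<dots> = Re (\<integral>w. \<zeta> * w \<partial>circle_measure)"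
      using int[of 1] by (intro integral_Re) auto
    also have "(\<integral>w. \<zeta> * w \<partial>circle_measure) = 0"
      using circle_integral_power[of 1 0] by simp
    finally show ?thesis by simp
  qed
  show "sqrt (1/2) > (0::real)" by simp
  show "integrable torus (\<lambda>z. (Re (\<zeta> * z n))\<^sup>2)" for n
  proof (rule torus_integrable_bounded[where B = 1])
    fix z assume "z \<in> space torus"
    then have "cmod (\<zeta> * z n) = 1" using \<zeta> by (simp add: norm_mult space_torus)
    then have "\<bar>Re (\<zeta> * z n)\<bar> \<le> 1" using abs_Re_le_cmod[of "\<zeta> * z n"] by simp
    then show "norm ((Re (\<zeta> * z n))\<^sup>2) \<le> 1" by (simp add: abs_square_le_1)
  qed measurable
  show "torus.variance (\<lambda>z. Re (\<zeta> * z n)) = (sqrt (1/2))\<^sup>2" for n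
  proof -
    have "torus.variance (\<lambda>z. Re (\<zeta> * z n)) = (\<integral>w. (Re (\<zeta> * w))\<^sup>2 \<partial>circle_measure)"
      unfolding mean using torus_integral_coordinate[of "\<lambda>w. (Re (\<zeta> * w))\<^sup>2" n] by simp
    also have "\<dots> = (\<integral>w. 1/2 + Re (\<zeta>\<^sup>2 * w\<^sup>2) / 2 \<partial>circle_measure)"
    proof (intro Bochner_Integration.integral_cong refl)
      fix w :: complex assume "w \<in> space circle_measure"
      then have "cmod (\<zeta> * w) = 1" using \<zeta> by (simp add: norm_mult)
      then have 1: "(Re (\<zeta> * w))\<^sup>2 + (Im (\<zeta> * w))\<^sup>2 = 1"
        using cmod_power2[of "\<zeta> * w"] by simp
      have 2: "\<zeta>\<^sup>2 * w\<^sup>2 = (\<zeta> * w)\<^sup>2" by (simp add: power_mult_distrib)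
      have "Re ((\<zeta> * w)\<^sup>2) = (Re (\<zeta> * w))\<^sup>2 - (Im (\<zeta> * w))\<^sup>2"
        by (rule Re_power2)
      then show "(Re (\<zeta> * w))\<^sup>2 = 1/2 + Re (\<zeta>\<^sup>2 * w\<^sup>2) / 2"
        unfolding 2 using 1 by linarith
    qed
    also have "\<dots> = 1/2 + Re (\<integral>w. \<zeta>\<^sup>2 * w\<^sup>2 \<partial>circle_measure) / 2"
      using int[of 2] integral_Re[of circle_measure "\<lambda>w. \<zeta>\<^sup>2 * w\<^sup>2"]
      by (subst Bochner_Integration.integral_add)
         (auto simp: circle.prob_space[unfolded space_circle_measure])
    also have "(\<integral>w. \<zeta>\<^sup>2 * w\<^sup>2 \<partial>circle_measure) = 0"
      using circle_integral_power[of 2 0] by simp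
    finally show ?thesis by simp
  qed
  show "distr torus borel (\<lambda>z. Re (\<zeta> * z n)) = distr circle_measure borel (\<lambda>w. Re (\<zeta> * w))" for n
    using distr_distr[OF measurable_circle_measure[OF m] torus_coordinate_measurable[of n]]
    by (simp add: torus_distr_coordinate comp_def)
qed

text \<open>Weak convergence only tests bounded continuous functions, hence the cutoff of the
  absolute value at \<open>M\<close>.\<close>

lemma truncated_coordinate_sum_limit:
  fixes M :: real
  assumes \<zeta>: "cmod \<zeta> = 1" and M: "M \<ge> 0"
  shows "(\<lambda>d. \<integral>z. min \<bar>Re (\<zeta> * (\<Sum>i<d. z i)) / sqrt (real d / 2)\<bar> M \<partial>torus)
    \<longlonglongrightarrow> (\<integral>x. min \<bar>x\<bar> M \<partial>std_normal_distribution)"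
proof -
  have lim: "(\<lambda>d. \<integral>x. min \<bar>x\<bar> M
        \<partial>distr torus borel (\<lambda>z. (\<Sum>i<d. Re (\<zeta> * z i)) / sqrt (real d * (sqrt (1/2))\<^sup>2)))
      \<longlonglongrightarrow> (\<integral>x. min \<bar>x\<bar> M \<partial>std_normal_distribution)"
  proof (rule weak_conv_imp_integral_bdd_continuous_conv[OF _ real_dist_normal_dist
        rotated_coordinate_sum_weak_limit[OF \<zeta>]])
    show "real_distribution (distr torus borel
        (\<lambda>z. (\<Sum>i<d. Re (\<zeta> * z i)) / sqrt (real d * (sqrt (1/2))\<^sup>2)))" for d
      by (intro torus.real_distribution_distr) measurable
    show "isCont (\<lambda>x. min \<bar>x\<bar> M) x" for x
      by (intro continuous_intros)
    show "norm (min \<bar>x\<bar> M) \<le> M" for x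
      using M by auto
  qed
  have "(\<integral>x. min \<bar>x\<bar> M
        \<partial>distr torus borel (\<lambda>z. (\<Sum>i<d. Re (\<zeta> * z i)) / sqrt (real d * (sqrt (1/2))\<^sup>2))) =
      (\<integral>z. min \<bar>Re (\<zeta> * (\<Sum>i<d. z i)) / sqrt (real d / 2)\<bar> M \<partial>torus)" for d
    by (subst integral_distr) (auto simp: sum_distrib_left)
  then show ?thesis using lim by simp
qed

lemma std_normal_truncated_abs_moment:
  "(\<integral>x. min \<bar>x\<bar> M \<partial>std_normal_distribution) \<le> sqrt (2 / pi)"
proof -
  have "integrable std_normal_distribution (\<lambda>x. x ^ 1)"
    by (rule integrable_std_normal_distribution_moment)
  then have int: "integrable std_normal_distribution (\<lambda>x. \<bar>x\<bar>)"
    by (simp add: integrable_abs)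
  interpret N: real_distribution std_normal_distribution
    by (rule real_dist_normal_dist)
  have "(\<integral>x. min \<bar>x\<bar> M \<partial>std_normal_distribution) \<le> (\<integral>x. \<bar>x\<bar> \<partial>std_normal_distribution)"
  proof (rule integral_mono[OF _ int])
    show "integrable std_normal_distribution (\<lambda>x. min \<bar>x\<bar> M)"
      by (rule Bochner_Integration.integrable_min[OF int]) simp
  qed auto
  also have "\<dots> = (\<integral>x. std_normal_density x * \<bar>x\<bar> \<partial>lborel)"
    by (subst integral_density) auto
  also have "\<dots> = sqrt (2 / pi)"
    using integral_std_normal_moment_abs_odd[of 0] by simp
  finally show ?thesis .
qed

interpretation circle_torus: pair_prob_space circle_measure torus ..

lemma norm_coordinate_sum_le:
  assumes "z \<in> space torus"
  shows "cmod (\<Sum>i<d. z i) \<le> real d"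
  using norm_sum[of z "{..<d}"] assms by (simp add: space_torus)

text \<open>
  By the central limit theorem \<open>(z\<^sub>1 + \<dots> + z\<^sub>d) / sqrt d\<close> approaches a standard complex Gaussian,
  whose absolute value has mean \<open>sqrt pi / 2\<close>. Averaging \<open>\<bar>Re (\<zeta> w)\<bar>\<close> over \<open>\<zeta>\<close> reduces this to the real
  central limit theorem; the second moment controls the truncation error.
\<close>

lemma coordinate_sum_mean_norm_limit:
  assumes c: "c > sqrt pi / 2"
  shows "eventually (\<lambda>d. (\<integral>z. cmod (\<Sum>i<d. z i) \<partial>torus) / sqrt (real d) < c) sequentially"
proof -
  define \<delta> where "\<delta> = c - sqrt pi / 2"
  \<comment> \<open>The errors add up to \<open>3 / M\<close>: \<open>2 / M\<close> from truncation
    and \<open>1 / M\<close> as margin in the limit. Multiplied by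
    \<open>pi / 2 * sqrt (1/2)\<close>, this is \<open>sqrt (1/2) * \<delta> / 2\<close>, which is
    below \<open>\<delta>\<close>.\<close>
  define M where "M = 3 * pi / \<delta>"
  have \<delta>: "\<delta> > 0" and M: "M > 0" using c by (auto simp: \<delta>_def M_def)
  define K where "K d = (\<integral>z. cmod (\<Sum>i<d. z i) \<partial>torus)" for d
  define a where "a d \<zeta> = (\<integral>z. min \<bar>Re (\<zeta> * (\<Sum>i<d. z i)) / sqrt (real d / 2)\<bar> M \<partial>torus)" for d \<zeta>
  define b where "b = (\<integral>x. min \<bar>x\<bar> M \<partial>std_normal_distribution)"
  have [measurable]: "fst \<in> borel_measurable (circle_measure \<Otimes>\<^sub>M torus)"
    using measurable_compose[OF measurable_fst measurable_circle_measure[of "\<lambda>z. z"]] by simp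
  have [measurable]: "(\<lambda>x. snd x i) \<in> borel_measurable (circle_measure \<Otimes>\<^sub>M torus)" for i
    by (rule measurable_compose[OF measurable_snd measurable_torus_coordinate])
  have Re_meas [measurable]:
    "(\<lambda>x. Re (fst x * (\<Sum>i<d. snd x i))) \<in> borel_measurable (circle_measure \<Otimes>\<^sub>M torus)" for d
    by measurable
  have a_meas [measurable]: "a d \<in> borel_measurable circle_measure" for d
    unfolding a_def
    by (intro torus.borel_measurable_lebesgue_integral) (simp add: split_beta')
  have a_bound: "norm (a d \<zeta>) \<le> M" for d \<zeta>
  proof -
    have "0 \<le> a d \<zeta>"
      unfolding a_def using M by (intro Bochner_Integration.integral_nonneg) auto
    moreover have "a d \<zeta> \<le> (\<integral>z. M \<partial>torus)"
      unfolding a_def using M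
      by (intro integral_mono torus_integrable_bounded[where B = M]) auto
    ultimately show ?thesis by (simp add: torus.prob_space)
  qed
  have a_int: "integrable circle_measure (a d)" for d
    using a_bound by (intro circle.integrable_const_bound[where B = M]) auto
  \<comment> \<open>The central limit theorem holds for each fixed rotation; the cutoff supplies the
    dominating constant for averaging over all of them.\<close>
  have a_lim: "(\<lambda>d. \<integral>\<zeta>. a d \<zeta> \<partial>circle_measure) \<longlonglongrightarrow> (\<integral>\<zeta>. b \<partial>circle_measure)"
  proof (rule integral_dominated_convergence[where w = "\<lambda>_. M"])
    show "AE \<zeta> in circle_measure. (\<lambda>d. a d \<zeta>) \<longlonglongrightarrow> b"
      unfolding a_def b_def using M
      by (intro AE_I2 truncated_coordinate_sum_limit) auto
  qed (use a_bound in auto)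
  then have a_lim: "(\<lambda>d. \<integral>\<zeta>. a d \<zeta> \<partial>circle_measure) \<longlonglongrightarrow> b"
    using circle.prob_space by simp
  have "b \<le> sqrt (2 / pi)"
    unfolding b_def by (rule std_normal_truncated_abs_moment)
  moreover have "0 < 1 / M" using M by simp
  ultimately have "b < sqrt (2 / pi) + 1 / M" by linarith
  then have ev: "eventually (\<lambda>d. (\<integral>\<zeta>. a d \<zeta> \<partial>circle_measure) < sqrt (2 / pi) + 1 / M) sequentially"
    by (rule order_tendstoD(2)[OF a_lim])
  \<comment> \<open>The scale \<open>q = sqrt (d / 2)\<close> is the standard deviation of the real
    part of the rotated sum. Fubini exchanges rotation and torus, and the truncation costs at most
    \<open>d / q^2 / M = 2 / M\<close>.\<close>
  have K_le: "2 / pi * K d \<le> sqrt (real d / 2) * ((\<integral>\<zeta>. a d \<zeta> \<partial>circle_measure) + 2 / M)" if d: "d > 0" for d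
  proof -
    define q where "q = sqrt (real d / 2)"
    have q: "q > 0" "q\<^sup>2 = real d / 2" using d by (auto simp: q_def)
    have Re_le: "\<bar>Re (\<zeta> * (\<Sum>i<d. z i))\<bar> \<le> cmod (\<Sum>i<d. z i)" if "\<zeta> \<in> space circle_measure" for \<zeta> z
      using abs_Re_le_cmod[of "\<zeta> * (\<Sum>i<d. z i)"] that by (simp add: norm_mult)
    have "2 / pi * K d = (\<integral>z. (\<integral>\<zeta>. \<bar>Re (\<zeta> * (\<Sum>i<d. z i))\<bar> \<partial>circle_measure) \<partial>torus)"
      unfolding K_def circle_integral_abs_Re by simp
    also have "\<dots> = (\<integral>\<zeta>. (\<integral>z. \<bar>Re (\<zeta> * (\<Sum>i<d. z i))\<bar> \<partial>torus) \<partial>circle_measure)"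
    proof (rule circle_torus.Fubini_integral)
      show "integrable (circle_measure \<Otimes>\<^sub>M torus) (\<lambda>(\<zeta>, z). \<bar>Re (\<zeta> * (\<Sum>i<d. z i))\<bar>)"
      proof (rule circle_torus.P.integrable_const_bound[where B = "real d"])
        show "AE x in circle_measure \<Otimes>\<^sub>M torus. norm (case x of (\<zeta>, z) \<Rightarrow> \<bar>Re (\<zeta> * (\<Sum>i<d. z i))\<bar>) \<le> real d"
        proof (rule AE_I2, clarify)
          fix \<zeta> z assume "(\<zeta>, z) \<in> space (circle_measure \<Otimes>\<^sub>M torus)"
          then have "\<zeta> \<in> space circle_measure" "z \<in> space torus"
            by (auto simp: space_pair_measure)
          then show "norm \<bar>Re (\<zeta> * (\<Sum>i<d. z i))\<bar> \<le> real d"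
            using Re_le[of \<zeta> z] norm_coordinate_sum_le[of z d] by simp
        qed
      qed (simp add: split_beta')
    qed
    also have "\<dots> \<le> (\<integral>\<zeta>. q * (a d \<zeta> + 2 / M) \<partial>circle_measure)"
    proof (rule integral_mono)
      show "integrable circle_measure (\<lambda>\<zeta>. \<integral>z. \<bar>Re (\<zeta> * (\<Sum>i<d. z i))\<bar> \<partial>torus)"
      proof (rule circle.integrable_const_bound[where B = "real d"])
        show "AE \<zeta> in circle_measure. norm (\<integral>z. \<bar>Re (\<zeta> * (\<Sum>i<d. z i))\<bar> \<partial>torus) \<le> real d"
        proof (rule AE_I2)
          fix \<zeta> assume \<zeta>: "\<zeta> \<in> space circle_measure"
          have b: "\<bar>Re (\<zeta> * (\<Sum>i<d. z i))\<bar> \<le> real d" if "z \<in> space torus" for z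
            using Re_le[OF \<zeta>, of z] norm_coordinate_sum_le[OF that, of d] by linarith
          have "(\<integral>z. \<bar>Re (\<zeta> * (\<Sum>i<d. z i))\<bar> \<partial>torus) \<le> (\<integral>z. real d \<partial>torus)"
            using b by (intro integral_mono torus_integrable_bounded[where B = "real d"]) auto
          moreover have "0 \<le> (\<integral>z. \<bar>Re (\<zeta> * (\<Sum>i<d. z i))\<bar> \<partial>torus)"
            by (intro Bochner_Integration.integral_nonneg) auto
          ultimately show "norm (\<integral>z. \<bar>Re (\<zeta> * (\<Sum>i<d. z i))\<bar> \<partial>torus) \<le> real d"
            by (simp add: torus.prob_space)
        qed
      qed (intro torus.borel_measurable_lebesgue_integral, simp add: split_beta')
      show "integrable circle_measure (\<lambda>\<zeta>. q * (a d \<zeta> + 2 / M))"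
        using a_int by simp
      fix \<zeta> assume \<zeta>: "\<zeta> \<in> space circle_measure"
      define X where "X z = Re (\<zeta> * (\<Sum>i<d. z i)) / q" for z :: "nat \<Rightarrow> complex"
      have X[measurable]: "X \<in> borel_measurable torus"
        unfolding X_def by measurable
      have int1: "integrable torus (\<lambda>z. min \<bar>X z\<bar> M)"
        using M by (intro torus_integrable_bounded[where B = M]) auto
      have int2: "integrable torus (\<lambda>z. (cmod (\<Sum>i<d. z i))\<^sup>2)"
        using norm_coordinate_sum_le[of _ d]
        by (intro torus_integrable_bounded[where B = "(real d)\<^sup>2"]) (auto intro!: power_mono)
      have "(\<integral>z. \<bar>Re (\<zeta> * (\<Sum>i<d. z i))\<bar> \<partial>torus) \<le>
          (\<integral>z. q * (min \<bar>X z\<bar> M + (cmod (\<Sum>i<d. z i))\<^sup>2 / q\<^sup>2 / M) \<partial>torus)"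
      proof (rule integral_mono)
        show "integrable torus (\<lambda>z. \<bar>Re (\<zeta> * (\<Sum>i<d. z i))\<bar>)"
          using Re_le[OF \<zeta>] norm_coordinate_sum_le[of _ d]
          by (intro torus_integrable_bounded[where B = "real d"]) (auto intro: order_trans)
        show "integrable torus (\<lambda>z. q * (min \<bar>X z\<bar> M + (cmod (\<Sum>i<d. z i))\<^sup>2 / q\<^sup>2 / M))"
          using int1 int2 by simp
        fix z
        \<comment> \<open>Beyond the cutoff \<open>\<bar>x\<bar> > M\<close> gives
          \<open>\<bar>x\<bar> \<le> x^2 / M\<close>, so the second moment pays for the
          excess.\<close>
        have "\<bar>x\<bar> \<le> min \<bar>x\<bar> M + x\<^sup>2 / M" for x :: real
        proof (cases "\<bar>x\<bar> \<le> M")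
          case False
          then have "\<bar>x\<bar> * M \<le> \<bar>x\<bar> * \<bar>x\<bar>" by (intro mult_left_mono) auto
          then have "\<bar>x\<bar> \<le> x\<^sup>2 / M" using M by (simp add: field_simps power2_eq_square)
          then show ?thesis using M by auto
        qed (use M in auto)
        then have "\<bar>X z\<bar> \<le> min \<bar>X z\<bar> M + (X z)\<^sup>2 / M" .
        also have "(X z)\<^sup>2 \<le> (cmod (\<Sum>i<d. z i))\<^sup>2 / q\<^sup>2"
          unfolding X_def power_divide
          using power_mono[OF Re_le[OF \<zeta>, of z], of 2] by (intro divide_right_mono) auto
        finally have "\<bar>X z\<bar> \<le> min \<bar>X z\<bar> M + (cmod (\<Sum>i<d. z i))\<^sup>2 / q\<^sup>2 / M"
          using M by (simp add: divide_right_mono)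
        moreover have "\<bar>Re (\<zeta> * (\<Sum>i<d. z i))\<bar> = q * \<bar>X z\<bar>"
          using q by (simp add: X_def)
        ultimately show "\<bar>Re (\<zeta> * (\<Sum>i<d. z i))\<bar> \<le> q * (min \<bar>X z\<bar> M + (cmod (\<Sum>i<d. z i))\<^sup>2 / q\<^sup>2 / M)"
          by (metis mult_left_mono order_less_imp_le q(1))
      qed
      also have "\<dots> = q * (a d \<zeta> + real d / q\<^sup>2 / M)"
        using int1 int2
        by (simp add: a_def X_def q_def torus_integral_norm_sum_square)
      also have "real d / q\<^sup>2 = 2" using d by (simp add: q)
      finally show "(\<integral>z. \<bar>Re (\<zeta> * (\<Sum>i<d. z i))\<bar> \<partial>torus) \<le> q * (a d \<zeta> + 2 / M)" .
    qed
    also have "\<dots> = q * ((\<integral>\<zeta>. a d \<zeta> \<partial>circle_measure) + 2 / M)"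
      using a_int circle.prob_space by simp
    finally show ?thesis by (simp add: q_def)
  qed
  \<comment> \<open>The main term simplifies to \<open>sqrt pi / 2\<close>. The factors undo the
    average \<open>2 / pi\<close> over rotations, the variance 1/2, and the mean
    \<open>sqrt (2 / pi)\<close> of the absolute value of a real Gaussian.\<close>
  have fin: "pi / 2 * (sqrt (1/2) * (sqrt (2 / pi) + 3 / M)) < c"
  proof -
    have "sqrt (1/2) * sqrt (2 / pi) = sqrt (1 / pi)"
      by (simp flip: real_sqrt_mult)
    moreover have "pi * sqrt (1 / pi) = sqrt pi"
      by (simp add: real_sqrt_divide real_div_sqrt)
    ultimately have "pi / 2 * (sqrt (1/2) * (sqrt (2 / pi) + 3 / M)) = sqrt pi / 2 + pi / 2 * sqrt (1/2) * (\<delta> / pi)"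
      using \<delta> by (simp add: ring_distribs M_def)
    also have "pi / 2 * sqrt (1/2) * (\<delta> / pi) = sqrt (1/2) * \<delta> / 2"
      by simp
    also have "sqrt (1/2) * \<delta> / 2 < \<delta>"
    proof -
      have "sqrt (1/2) \<le> (1::real)" by simp
      then have "sqrt (1/2) * \<delta> \<le> 1 * \<delta>" using \<delta> by (intro mult_right_mono) auto
      then show ?thesis using \<delta> by linarith
    qed
    finally show ?thesis by (simp add: \<delta>_def)
  qed
  show ?thesis
    using ev eventually_gt_at_top[of 0]
  proof eventually_elim
    case (elim d)
    then have d: "d > 0" by simp
    have "2 / pi * K d \<le> sqrt (real d / 2) * ((\<integral>\<zeta>. a d \<zeta> \<partial>circle_measure) + 2 / M)"
      by (rule K_le[OF d])
    also have "\<dots> \<le> sqrt (real d / 2) * (sqrt (2 / pi) + 3 / M)"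
      using elim by (intro mult_left_mono) (auto simp: field_simps)
    also have "sqrt (real d / 2) = sqrt (real d) * sqrt (1/2)"
      by (simp flip: real_sqrt_mult)
    finally have "K d \<le> sqrt (real d) * (pi / 2 * (sqrt (1/2) * (sqrt (2 / pi) + 3 / M)))"
      by (simp add: field_simps)
    also have "\<dots> < sqrt (real d) * c"
      using fin d by (intro mult_strict_left_mono) auto
    finally show "(\<integral>z. cmod (\<Sum>i<d. z i) \<partial>torus) / sqrt (real d) < c"
      using d by (simp add: K_def field_simps)
  qed
qed

section \<open>Products of one prime from each block\<close>

lemma kappa_one [simp]: "kappa 1 j = 0" "kappa (Suc 0) j = 0"
  by (simp_all add: kappa_def)

lemma kappa_prod:
  assumes "finite T" "\<And>j. j \<in> T \<Longrightarrow> f j > 0"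
  shows "kappa (\<Prod>j\<in>T. f j) l = (\<Sum>j\<in>T. kappa (f j) l)"
  using assms
proof (induction T)
  case (insert j T)
  then have "0 < prod f T" by (simp add: prod_pos)
  with insert show ?case by (simp add: kappa_mult)
qed simp

lemma torus_monomial_mult:
  assumes "m > 0" "n > 0"
  shows "torus_monomial (m * n) z = torus_monomial m z * torus_monomial n z"
proof -
  define J where "J = {j. kappa m j \<noteq> 0} \<union> {j. kappa n j \<noteq> 0}"
  have J: "finite J" using finite_kappa[OF assms(1)] finite_kappa[OF assms(2)] by (simp add: J_def)
  have mn: "kappa (m * n) j = kappa m j + kappa n j" for j
    using assms by (rule kappa_mult)
  have "torus_monomial (m * n) z = (\<Prod>j\<in>J. z j ^ kappa (m * n) j)"
    by (rule torus_monomial_superset[OF J]) (auto simp: J_def mn)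
  moreover have "torus_monomial m z = (\<Prod>j\<in>J. z j ^ kappa m j)"
    by (rule torus_monomial_superset[OF J]) (auto simp: J_def)
  moreover have "torus_monomial n z = (\<Prod>j\<in>J. z j ^ kappa n j)"
    by (rule torus_monomial_superset[OF J]) (auto simp: J_def)
  ultimately show ?thesis
    by (simp add: mn power_add prod.distrib)
qed

lemma torus_monomial_prod:
  assumes "finite T" "\<And>j. j \<in> T \<Longrightarrow> f j > 0"
  shows "torus_monomial (\<Prod>j\<in>T. f j) z = (\<Prod>j\<in>T. torus_monomial (f j) z)"
  using assms
proof (induction T)
  case empty
  show ?case by (simp add: torus_monomial_def)
next
  case (insert j T)
  then have "0 < prod f T" by (simp add: prod_pos)
  with insert show ?case by (simp add: torus_monomial_mult)
qed

text \<open>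
  The variables are split into levels \<open>k\<close>, each level into blocks \<open>j\<close>, and each block into
  its members \<open>i\<close>.
\<close>

definition coord :: "nat \<Rightarrow> nat \<Rightarrow> nat \<Rightarrow> nat" where
  "coord k j i = prod_encode (k, prod_encode (j, i))"

lemma coord_eq_iff [simp]: "coord k j i = coord k' j' i' \<longleftrightarrow> k = k' \<and> j = j' \<and> i = i'"
  by (auto simp: coord_def)

lemma coord_cases: obtains k j i where "l = coord k j i"
proof -
  obtain k m where km: "prod_decode l = (k, m)" by (cases "prod_decode l")
  obtain j i where ji: "prod_decode m = (j, i)" by (cases "prod_decode m")
  have "l = prod_encode (k, m)" "m = prod_encode (j, i)"
    using prod_decode_inverse[of l] prod_decode_inverse[of m] km ji by simp_all
  then show ?thesis using that by (simp add: coord_def)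
qed

definition block_number :: "nat \<Rightarrow> nat set \<Rightarrow> (nat \<Rightarrow> nat) \<Rightarrow> nat" where
  "block_number k T g = (\<Prod>j\<in>T. nth_prime (coord k j (g j)))"

text \<open>The integers of the monomials that occur when the product over the blocks in
  \<open>T\<close> of the block sums is multiplied out. For \<open>T = {..<k}\<close> this is the
  spectrum of the level polynomial.\<close>

definition block_numbers :: "nat \<Rightarrow> nat \<Rightarrow> nat set \<Rightarrow> nat set" where
  "block_numbers d k T = block_number k T ` (T \<rightarrow>\<^sub>E {..<d})"

lemma nth_prime_pos: "nth_prime j > 0"
  using prime_nth_prime by (simp add: prime_gt_0_nat)

lemma block_number_pos: "block_number k T g > 0"
  by (simp add: block_number_def nth_prime_pos prod_pos)

lemma zero_not_block_number: "0 \<notin> block_numbers d k T"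
proof
  assume "0 \<in> block_numbers d k T"
  then obtain g where "0 = block_number k T g" by (auto simp: block_numbers_def)
  then show False using block_number_pos[of k T g] by simp
qed

lemma block_numbers_empty [simp]: "block_numbers d k {} = {1}"
  by (auto simp: block_numbers_def block_number_def)

lemma kappa_block_number:
  assumes "finite T"
  shows "kappa (block_number k T g) (coord k' j i) = (if k = k' \<and> j \<in> T \<and> g j = i then 1 else 0)"
proof -
  have "kappa (block_number k T g) (coord k' j i) =
      (\<Sum>l\<in>T. kappa (nth_prime (coord k l (g l))) (coord k' j i))"
    unfolding block_number_def by (rule kappa_prod) (auto simp: assms nth_prime_pos)
  also have "\<dots> = (\<Sum>l\<in>T. if l = j then if k = k' \<and> g j = i then 1 else 0 else 0)"
    by (rule sum.cong) (auto simp: kappa_prime)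
  also have "\<dots> = (if j \<in> T then if k = k' \<and> g j = i then 1 else 0 else 0)"
    using assms by (rule sum.delta)
  finally show ?thesis by simp
qed

text \<open>Unique factorization recovers the blocks and the chosen members. The empty product is 1
  at every level, so the level is only recovered for nonempty \<open>T\<close>; this is the source
  of the two exceptional singular values.\<close>

lemma block_number_eqD:
  assumes "finite T" "finite T'" "block_number k T g = block_number k' T' g'"
  shows "T = T'" "T \<noteq> {} \<Longrightarrow> k = k'" "\<And>j. j \<in> T \<Longrightarrow> g j = g' j"
proof -
  have if_eq: "(if P then 1 else 0) = (if Q then 1 else (0::nat)) \<longleftrightarrow> (P \<longleftrightarrow> Q)" for P Q
    by simp
  have *: "(k = x \<and> j \<in> T \<and> g j = i) \<longleftrightarrow> (k' = x \<and> j \<in> T' \<and> g' j = i)" for x j i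
    unfolding if_eq[symmetric] kappa_block_number[OF assms(1), symmetric]
      kappa_block_number[OF assms(2), symmetric] assms(3) ..
  show "T = T'" "T \<noteq> {} \<Longrightarrow> k = k'" "\<And>j. j \<in> T \<Longrightarrow> g j = g' j"
    using * by blast+
qed

lemma block_number_inj:
  assumes "finite T"
  shows "inj_on (block_number k T) (T \<rightarrow>\<^sub>E {..<d})"
  using block_number_eqD(3)[OF assms assms] by (intro inj_onI PiE_ext) auto

lemma finite_block_numbers: "finite T \<Longrightarrow> finite (block_numbers d k T)"
  unfolding block_numbers_def by (intro finite_imageI finite_PiE) auto

lemma card_block_numbers: "finite T \<Longrightarrow> card (block_numbers d k T) = d ^ card T"
  unfolding block_numbers_def by (simp add: card_image block_number_inj card_PiE)

lemma block_numbers_disjoint: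
  assumes "finite T" "finite T'" "n \<in> block_numbers d k T" "n \<in> block_numbers d k' T'"
  shows "T = T'" "T \<noteq> {} \<Longrightarrow> k = k'"
  using assms block_number_eqD[OF assms(1,2)] unfolding block_numbers_def by blast+

lemma block_number_cong: "(\<And>j. j \<in> T \<Longrightarrow> g j = h j) \<Longrightarrow> block_number k T g = block_number k T h"
  unfolding block_number_def by (intro prod.cong) auto

lemma block_number_in: "(\<And>j. j \<in> T \<Longrightarrow> g j < d) \<Longrightarrow> block_number k T g \<in> block_numbers d k T"
  unfolding block_numbers_def
  by (rule image_eqI[of _ _ "restrict g T"]) (auto intro: block_number_cong)

lemma block_numbers_mult:
  assumes U: "finite U" "T \<subseteq> U" and m: "m \<in> block_numbers d k T" and n: "n \<in> block_numbers d k (U - T)"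
  shows "m * n \<in> block_numbers d k U"
proof -
  obtain g h where g: "g \<in> T \<rightarrow>\<^sub>E {..<d}" "m = block_number k T g"
    and h: "h \<in> (U - T) \<rightarrow>\<^sub>E {..<d}" "n = block_number k (U - T) h"
    using m n by (auto simp: block_numbers_def)
  define f where "f j = (if j \<in> T then g j else h j)" for j
  have "m = block_number k T f" "n = block_number k (U - T) f"
    unfolding g h by (intro block_number_cong; simp add: f_def)+
  then have "m * n = block_number k U f"
    using U by (simp add: block_number_def prod.subset_diff[of T U] mult.commute)
  moreover have "f j < d" if "j \<in> U" for j
    using g(1) h(1) that by (cases "j \<in> T") (auto simp: f_def PiE_def Pi_def)
  ultimately show ?thesis by (simp add: block_number_in)
qed

lemma block_numbers_factor:
  assumes U: "finite U" and mn: "m > 0" "n > 0" and prod: "m * n \<in> block_numbers d k U"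
  obtains T where "T \<subseteq> U" "m \<in> block_numbers d k T" "n \<in> block_numbers d k (U - T)"
proof -
  obtain g where g: "g \<in> U \<rightarrow>\<^sub>E {..<d}" and eq: "m * n = block_number k U g"
    using prod by (auto simp: block_numbers_def)
  \<comment> \<open>The product is squarefree, so each chosen prime divides exactly one of
    \<open>m\<close> and \<open>n\<close>; \<open>T\<close> collects the blocks that go to
    \<open>m\<close>.\<close>
  define T where "T = {j \<in> U. kappa m (coord k j (g j)) = 1}"
  have T: "T \<subseteq> U" "finite T" using U by (auto simp: T_def)
  have sum: "kappa m (coord k' j i) + kappa n (coord k' j i) = (if k = k' \<and> j \<in> U \<and> g j = i then 1 else 0)" for k' j i
    using kappa_mult[OF mn, of "coord k' j i"] kappa_block_number[OF U, of k g k' j i] eq by simp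
  have m1: "kappa m (coord k' j i) = (if k = k' \<and> j \<in> T \<and> g j = i then 1 else 0)" for k' j i
    using sum[of k' j i] by (auto simp: T_def split: if_splits)
  have n1: "kappa n (coord k' j i) = (if k = k' \<and> j \<in> U - T \<and> g j = i then 1 else 0)" for k' j i
    using sum[of k' j i] T(1) unfolding m1 by (auto split: if_splits)
  have "m = block_number k T g"
  proof (rule kappa_inject[OF mn(1) block_number_pos])
    fix l show "kappa m l = kappa (block_number k T g) l"
      by (rule coord_cases[of l]) (simp only: m1 kappa_block_number[OF T(2)])
  qed
  moreover have "n = block_number k (U - T) g"
  proof (rule kappa_inject[OF mn(2) block_number_pos])
    have "finite (U - T)" using U by simp
    fix l show "kappa n l = kappa (block_number k (U - T) g) l"
      by (rule coord_cases[of l]) (simp only: n1 kappa_block_number[OF \<open>finite (U - T)\<close>])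
  qed
  ultimately show ?thesis
    using T(1) g by (intro that[of T]) (auto intro!: block_number_in simp: PiE_def Pi_def)
qed

text \<open>The factorization of \<open>m * n\<close> determines which blocks belong to
  \<open>n\<close>, so at most one summand is nonzero. Read as matrices in \<open>m\<close> and
  \<open>n\<close>, this writes the Hankel matrix of a level as a sum of \<open>2 ^ card U\<close>
  rank-one matrices.\<close>

lemma block_numbers_convolution:
  assumes U: "finite U" and mn: "m > 0" "n > 0"
  shows "(of_bool (m * n \<in> block_numbers d k U) :: complex) =
    (\<Sum>T\<in>Pow U. of_bool (m \<in> block_numbers d k (U - T)) * of_bool (n \<in> block_numbers d k T))"
proof (cases "m * n \<in> block_numbers d k U")
  case True
  have nm: "n * m \<in> block_numbers d k U" using True by (simp add: mult.commute)
  obtain S where S: "S \<subseteq> U" "n \<in> block_numbers d k S" "m \<in> block_numbers d k (U - S)"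
    using block_numbers_factor[OF U mn(2,1) nm] by blast
  have "(\<Sum>T\<in>Pow U. of_bool (m \<in> block_numbers d k (U - T)) * of_bool (n \<in> block_numbers d k T)) =
      (\<Sum>T\<in>Pow U. if T = S then 1 else (0::complex))"
  proof (intro sum.cong refl)
    fix T assume "T \<in> Pow U"
    then show "of_bool (m \<in> block_numbers d k (U - T)) * of_bool (n \<in> block_numbers d k T) =
        (if T = S then 1 else (0::complex))"
      using S U block_numbers_disjoint(1)[of T S n d k k] finite_subset by auto
  qed
  also have "\<dots> = 1" using S U by simp
  finally show ?thesis using True by simp
next
  case False
  have "of_bool (m \<in> block_numbers d k (U - T)) * of_bool (n \<in> block_numbers d k T) = (0::complex)"
    if "T \<in> Pow U" for T
    using False block_numbers_mult[OF U, of T n d k m] that by (auto simp: mult.commute)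
  then have "(\<Sum>T\<in>Pow U. of_bool (m \<in> block_numbers d k (U - T)) * of_bool (n \<in> block_numbers d k T)) =
      (0::complex)"
    by (intro sum.neutral ballI)
  then show ?thesis using False by simp
qed

section \<open>Singular vectors of the Hankel matrix\<close>

text \<open>A unit vector for \<open>d > 0\<close>, since \<open>d ^ card T\<close> numbers are in
  the support. \<open>Suc m\<close> converts a matrix index into the integer that it stands
  for.\<close>

definition block_vector :: "nat \<Rightarrow> nat \<Rightarrow> nat set \<Rightarrow> nat \<Rightarrow> complex" where
  "block_vector d k T m = of_bool (Suc m \<in> block_numbers d k T) / of_real (sqrt (real d ^ card T))"

lemma block_vector_finite_support:
  assumes "finite T"
  shows "finite {m. Suc m \<in> block_numbers d k T}" "card {m. Suc m \<in> block_numbers d k T} = d ^ card T"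
proof -
  have eq: "Suc ` {m. Suc m \<in> block_numbers d k T} = block_numbers d k T"
  proof (intro equalityI subsetI)
    fix n assume n: "n \<in> block_numbers d k T"
    then obtain m where "n = Suc m"
      using zero_not_block_number[of d k T] by (cases n) auto
    then show "n \<in> Suc ` {m. Suc m \<in> block_numbers d k T}" using n by auto
  qed auto
  show "finite {m. Suc m \<in> block_numbers d k T}"
  proof (rule finite_imageD)
    show "finite (Suc ` {m. Suc m \<in> block_numbers d k T})"
      unfolding eq by (rule finite_block_numbers[OF assms])
  qed simp
  have "card {m. Suc m \<in> block_numbers d k T} = card (Suc ` {m. Suc m \<in> block_numbers d k T})"
    by (rule card_image[symmetric]) simp
  then show "card {m. Suc m \<in> block_numbers d k T} = d ^ card T"
    unfolding eq by (simp add: card_block_numbers assms)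
qed

lemma block_vector_ell2: "finite T \<Longrightarrow> block_vector d k T \<in> ell2"
  unfolding ell2_def using block_vector_finite_support(1)[of T d k]
  by (auto intro!: summable_finite[of "{m. Suc m \<in> block_numbers d k T}"] simp: block_vector_def)

lemma block_vector_disjoint:
  assumes "finite T" "finite T'" "block_vector d k T m \<noteq> 0" "block_vector d k' T' m \<noteq> 0"
  shows "T = T'" "T \<noteq> {} \<Longrightarrow> k = k'"
  using assms block_numbers_disjoint[OF assms(1,2), of "Suc m"]
  by (auto simp: block_vector_def of_bool_def split: if_splits)

lemma ell2_inner_disjoint:
  assumes "\<And>m. x m = 0 \<or> y m = 0"
  shows "ell2_inner x y = 0"
proof -
  have "(\<lambda>m. x m * cnj (y m)) = (\<lambda>_. 0)"
    using assms by (intro ext) (metis complex_cnj_zero mult_zero_left mult_zero_right)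
  then show ?thesis by (simp add: ell2_inner_def)
qed

lemma block_vector_inner_zero:
  assumes "finite T" "finite T'" "T \<noteq> T' \<or> T \<noteq> {} \<and> k \<noteq> k'"
  shows "ell2_inner (block_vector d k T) (block_vector d k' T') = 0"
  using block_vector_disjoint[OF assms(1,2), of d k _ k'] assms(3)
  by (intro ell2_inner_disjoint) blast

lemma block_vector_inner_self:
  assumes "finite T" "d > 0"
  shows "ell2_inner (block_vector d k T) (block_vector d k T) = 1"
proof -
  have r: "sqrt (real d ^ card T) * sqrt (real d ^ card T) = real d ^ card T"
    by (intro real_sqrt_mult_self[THEN trans]) simp
  have "ell2_inner (block_vector d k T) (block_vector d k T) =
      (\<Sum>m\<in>{m. Suc m \<in> block_numbers d k T}. 1 / of_real (real d ^ card T))"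
    unfolding ell2_inner_def
  proof (subst suminf_finite[OF block_vector_finite_support(1)[OF assms(1), of d k]])
    show "(\<Sum>n | Suc n \<in> block_numbers d k T. block_vector d k T n * cnj (block_vector d k T n)) =
        (\<Sum>m | Suc m \<in> block_numbers d k T. 1 / of_real (real d ^ card T))"
      by (intro sum.cong refl) (simp add: block_vector_def r of_real_mult[symmetric] del: of_real_mult of_real_power)
  qed (simp add: block_vector_def)
  also have "\<dots> = 1"
    using assms block_vector_finite_support(2)[OF assms(1), of d k] by simp
  finally show ?thesis .
qed

lemma block_vector_orthonormal:
  assumes "finite T" "finite T'" "T \<noteq> {}" "d > 0"
  shows "ell2_inner (block_vector d k T) (block_vector d k' T') = (if k = k' \<and> T = T' then 1 else 0)"
  using assms block_vector_inner_zero[of T T' k k' d] block_vector_inner_self[of T d k] by auto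

lemma block_vector_level_unique:
  assumes "finite T" "finite T'" "T \<noteq> {}" "block_vector d k T m \<noteq> 0" "block_vector d k' T' m \<noteq> 0"
  shows "k = k'"
  using block_vector_disjoint(2)[OF assms(1,2,4,5)] assms(3) .

text \<open>A matrix index lies in the supports of at most one level, apart from those of the empty
  block set. Local finiteness of all systems below rests on this.\<close>

lemma block_vector_level_bound:
  obtains K where "\<And>k T. finite T \<Longrightarrow> T \<noteq> {} \<Longrightarrow> block_vector d k T m \<noteq> 0 \<Longrightarrow> k < K"
proof (cases "\<exists>k T. finite T \<and> T \<noteq> {} \<and> block_vector d k T m \<noteq> 0")
  case True
  then obtain k T where "finite T" "T \<noteq> {}" "block_vector d k T m \<noteq> 0" by blast
  then show ?thesis
    using block_vector_level_unique[of T _ d k m] by (intro that[of "Suc k"]) blast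
next
  case False
  then show ?thesis by (intro that[of 0]) blast
qed

text \<open>The levels in use start at 1, so index \<open>k\<close> belongs to level
  \<open>Suc k\<close>.\<close>

definition level_vector :: "nat \<Rightarrow> nat \<Rightarrow> nat \<Rightarrow> complex" where
  "level_vector d k = block_vector d (Suc k) {..<Suc k}"

lemma level_vector_orthonormal: "d > 0 \<Longrightarrow> ell2_orthonormal (level_vector d)"
proof -
  assume d: "d > 0"
  have "{..<Suc i} \<noteq> {}" for i by blast
  then have "ell2_inner (level_vector d i) (level_vector d j) = (if i = j then 1 else 0)" for i j
    unfolding level_vector_def using d
    by (subst block_vector_orthonormal) auto
  then show ?thesis
    by (auto simp: ell2_orthonormal_def level_vector_def block_vector_ell2)
qed

lemma level_vector_locally_finite: "locally_finite (level_vector d)"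
  unfolding locally_finite_def
proof
  fix m
  obtain K where K: "\<And>k T. finite T \<Longrightarrow> T \<noteq> {} \<Longrightarrow> block_vector d k T m \<noteq> 0 \<Longrightarrow> k < K"
    using block_vector_level_bound[of d m] by blast
  have "{k. level_vector d k m \<noteq> 0} \<subseteq> {..<K}"
  proof
    fix k assume "k \<in> {k. level_vector d k m \<noteq> 0}"
    then have "Suc k < K" by (intro K) (auto simp: level_vector_def)
    then show "k \<in> {..<K}" by simp
  qed
  then show "finite {k. level_vector d k m \<noteq> 0}"
    by (rule finite_subset) simp
qed

text \<open>The first column of the Hankel matrix of the symbol, that is, the image of the unit
  vector of the constant monomial; \<open>top_weight\<close> is its norm.\<close>

definition top_vector :: "nat \<Rightarrow> real \<Rightarrow> nat \<Rightarrow> complex" where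
  "top_vector d \<theta> = lincomb (\<lambda>k. of_real (\<theta> ^ Suc k)) (level_vector d)"

definition top_weight :: "real \<Rightarrow> real" where
  "top_weight \<theta> = sqrt (\<Sum>k. (\<theta> ^ Suc k)\<^sup>2)"

lemma theta_square_summable:
  assumes "0 < \<theta>" "\<theta> < (1::real)"
  shows "summable (\<lambda>k. (\<theta> ^ Suc k)\<^sup>2)"
proof -
  have "\<theta>\<^sup>2 < 1" using assms by (simp add: power_less_one_iff)
  then have "summable (\<lambda>k. \<theta>\<^sup>2 * (\<theta>\<^sup>2) ^ k)"
    using assms by (intro summable_mult summable_geometric) auto
  then show ?thesis
    by (simp add: power_mult_distrib flip: power_mult) (simp add: mult.commute)
qed

lemma top_weight_pos:
  assumes "0 < \<theta>" "\<theta> < 1"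
  shows "0 < top_weight \<theta>"
  unfolding top_weight_def using suminf_pos[OF theta_square_summable[OF assms]] assms by simp

text \<open>The upper bound for the norm is the estimate for infinite combinations, the lower one is
  Bessel's inequality.\<close>

lemma top_vector_ell2:
  assumes "d > 0" "0 < \<theta>" "\<theta> < 1"
  shows "top_vector d \<theta> \<in> ell2" "ell2_inner (top_vector d \<theta>) (top_vector d \<theta>) = of_real ((top_weight \<theta>)\<^sup>2)"
proof -
  note on = level_vector_orthonormal[OF assms(1)] level_vector_locally_finite[of d]
  have sm: "summable (\<lambda>k. (cmod (of_real (\<theta> ^ Suc k)))\<^sup>2)"
    using theta_square_summable[OF assms(2,3)] by (simp only: norm_of_real power2_abs)
  note lc = lincomb_ell2[OF on sm] lincomb_inner[OF on sm]
  show ell2: "top_vector d \<theta> \<in> ell2"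
    unfolding top_vector_def by (rule lc)
  have W: "(top_weight \<theta>)\<^sup>2 = (\<Sum>k. (cmod (of_real (\<theta> ^ Suc k)))\<^sup>2)"
    unfolding top_weight_def norm_of_real power2_abs
    by (rule real_sqrt_pow2) (intro suminf_nonneg theta_square_summable assms; simp)
  have "(ell2_norm (top_vector d \<theta>))\<^sup>2 \<le> (top_weight \<theta>)\<^sup>2"
    unfolding W top_vector_def by (rule lc(2))
  moreover have "(top_weight \<theta>)\<^sup>2 \<le> (ell2_norm (top_vector d \<theta>))\<^sup>2"
    unfolding W
  proof (rule suminf_le_const[OF sm])
    fix N
    show "(\<Sum>k<N. (cmod (of_real (\<theta> ^ Suc k)))\<^sup>2) \<le> (ell2_norm (top_vector d \<theta>))\<^sup>2"
      using ell2_Bessel[OF on(1) _ ell2, of "{..<N}"] unfolding top_vector_def lc(3) by simp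
  qed
  ultimately show "ell2_inner (top_vector d \<theta>) (top_vector d \<theta>) = of_real ((top_weight \<theta>)\<^sup>2)"
    unfolding ell2_inner_self[OF ell2] by (intro arg_cong[where f = of_real] antisym)
qed

text \<open>
  Index set of the singular value decomposition. The two exceptional singular values arise
  because all levels share the constant monomial.
\<close>

datatype svd_index = Bottom | Top | Mixed nat "nat set"

fun svd_vector :: "nat \<Rightarrow> real \<Rightarrow> svd_index \<Rightarrow> nat \<Rightarrow> complex" where
  "svd_vector d \<theta> Bottom = block_vector d 1 {}"
| "svd_vector d \<theta> Top = (\<lambda>m. of_real (inverse (top_weight \<theta>)) * top_vector d \<theta> m)"
| "svd_vector d \<theta> (Mixed k T) = block_vector d k T"

text \<open>Sends the index of a right singular vector to that of its left partner: complementary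
  blocks in the mixed case, while the constant and the normalized first column are
  exchanged.\<close>

fun svd_flip :: "svd_index \<Rightarrow> svd_index" where
  "svd_flip Bottom = Top"
| "svd_flip Top = Bottom"
| "svd_flip (Mixed k T) = Mixed k ({..<k} - T)"

fun svd_weight :: "real \<Rightarrow> svd_index \<Rightarrow> real" where
  "svd_weight \<theta> Bottom = top_weight \<theta>"
| "svd_weight \<theta> Top = top_weight \<theta>"
| "svd_weight \<theta> (Mixed k T) = \<theta> ^ k"

text \<open>The empty set gives the same vector at every level and is paired with the full set. The
  pieces of both kinds are collected over all levels in \<open>Bottom\<close> and
  \<open>Top\<close>.\<close>

definition mixed_sets :: "nat \<Rightarrow> nat set set" where
  "mixed_sets k = Pow {..<k} - {{}, {..<k}}"

definition svd_indices :: "svd_index set" where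
  "svd_indices = {Bottom, Top} \<union> (\<lambda>(k, T). Mixed k T) ` (SIGMA k:UNIV. mixed_sets k)"

lemma svd_indices_iff [simp]:
  "Bottom \<in> svd_indices" "Top \<in> svd_indices" "Mixed k T \<in> svd_indices \<longleftrightarrow> T \<in> mixed_sets k"
  by (auto simp: svd_indices_def)

lemma mixed_setsD:
  assumes "T \<in> mixed_sets k"
  shows "finite T" "T \<noteq> {}" "T \<subset> {..<k}" "{..<k} - T \<in> mixed_sets k" "{..<k} - ({..<k} - T) = T"
  using assms by (auto simp: mixed_sets_def intro: finite_subset)

lemma svd_flip_in: "i \<in> svd_indices \<Longrightarrow> svd_flip i \<in> svd_indices"
  by (cases i) (auto dest: mixed_setsD)

lemma svd_flip_flip: "i \<in> svd_indices \<Longrightarrow> svd_flip (svd_flip i) = i"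
  by (cases i) (auto simp: mixed_setsD)

lemma top_vector_nonzeroD:
  assumes "top_vector d \<theta> m \<noteq> 0"
  obtains k where "block_vector d (Suc k) {..<Suc k} m \<noteq> 0"
proof -
  have "\<exists>k. level_vector d k m \<noteq> 0"
    using assms unfolding top_vector_def lincomb_def by (metis (mono_tags, lifting) mem_Collect_eq sum.neutral)
  then show ?thesis using that by (auto simp: level_vector_def)
qed

lemma top_vector_block_disjoint:
  assumes T: "finite T" "T \<noteq> {..<k}"
  shows "top_vector d \<theta> m = 0 \<or> block_vector d k T m = 0"
proof (rule ccontr)
  assume "\<not> ?thesis"
  then have t: "top_vector d \<theta> m \<noteq> 0" and b: "block_vector d k T m \<noteq> 0" by auto
  obtain l where l: "block_vector d (Suc l) {..<Suc l} m \<noteq> 0"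
    using top_vector_nonzeroD[OF t] .
  have "{..<Suc l} = T" "Suc l = k"
    using block_vector_disjoint[OF _ T(1) l b] by auto
  then show False using T(2) by simp
qed

lemma svd_vector_ell2:
  assumes "d > 0" "0 < \<theta>" "\<theta> < 1" "x \<in> svd_indices"
  shows "svd_vector d \<theta> x \<in> ell2"
  using assms
  by (cases x) (auto intro!: block_vector_ell2 ell2_scale top_vector_ell2 dest: mixed_setsD simp del: of_real_inverse)

lemma top_vector_unit:
  assumes "d > 0" "0 < \<theta>" "\<theta> < 1"
  shows "ell2_inner (svd_vector d \<theta> Top) (svd_vector d \<theta> Top) = 1"
proof -
  define c where "c = complex_of_real (inverse (top_weight \<theta>))"
  define t where "t = top_vector d \<theta>"
  have t: "t \<in> ell2" "ell2_inner t t = of_real ((top_weight \<theta>)\<^sup>2)"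
    unfolding t_def by (rule top_vector_ell2[OF assms])+
  have ct: "(\<lambda>m. c * t m) \<in> ell2" using t(1) by (rule ell2_scale)
  have "ell2_inner (\<lambda>m. c * t m) (\<lambda>m. c * t m) = c * ell2_inner t (\<lambda>m. c * t m)"
    by (rule ell2_inner_scale_left[OF t(1) ct])
  also have "ell2_inner t (\<lambda>m. c * t m) = cnj (ell2_inner (\<lambda>m. c * t m) t)"
    by (rule ell2_inner_commute[OF ct t(1)])
  also have "ell2_inner (\<lambda>m. c * t m) t = c * ell2_inner t t"
    by (rule ell2_inner_scale_left[OF t(1) t(1)])
  also have "c * cnj (c * ell2_inner t t) = 1"
    using top_weight_pos[OF assms(2,3)] unfolding t(2) c_def
    by (simp add: power2_eq_square field_simps)
  finally show ?thesis by (simp add: c_def t_def)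
qed

text \<open>Vectors with different indices have disjoint supports, so only the norms require a
  computation.\<close>

lemma svd_vector_orthonormal:
  assumes d: "d > 0" and \<theta>: "0 < \<theta>" "\<theta> < 1" and xy: "x \<in> svd_indices" "y \<in> svd_indices"
  shows "ell2_inner (svd_vector d \<theta> x) (svd_vector d \<theta> y) = (if x = y then 1 else 0)"
proof -
  have top: "svd_vector d \<theta> Top m = 0 \<or> svd_vector d \<theta> z m = 0"
    if z: "z \<in> svd_indices" "z \<noteq> Top" for z m
  proof (cases z)
    case Bottom
    have "{} \<noteq> {..<1::nat}" by blast
    from top_vector_block_disjoint[OF finite.emptyI this, of d \<theta> m] show ?thesis
      by (auto simp: Bottom)
  next
    case (Mixed k T)
    then have "T \<in> mixed_sets k" using z by simp
    then have "finite T" "T \<noteq> {..<k}" using mixed_setsD(1,3)[of T k] by auto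
    from top_vector_block_disjoint[OF this, of d \<theta> m] show ?thesis
      by (auto simp: Mixed)
  qed (use z in auto)
  consider "x = Top" "y = Top" | "x = Top" "y \<noteq> Top" | "x \<noteq> Top" "y = Top" | "x \<noteq> Top" "y \<noteq> Top"
    by blast
  then show ?thesis
  proof cases
    case 1
    then show ?thesis using top_vector_unit[OF d \<theta>] by simp
  next
    case 2
    then have "ell2_inner (svd_vector d \<theta> x) (svd_vector d \<theta> y) = 0"
      using top[OF xy(2)] by (intro ell2_inner_disjoint) auto
    then show ?thesis using 2 by auto
  next
    case 3
    then have "ell2_inner (svd_vector d \<theta> x) (svd_vector d \<theta> y) = 0"
      using top[OF xy(1)] by (intro ell2_inner_disjoint) auto
    then show ?thesis using 3 by auto
  next
    case 4
    obtain k T where x: "svd_vector d \<theta> x = block_vector d k T" "finite T"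
      "x = Bottom \<and> T = {} \<and> k = 1 \<or> x = Mixed k T \<and> T \<noteq> {}"
      using 4(1) xy(1) by (cases x) (auto dest: mixed_setsD)
    obtain l S where y: "svd_vector d \<theta> y = block_vector d l S" "finite S"
      "y = Bottom \<and> S = {} \<and> l = 1 \<or> y = Mixed l S \<and> S \<noteq> {}"
      using 4(2) xy(2) by (cases y) (auto dest: mixed_setsD)
    show ?thesis
    proof (cases "x = y")
      case True
      then show ?thesis using block_vector_inner_self[OF x(2) d, of k] x(1) by simp
    next
      case False
      then have "T \<noteq> S \<or> T \<noteq> {} \<and> k \<noteq> l" using x(3) y(3) by auto
      from block_vector_inner_zero[OF x(2) y(2) this, of d] show ?thesis
        using False x(1) y(1) by simp
    qed
  qed
qed

definition svd_below :: "nat \<Rightarrow> svd_index set" where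
  "svd_below K = {Bottom, Top} \<union> (\<lambda>(k, T). Mixed k T) ` (SIGMA k:{..<K}. mixed_sets k)"

lemma finite_mixed_sets: "finite (mixed_sets k)"
  by (simp add: mixed_sets_def)

lemma finite_svd_below: "finite (svd_below K)"
  unfolding svd_below_def using finite_mixed_sets by auto

lemma svd_below_subset: "svd_below K \<subseteq> svd_indices"
  by (auto simp: svd_below_def)

lemma svd_below_iff: "x \<in> svd_indices \<Longrightarrow> x \<in> svd_below K \<longleftrightarrow> (\<forall>k T. x = Mixed k T \<longrightarrow> k < K)"
  by (cases x) (auto simp: svd_below_def)

lemma svd_below_mono: "K \<le> L \<Longrightarrow> svd_below K \<subseteq> svd_below L"
  by (auto simp: svd_below_def)

lemma sum_svd_below:
  fixes f :: "svd_index \<Rightarrow> 'a::comm_monoid_add"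
  shows "(\<Sum>x\<in>svd_below K. f x) = f Bottom + (f Top + (\<Sum>k<K. \<Sum>T\<in>mixed_sets k. f (Mixed k T)))"
proof -
  define B where "B = (\<lambda>(k, T). Mixed k T) ` (SIGMA k:{..<K}. mixed_sets k)"
  have B: "finite B" "Bottom \<notin> B" "Top \<notin> B"
    unfolding B_def using finite_mixed_sets by auto
  have "svd_below K = insert Bottom (insert Top B)"
    by (simp add: svd_below_def B_def)
  moreover have "(\<Sum>x\<in>B. f x) = (\<Sum>(k, T)\<in>(SIGMA k:{..<K}. mixed_sets k). f (Mixed k T))"
    unfolding B_def by (subst sum.reindex) (auto simp: inj_on_def intro!: sum.cong)
  moreover have "\<dots> = (\<Sum>k<K. \<Sum>T\<in>mixed_sets k. f (Mixed k T))"
    by (rule sum.Sigma[symmetric]) (auto simp: finite_mixed_sets)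
  ultimately show ?thesis using B by simp
qed

lemma svd_vector_level_bound:
  "\<exists>K. \<forall>x\<in>svd_indices. svd_vector d \<theta> x m \<noteq> 0 \<or> svd_vector d \<theta> (svd_flip x) m \<noteq> 0 \<longrightarrow> x \<in> svd_below K"
proof -
  obtain K where K: "\<And>k T. finite T \<Longrightarrow> T \<noteq> {} \<Longrightarrow> block_vector d k T m \<noteq> 0 \<Longrightarrow> k < K"
    using block_vector_level_bound[of d m] by blast
  have 1: "x \<in> svd_below K" if x: "x \<in> svd_indices" "svd_vector d \<theta> x m \<noteq> 0" for x
    unfolding svd_below_iff[OF x(1)]
  proof (intro allI impI)
    fix k T assume "x = Mixed k T"
    then show "k < K" using x K[of T k] mixed_setsD(1,2)[of T k] by simp
  qed
  \<comment> \<open>Flipping keeps the level of a mixed index, so the same \<open>K\<close> serves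
    the left vectors.\<close>
  have 2: "x \<in> svd_below K" if x: "x \<in> svd_indices" "svd_vector d \<theta> (svd_flip x) m \<noteq> 0" for x
    using 1[OF svd_flip_in[OF x(1)] x(2)]
    unfolding svd_below_iff[OF x(1)] svd_below_iff[OF svd_flip_in[OF x(1)]] by (cases x) auto
  show ?thesis using 1 2 by blast
qed

lemma cnj_block_vector [simp]: "cnj (block_vector d k T m) = block_vector d k T m"
  by (simp add: block_vector_def)

lemma cnj_top_vector [simp]: "cnj (top_vector d \<theta> m) = top_vector d \<theta> m"
  by (simp add: top_vector_def lincomb_def level_vector_def)

lemma block_vector_empty: "block_vector d k {} = block_vector d l {}"
  by (simp add: block_vector_def fun_eq_iff)

text \<open>The expected pairing of the monomial of \<open>n\<close> with the symbol. The spectra of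
  different levels are disjoint, so at most one term of the series is nonzero.\<close>

definition symbol_coeff :: "nat \<Rightarrow> real \<Rightarrow> nat \<Rightarrow> complex" where
  "symbol_coeff d \<theta> n = (\<Sum>k. of_real (\<theta> ^ Suc k / sqrt (real d ^ Suc k)) *
     of_bool (n \<in> block_numbers d (Suc k) {..<Suc k}))"

text \<open>The normalization \<open>sqrt (d ^ k)\<close> splits exactly between \<open>T\<close>
  and its complement, which leaves unit vectors on both sides.\<close>

lemma level_convolution:
  "of_real (1 / sqrt (real d ^ k)) * of_bool (Suc m * Suc n \<in> block_numbers d k {..<k}) =
    (\<Sum>T\<in>Pow {..<k}. block_vector d k ({..<k} - T) m * block_vector d k T n)"
proof -
  have pointwise: "block_vector d k ({..<k} - T) m * block_vector d k T n =
      of_real (1 / sqrt (real d ^ k)) *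
      (of_bool (Suc m \<in> block_numbers d k ({..<k} - T)) * of_bool (Suc n \<in> block_numbers d k T))"
    if "T \<in> Pow {..<k}" for T
  proof -
    have T: "T \<subseteq> {..<k}" "finite T" using that by (auto intro: finite_subset)
    have "card ({..<k} - T) + card T = k"
      using T card_mono[of "{..<k}" T] by (simp add: card_Diff_subset)
    then have "sqrt (real d ^ card ({..<k} - T)) * sqrt (real d ^ card T) = sqrt (real d ^ k)"
      by (metis power_add real_sqrt_mult)
    then show ?thesis
      by (simp add: block_vector_def flip: of_real_mult)
  qed
  show ?thesis
    unfolding block_numbers_convolution[OF finite_lessThan zero_less_Suc zero_less_Suc] sum_distrib_left
    by (rule sum.cong[OF refl]) (rule pointwise[symmetric])
qed

lemma sum_Pow_mixed_sets:
  fixes f :: "nat set \<Rightarrow> 'a::comm_monoid_add"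
  shows "(\<Sum>T\<in>Pow {..<Suc k}. f T) = f {} + (f {..<Suc k} + (\<Sum>T\<in>mixed_sets (Suc k). f T))"
proof -
  have eq: "Pow {..<Suc k} = insert {} (insert {..<Suc k} (mixed_sets (Suc k)))"
    by (auto simp: mixed_sets_def)
  have "{} \<noteq> {..<Suc k}" by blast
  then have "{} \<notin> insert {..<Suc k} (mixed_sets (Suc k))" "{..<Suc k} \<notin> mixed_sets (Suc k)"
    unfolding mixed_sets_def by blast+
  then show ?thesis
    unfolding eq by (simp only: sum.insert finite_insert finite_mixed_sets not_False_eq_True if_False)
qed

text \<open>At each level \<open>T = {}\<close> pairs the level vector with the constant vector, and
  \<open>T = {..<k}\<close> does so in the reverse order. Summed over the levels these pieces become
  two rank-one matrices built from \<open>top_vector\<close>; the others are already in singular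
  form. \<open>K\<close> cuts off the levels that vanish at \<open>m\<close> and
  \<open>n\<close>.\<close>

lemma symbol_coeff_svd:
  assumes \<theta>: "0 < \<theta>" "\<theta> < 1"
    and Km: "\<And>k. level_vector d k m \<noteq> 0 \<Longrightarrow> k < K" and Kn: "\<And>k. level_vector d k n \<noteq> 0 \<Longrightarrow> k < K"
    and K: "\<And>k T. k \<ge> K \<Longrightarrow> T \<in> Pow {..<Suc k} \<Longrightarrow>
      block_vector d (Suc k) ({..<Suc k} - T) m * block_vector d (Suc k) T n = 0"
  shows "symbol_coeff d \<theta> (Suc m * Suc n) =
    (\<Sum>x\<in>svd_below (Suc K). of_real (svd_weight \<theta> x) * svd_vector d \<theta> (svd_flip x) m * cnj (svd_vector d \<theta> x n))"
proof -
  note W = top_weight_pos[OF \<theta>]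
  define b where "b = block_vector d 1 {}"
  have b: "block_vector d k {} = b" for k by (simp add: b_def block_vector_empty[of d k 1])
  define c where "c k = (\<Sum>T\<in>Pow {..<Suc k}. block_vector d (Suc k) ({..<Suc k} - T) m * block_vector d (Suc k) T n)" for k
  define X where "X k = (\<Sum>T\<in>mixed_sets (Suc k). block_vector d (Suc k) ({..<Suc k} - T) m * block_vector d (Suc k) T n)" for k
  have top: "top_vector d \<theta> l = (\<Sum>k<K. of_real (\<theta> ^ Suc k) * level_vector d k l)"
    if "\<And>k. level_vector d k l \<noteq> 0 \<Longrightarrow> k < K" for l
    unfolding top_vector_def using that by (intro lincomb_superset) auto
  have "symbol_coeff d \<theta> (Suc m * Suc n) = (\<Sum>k. of_real (\<theta> ^ Suc k) * c k)"
    unfolding symbol_coeff_def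
  proof (intro suminf_cong)
    fix k
    show "of_real (\<theta> ^ Suc k / sqrt (real d ^ Suc k)) * of_bool (Suc m * Suc n \<in> block_numbers d (Suc k) {..<Suc k}) =
        of_real (\<theta> ^ Suc k) * c k"
      unfolding c_def level_convolution[symmetric] by (simp only: of_real_mult[symmetric] mult.assoc[symmetric]) simp
  qed
  also have "\<dots> = (\<Sum>k<K. of_real (\<theta> ^ Suc k) * c k)"
    by (rule suminf_finite) (auto simp: c_def intro!: sum.neutral K simp del: Pow_iff)
  also have "\<dots> = (\<Sum>k<K. of_real (\<theta> ^ Suc k) * level_vector d k m) * b n +
      (b m * (\<Sum>k<K. of_real (\<theta> ^ Suc k) * level_vector d k n) + (\<Sum>k<K. of_real (\<theta> ^ Suc k) * X k))"
  proof -
    have "c k = level_vector d k m * b n + (b m * level_vector d k n + X k)" for k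
      unfolding c_def sum_Pow_mixed_sets X_def by (simp add: b level_vector_def)
    then show ?thesis
      by (simp only: sum_distrib_left sum_distrib_right sum.distrib[symmetric] ring_distribs mult_ac)
  qed
  also have "(\<Sum>k<K. of_real (\<theta> ^ Suc k) * level_vector d k m) = top_vector d \<theta> m"
    using Km by (rule top[symmetric])
  also have "(\<Sum>k<K. of_real (\<theta> ^ Suc k) * level_vector d k n) = top_vector d \<theta> n"
    using Kn by (rule top[symmetric])
  also have "(\<Sum>k<K. of_real (\<theta> ^ Suc k) * X k) =
      (\<Sum>k<Suc K. \<Sum>T\<in>mixed_sets k. of_real (\<theta> ^ k) * block_vector d k ({..<k} - T) m * block_vector d k T n)"
  proof -
    \<comment> \<open>This makes the shift of the level index by one harmless: level 0 contributes
      nothing.\<close>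
    have "mixed_sets 0 = {}" by (auto simp: mixed_sets_def)
    then show ?thesis
      unfolding sum.lessThan_Suc_shift X_def sum_distrib_left by (simp add: mult.assoc)
  qed
  \<comment> \<open>The weight \<open>top_weight \<theta>\<close> cancels the normalizing factor
    inside the \<open>Top\<close> vector.\<close>
  finally show ?thesis
    unfolding sum_svd_below using W by (simp add: b_def field_simps)
qed

section \<open>Ordering and summing the singular values\<close>

lemma svd_weight_pos: "0 < \<theta> \<Longrightarrow> \<theta> < 1 \<Longrightarrow> 0 < svd_weight \<theta> x"
  by (cases x) (auto simp: top_weight_pos)

lemma finite_svd_subset:
  assumes "finite B" "B \<subseteq> svd_indices"
  obtains K where "B \<subseteq> svd_below K"
proof -
  have "\<exists>K. B \<subseteq> svd_below K"
    using assms
  proof (induction B)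
    case (insert x B)
    then obtain K where K: "B \<subseteq> svd_below K" by blast
    show ?case
    proof (cases x)
      case (Mixed k T)
      then have "x \<in> svd_below (max K (Suc k))"
        using insert.prems by (auto simp: svd_below_iff)
      then show ?thesis
        using K svd_below_mono[of K "max K (Suc k)"] by auto
    qed (use K in \<open>auto simp: svd_below_def\<close>)
  qed auto
  then show ?thesis using that by blast
qed

lemma infinite_svd_indices: "infinite svd_indices"
proof
  assume "finite svd_indices"
  then obtain K where K: "svd_indices \<subseteq> svd_below K"
    using finite_svd_subset by blast
  \<comment> \<open>Level \<open>K + 2\<close> lies beyond the cutoff and has at least two blocks,
    so \<open>{0}\<close> is a nonempty proper subset.\<close>
  have "{0} \<noteq> {..<K + 2}"
  proof
    assume "{0} = {..<K + 2}"
    moreover have "1 \<in> {..<K + 2}" by simp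
    ultimately show False by (metis singletonD zero_neq_one)
  qed
  then have in_I: "Mixed (K + 2) {0} \<in> svd_indices"
    by (auto simp: mixed_sets_def)
  then have "Mixed (K + 2) {0} \<in> svd_below K" using K by blast
  then show False unfolding svd_below_iff[OF in_I] by auto
qed

lemma countable_svd_indices: "countable svd_indices"
  unfolding svd_indices_def
  by (intro countable_Un countable_image countable_SIGMA)
     (simp_all add: countable_finite finite_mixed_sets)

lemma svd_weight_level_finite:
  assumes "0 < \<theta>" "\<theta> < 1" "0 < \<epsilon>"
  shows "finite {x \<in> svd_indices. \<epsilon> \<le> svd_weight \<theta> x}"
proof -
  obtain K where K: "\<theta> ^ K < \<epsilon>"
    using real_arch_pow_inv[of \<epsilon> \<theta>] assms by blast
  have "{x \<in> svd_indices. \<epsilon> \<le> svd_weight \<theta> x} \<subseteq> svd_below K"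
  proof
    fix x assume x: "x \<in> {x \<in> svd_indices. \<epsilon> \<le> svd_weight \<theta> x}"
    have "k < K" if "x = Mixed k T" for k T
    proof (rule ccontr)
      assume "\<not> k < K"
      then have "\<theta> ^ k \<le> \<theta> ^ K" using assms by (intro power_decreasing) auto
      then show False using x K that by simp
    qed
    then show "x \<in> svd_below K" using x by (simp add: svd_below_iff)
  qed
  then show ?thesis using finite_svd_below finite_subset by blast
qed

text \<open>Level \<open>k\<close> has at most \<open>2 ^ k\<close> mixed indices of weight
  \<open>\<theta> ^ k\<close>, so the sum is dominated by a geometric series of ratio
  \<open>2 * \<theta> powr p\<close>.\<close>

lemma sum_svd_weight_powr:
  assumes \<theta>: "0 < \<theta>" "\<theta> < 1" and p: "2 * \<theta> powr p < 1"
  shows "(\<Sum>x\<in>svd_below K. svd_weight \<theta> x powr p) \<le> 2 * top_weight \<theta> powr p + 1 / (1 - 2 * \<theta> powr p)"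
proof -
  have "(\<Sum>k<K. \<Sum>T\<in>mixed_sets k. svd_weight \<theta> (Mixed k T) powr p) \<le> (\<Sum>k<K. (2 * \<theta> powr p) ^ k)"
  proof (rule sum_mono)
    fix k
    have "card (mixed_sets k) \<le> card (Pow {..<k})"
      by (intro card_mono) (auto simp: mixed_sets_def)
    then have c: "real (card (mixed_sets k)) \<le> 2 ^ k"
      by (simp add: card_Pow flip: of_nat_power)
    have "(\<theta> ^ k) powr p = (\<theta> powr p) ^ k"
      using \<theta> by (simp add: powr_realpow[symmetric] powr_powr mult.commute)
    then have "(\<Sum>T\<in>mixed_sets k. svd_weight \<theta> (Mixed k T) powr p) = real (card (mixed_sets k)) * (\<theta> powr p) ^ k"
      by simp
    also have "\<dots> \<le> 2 ^ k * (\<theta> powr p) ^ k"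
      using c by (intro mult_right_mono) auto
    finally show "(\<Sum>T\<in>mixed_sets k. svd_weight \<theta> (Mixed k T) powr p) \<le> (2 * \<theta> powr p) ^ k"
      by (simp add: power_mult_distrib)
  qed
  also have "\<dots> \<le> (\<Sum>k. (2 * \<theta> powr p) ^ k)"
    using p by (intro sum_le_suminf summable_geometric) auto
  also have "\<dots> = 1 / (1 - 2 * \<theta> powr p)"
    using p by (intro suminf_geometric) auto
  finally show ?thesis unfolding sum_svd_below by simp
qed

lemma symbol_coeff_schatten:
  assumes d: "d > 0" and \<theta>: "0 < \<theta>" "\<theta> < 1" and p: "2 * \<theta> powr p < 1"
  shows "schatten_class p (\<lambda>m n. symbol_coeff d \<theta> (Suc m * Suc n))"
proof -
  obtain r where bij: "bij_betw r UNIV svd_indices"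
    and dec: "decseq (\<lambda>n. svd_weight \<theta> (r n))" and lim: "(\<lambda>n. svd_weight \<theta> (r n)) \<longlonglongrightarrow> 0"
    using decreasing_enumeration[of svd_indices "svd_weight \<theta>", OF infinite_svd_indices countable_svd_indices]
      svd_weight_pos[OF \<theta>] svd_weight_level_finite[OF \<theta>] by blast
  have rI: "r n \<in> svd_indices" for n using bij by (auto simp: bij_betw_def)
  have inj: "inj r" using bij by (simp add: bij_betw_def)
  define s where "s n = svd_weight \<theta> (r n)" for n
  define e where "e n = svd_vector d \<theta> (r n)" for n
  define f where "f n = svd_vector d \<theta> (svd_flip (r n))" for n
  have e: "ell2_orthonormal e"
    unfolding ell2_orthonormal_def e_def
    using svd_vector_ell2[OF d \<theta> rI] svd_vector_orthonormal[OF d \<theta> rI rI] inj by (auto simp: inj_eq)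
  have flip_eq: "svd_flip (r i) = svd_flip (r j) \<longleftrightarrow> i = j" for i j
    using svd_flip_flip[OF rI, of i] svd_flip_flip[OF rI, of j] inj by (metis inj_eq)
  have f: "ell2_orthonormal f"
    unfolding ell2_orthonormal_def f_def
    using svd_vector_ell2[OF d \<theta> svd_flip_in[OF rI]]
      svd_vector_orthonormal[OF d \<theta> svd_flip_in[OF rI] svd_flip_in[OF rI]] flip_eq by auto
  have fin: "finite (r -` svd_below K)" for K
    by (intro finite_vimageI finite_svd_below inj)
  have lfe: "locally_finite e"
    unfolding locally_finite_def
  proof
    fix m
    obtain K where "\<forall>x\<in>svd_indices. svd_vector d \<theta> x m \<noteq> 0 \<or> svd_vector d \<theta> (svd_flip x) m \<noteq> 0 \<longrightarrow> x \<in> svd_below K"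
      using svd_vector_level_bound[of d \<theta> m] ..
    then have "{i. e i m \<noteq> 0} \<subseteq> r -` svd_below K"
      using rI by (auto simp: e_def)
    then show "finite {i. e i m \<noteq> 0}" using fin by (rule finite_subset)
  qed
  have lff: "locally_finite f"
    unfolding locally_finite_def
  proof
    fix m
    obtain K where "\<forall>x\<in>svd_indices. svd_vector d \<theta> x m \<noteq> 0 \<or> svd_vector d \<theta> (svd_flip x) m \<noteq> 0 \<longrightarrow> x \<in> svd_below K"
      using svd_vector_level_bound[of d \<theta> m] ..
    then have "{i. f i m \<noteq> 0} \<subseteq> r -` svd_below K"
      using rI by (auto simp: f_def)
    then show "finite {i. f i m \<noteq> 0}" using fin by (rule finite_subset)
  qed
  have "symbol_coeff d \<theta> (Suc m * Suc n) = svd_matrix s f e m n" for m n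
  proof -
    obtain K1 where
      "\<forall>x\<in>svd_indices. svd_vector d \<theta> x m \<noteq> 0 \<or> svd_vector d \<theta> (svd_flip x) m \<noteq> 0 \<longrightarrow> x \<in> svd_below K1"
      using svd_vector_level_bound[of d \<theta> m] ..
    then have K1: "x \<in> svd_below K1" if "x \<in> svd_indices" "svd_vector d \<theta> (svd_flip x) m \<noteq> 0" for x
      using that by blast
    obtain K2 where K2: "\<And>k T. finite T \<Longrightarrow> T \<noteq> {} \<Longrightarrow> block_vector d k T m \<noteq> 0 \<Longrightarrow> k < K2"
      using block_vector_level_bound[of d m] by blast
    obtain K3 where K3: "\<And>k T. finite T \<Longrightarrow> T \<noteq> {} \<Longrightarrow> block_vector d k T n \<noteq> 0 \<Longrightarrow> k < K3"
      using block_vector_level_bound[of d n] by blast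
    define K where "K = max K1 (max K2 K3)"
    have ne: "{..<Suc k} \<noteq> {}" for k by blast
    have bm: "k < K" if "level_vector d k m \<noteq> 0" for k
      using K2[OF finite_lessThan ne that[unfolded level_vector_def]] by (simp add: K_def)
    have bn: "k < K" if "level_vector d k n \<noteq> 0" for k
      using K3[OF finite_lessThan ne that[unfolded level_vector_def]] by (simp add: K_def)
    \<comment> \<open>One of \<open>T\<close> and its complement is nonempty. For
      \<open>T = {}\<close> the bound at \<open>m\<close> applies to the full set, otherwise the
      bound at \<open>n\<close> applies to \<open>T\<close>.\<close>
    have vanish: "block_vector d (Suc k) ({..<Suc k} - T) m * block_vector d (Suc k) T n = 0"
      if "k \<ge> K" "T \<in> Pow {..<Suc k}" for k T
    proof (cases "T = {}")
      case True
      then show ?thesis using K2[OF finite_lessThan ne, of k k] K2[of "{..<Suc k}" "Suc k"] ne[of k] that(1)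
        by (force simp: K_def)
    next
      case False
      then show ?thesis using K3[of T "Suc k"] that finite_subset[of T "{..<Suc k}"]
        by (force simp: K_def)
    qed
    have sub: "svd_below K1 \<subseteq> svd_below (Suc K)"
      by (intro svd_below_mono) (simp add: K_def)
    have bij': "bij_betw r (r -` svd_below (Suc K)) (svd_below (Suc K))"
      using bij svd_below_subset[of "Suc K"] inj
      by (auto simp: bij_betw_def inj_on_def inj_def image_vimage_eq)
    have "svd_matrix s f e m n = (\<Sum>i\<in>r -` svd_below (Suc K). of_real (s i) * cnj (e i n) * f i m)"
      unfolding svd_matrix_def
      by (rule lincomb_superset[OF fin]) (use K1[OF rI] sub in \<open>auto simp: f_def\<close>)
    also have "\<dots> = (\<Sum>x\<in>svd_below (Suc K).
        of_real (svd_weight \<theta> x) * svd_vector d \<theta> (svd_flip x) m * cnj (svd_vector d \<theta> x n))"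
      unfolding sum.reindex_bij_betw[OF bij', symmetric]
      by (intro sum.cong refl) (simp add: s_def e_def f_def)
    also have "\<dots> = symbol_coeff d \<theta> (Suc m * Suc n)"
      by (rule symbol_coeff_svd[OF \<theta> bm bn vanish, symmetric])
    finally show ?thesis ..
  qed
  then have eq: "(\<lambda>m n. symbol_coeff d \<theta> (Suc m * Suc n)) = svd_matrix s f e"
    by (intro ext)
  have "summable (\<lambda>n. s n powr p)"
  proof (rule summableI_nonneg_bounded)
    fix N
    have "r ` {..<N} \<subseteq> svd_indices" using rI by auto
    then obtain K where K: "r ` {..<N} \<subseteq> svd_below K"
      using finite_svd_subset[of "r ` {..<N}"] by blast
    have "(\<Sum>n<N. s n powr p) = (\<Sum>x\<in>r ` {..<N}. svd_weight \<theta> x powr p)"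
      using inj by (subst sum.reindex) (auto simp: s_def inj_on_def inj_def)
    also have "\<dots> \<le> (\<Sum>x\<in>svd_below K. svd_weight \<theta> x powr p)"
      using K by (intro sum_mono2 finite_svd_below) auto
    also have "\<dots> \<le> 2 * top_weight \<theta> powr p + 1 / (1 - 2 * \<theta> powr p)"
      by (rule sum_svd_weight_powr[OF \<theta> p])
    finally show "(\<Sum>n<N. s n powr p) \<le> 2 * top_weight \<theta> powr p + 1 / (1 - 2 * \<theta> powr p)" .
  qed simp
  then show ?thesis
    unfolding eq
    using svd_weight_pos[OF \<theta>] dec lim
    by (intro svd_matrix_schatten[OF e f lfe lff]) (auto simp: s_def[abs_def] less_imp_le)
qed

section \<open>The symbol\<close>

text \<open>This is \<open>\<Phi> k\<close> multiplied out: the expanded form serves inner products,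
  and \<open>level_poly_factor\<close> recovers the product form for the L^1 norm.\<close>

definition level_poly :: "nat \<Rightarrow> nat \<Rightarrow> (nat \<Rightarrow> complex) \<Rightarrow> complex" where
  "level_poly d k z = (\<Sum>n\<in>block_numbers d k {..<k}. of_real (1 / sqrt (real d ^ k)) * torus_monomial n z)"

lemma measurable_level_poly [measurable]: "(\<lambda>z. level_poly d k z) \<in> borel_measurable torus"
  unfolding level_poly_def
  by (intro borel_measurable_sum borel_measurable_times borel_measurable_const measurable_torus_monomial)

lemma level_poly_torus_polynomial: "level_poly d k \<in> torus_polynomials"
  unfolding torus_polynomials_def
proof (intro CollectI exI conjI)
  show "finite (block_numbers d k {..<k})" by (rule finite_block_numbers) simp
  show "0 \<notin> block_numbers d k {..<k}" by (rule zero_not_block_number)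
  show "level_poly d k = (\<lambda>z. \<Sum>n\<in>block_numbers d k {..<k}.
      (\<lambda>_. of_real (1 / sqrt (real d ^ k))) n * torus_monomial n z)"
    by (rule ext) (simp only: level_poly_def)
qed

lemma level_poly_bounded: "\<exists>B. \<forall>z\<in>space torus. cmod (level_poly d k z) \<le> B"
proof (intro exI ballI)
  fix z assume z: "z \<in> space torus"
  show "cmod (level_poly d k z) \<le> (\<Sum>n\<in>block_numbers d k {..<k}. cmod (of_real (1 / sqrt (real d ^ k))))"
    unfolding level_poly_def
    by (intro sum_norm_le) (simp only: norm_mult norm_torus_monomial[OF z] mult_1_right order_refl)
qed

lemma level_poly_integrable: "integrable torus (\<lambda>z. cmod (level_poly d k z))"
proof -
  obtain B where "\<forall>z\<in>space torus. cmod (level_poly d k z) \<le> B" using level_poly_bounded[of d k] ..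
  then show ?thesis by (intro torus_integrable_bounded[where B = B]) auto
qed

lemma level_poly_square_integrable: "integrable torus (\<lambda>z. (cmod (level_poly d k z))\<^sup>2)"
proof -
  obtain B where "\<forall>z\<in>space torus. cmod (level_poly d k z) \<le> B" using level_poly_bounded[of d k] ..
  then show ?thesis by (intro torus_integrable_bounded[where B = "B\<^sup>2"]) (auto intro: power_mono)
qed

lemma level_poly_inner:
  assumes "d > 0" "k > 0"
  shows "torus_inner (level_poly d k) (level_poly d l) = (if k = l then 1 else 0)"
proof -
  have fin: "finite (block_numbers d j {..<j})" for j by (rule finite_block_numbers) simp
  have eq: "torus_inner (level_poly d k) (level_poly d l) =
    (\<Sum>n\<in>block_numbers d k {..<k} \<inter> block_numbers d l {..<l}.
      of_real (1 / sqrt (real d ^ k)) * cnj (of_real (1 / sqrt (real d ^ l))))"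
    unfolding level_poly_def
    by (rule torus_polynomial_inner[OF fin zero_not_block_number fin zero_not_block_number])
  show ?thesis
  proof (cases "k = l")
    case True
    have r: "sqrt (real d ^ k) * sqrt (real d ^ k) = real d ^ k"
      by (intro real_sqrt_mult_self[THEN trans]) simp
    have card: "card (block_numbers d k {..<k}) = d ^ k"
      by (simp add: card_block_numbers)
    have "torus_inner (level_poly d k) (level_poly d k) =
        of_nat (d ^ k) * (of_real (1 / sqrt (real d ^ k)) * of_real (1 / sqrt (real d ^ k)))"
      unfolding eq[unfolded True[symmetric]] complex_cnj_complex_of_real Int_absorb
      by (simp only: sum_constant card)
    also have "\<dots> = of_real (real d ^ k * (1 / (sqrt (real d ^ k) * sqrt (real d ^ k))))"
    proof -
      have "complex_of_nat (d ^ k) = of_real (real d ^ k)" by simp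
      then show ?thesis
        by (simp only: of_real_mult[symmetric] times_divide_times_eq mult_1_left)
    qed
    also have "\<dots> = 1"
      unfolding r using assms by simp
    finally show ?thesis using True by simp
  next
    case False
    have "{..<k} \<noteq> {}" using assms(2) by blast
    then have "block_numbers d k {..<k} \<inter> block_numbers d l {..<l} = {}"
      using False block_numbers_disjoint(2)[of "{..<k}" "{..<l}" _ d k l] by blast
    then show ?thesis unfolding eq using False by simp
  qed
qed

lemma level_poly_square_integral: "d > 0 \<Longrightarrow> k > 0 \<Longrightarrow> (\<integral>z. (cmod (level_poly d k z))\<^sup>2 \<partial>torus) = 1"
  using level_poly_inner[of d k k] unfolding torus_inner_self by (simp only: if_True refl of_real_eq_1_iff)

lemma level_poly_monomial_inner:
  assumes "n > 0"
  shows "torus_inner (torus_monomial n) (level_poly d k) =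
    of_real (1 / sqrt (real d ^ k)) * of_bool (n \<in> block_numbers d k {..<k})"
proof -
  have fin: "finite (block_numbers d k {..<k})" by (rule finite_block_numbers) simp
  have "torus_inner (\<lambda>z. \<Sum>m\<in>{n}. 1 * torus_monomial m z) (level_poly d k) =
    (\<Sum>m\<in>{n} \<inter> block_numbers d k {..<k}. 1 * cnj (of_real (1 / sqrt (real d ^ k))))"
    unfolding level_poly_def using assms
    by (intro torus_polynomial_inner fin zero_not_block_number) auto
  then show ?thesis by (simp add: of_bool_def)
qed

lemma level_poly_factor:
  "level_poly d k z = (\<Prod>j<k. (\<Sum>i<d. z (coord k j i)) / of_real (sqrt (real d)))"
proof -
  have mono: "torus_monomial (block_number k {..<k} g) z = (\<Prod>j<k. z (coord k j (g j)))" for g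
    unfolding block_number_def
    by (subst torus_monomial_prod) (auto simp: nth_prime_pos torus_monomial_prime)
  have "(\<Sum>n\<in>block_numbers d k {..<k}. torus_monomial n z) =
      (\<Sum>g\<in>{..<k} \<rightarrow>\<^sub>E {..<d}. \<Prod>j<k. z (coord k j (g j)))"
    unfolding block_numbers_def
    by (subst sum.reindex[OF block_number_inj]) (auto simp: mono)
  also have "\<dots> = (\<Prod>j<k. \<Sum>i<d. z (coord k j i))"
    by (rule prod_sum_PiE[symmetric]) auto
  finally have "level_poly d k z = of_real (1 / sqrt (real d ^ k)) * (\<Prod>j<k. \<Sum>i<d. z (coord k j i))"
    by (simp only: level_poly_def sum_distrib_left[symmetric])
  also have "\<dots> = (\<Prod>j<k. (\<Sum>i<d. z (coord k j i)) / of_real (sqrt (real d)))"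
    by (simp add: prod_dividef real_sqrt_power)
  finally show ?thesis .
qed

lemma torus_integral_reindex:
  fixes f :: "(nat \<Rightarrow> complex) \<Rightarrow> real"
  assumes h: "inj h" and f: "f \<in> borel_measurable torus"
  shows "(\<integral>z. f (\<lambda>n. z (h n)) \<partial>torus) = (\<integral>z. f z \<partial>torus)"
proof -
  have "(\<lambda>z n. z (h n)) \<in> torus \<rightarrow>\<^sub>M Pi\<^sub>M UNIV (\<lambda>_. circle_measure)"
    by (intro measurable_abs_UNIV torus_coordinate_measurable)
  then have m: "(\<lambda>z n. z (h n)) \<in> torus \<rightarrow>\<^sub>M torus"
    by (simp add: torus_def)
  have "(\<integral>z. f z \<partial>torus) = (\<integral>z. f z \<partial>distr torus torus (\<lambda>z n. z (h n)))"
    by (simp add: torus_distr_reindex[OF h])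
  also have "\<dots> = (\<integral>z. f (\<lambda>n. z (h n)) \<partial>torus)"
    by (rule integral_distr[OF m f])
  finally show ?thesis ..
qed

text \<open>The blocks use disjoint coordinates, so the factors are independent and the mean of the
  product is the product of the means. Each factor has the law of the sum of the first
  \<open>d\<close> coordinates.\<close>

lemma level_poly_L1_norm:
  "(\<integral>z. cmod (level_poly d k z) \<partial>torus) = ((\<integral>z. cmod (\<Sum>i<d. z i) \<partial>torus) / sqrt (real d)) ^ k"
proof -
  define R where "R j = range (coord k j)" for j
  define Y where "Y j w = cmod (\<Sum>i<d. w (coord k j i))" for j and w :: "nat \<Rightarrow> complex"
  have Y: "Y j \<in> borel_measurable (Pi\<^sub>M (R j) (\<lambda>_. circle_measure))" for j
  proof -
    have m: "(\<lambda>w. w (coord k j i)) \<in> borel_measurable (Pi\<^sub>M (R j) (\<lambda>_. circle_measure))" for i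
    proof -
      have "(\<lambda>w. w (coord k j i)) \<in> Pi\<^sub>M (R j) (\<lambda>_. circle_measure) \<rightarrow>\<^sub>M circle_measure"
        by (rule measurable_component_singleton) (simp add: R_def)
      from measurable_compose[OF this measurable_circle_measure[of "\<lambda>z. z"]] show ?thesis by simp
    qed
    show ?thesis
      unfolding Y_def[abs_def] by (intro measurable_compose[OF _ borel_measurable_norm] borel_measurable_sum m)
  qed
  have disj: "disjoint_family_on R {..<k}"
    by (auto simp: disjoint_family_on_def R_def)
  have "torus.indep_vars (\<lambda>j. Pi\<^sub>M (R j) (\<lambda>_. circle_measure)) (\<lambda>j z. restrict (\<lambda>i. z i) (R j)) {..<k}"
    by (rule torus.indep_vars_restrict[OF torus_indep_coordinates subset_UNIV disj])
  then have "torus.indep_vars (\<lambda>_. borel) (\<lambda>j z. Y j (restrict (\<lambda>i. z i) (R j))) {..<k}"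
    by (rule torus.indep_vars_compose2[where Y = Y]) (rule Y)
  moreover have "Y j (restrict (\<lambda>i. z i) (R j)) = Y j z" for j z
    by (simp add: Y_def R_def)
  ultimately have indep: "torus.indep_vars (\<lambda>_. borel) Y {..<k}"
    by (simp add: restrict_def)
  have coord_meas: "(\<lambda>z. cmod (\<Sum>i<d. z (h i))) \<in> borel_measurable torus" for h :: "nat \<Rightarrow> nat"
    by (intro measurable_compose[OF _ borel_measurable_norm] borel_measurable_sum measurable_torus_coordinate)
  have int: "integrable torus (Y j)" for j
  proof (rule torus_integrable_bounded[where B = "real d"])
    show "Y j \<in> borel_measurable torus" unfolding Y_def[abs_def] by (rule coord_meas)
    fix z assume z: "z \<in> space torus"
    have "cmod (\<Sum>i<d. z (coord k j i)) \<le> (\<Sum>i<d. 1)"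
      using z by (intro sum_norm_le) (simp add: space_torus)
    then show "norm (Y j z) \<le> real d" by (simp add: Y_def)
  qed
  have exp: "(\<integral>z. Y j z \<partial>torus) = (\<integral>z. cmod (\<Sum>i<d. z i) \<partial>torus)" for j
    unfolding Y_def
    by (rule torus_integral_reindex[of "coord k j" "\<lambda>z. cmod (\<Sum>i<d. z i)", OF _ coord_meas[of "\<lambda>i. i"]])
       (simp add: inj_def)
  have "(\<integral>z. cmod (level_poly d k z) \<partial>torus) = (\<integral>z. (\<Prod>j<k. Y j z) / sqrt (real d) ^ k \<partial>torus)"
    by (simp add: level_poly_factor Y_def prod_norm[symmetric] norm_divide norm_power prod_dividef)
  also have "\<dots> = (\<integral>z. (\<Prod>j<k. Y j z) \<partial>torus) / sqrt (real d) ^ k"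
    by simp
  also have "(\<integral>z. (\<Prod>j<k. Y j z) \<partial>torus) = (\<Prod>j<k. \<integral>z. Y j z \<partial>torus)"
    by (rule torus.indep_vars_lebesgue_integral[OF finite_lessThan indep int])
  also have "\<dots> = (\<integral>z. cmod (\<Sum>i<d. z i) \<partial>torus) ^ k"
    by (simp add: exp)
  finally show ?thesis by (simp add: power_divide)
qed

text \<open>A pointwise series that is shown to converge only almost everywhere; the default value
  of a divergent series affects no integral.\<close>

definition symbol :: "nat \<Rightarrow> real \<Rightarrow> (nat \<Rightarrow> complex) \<Rightarrow> complex" where
  "symbol d \<theta> z = (\<Sum>k. of_real (\<theta> ^ Suc k) * level_poly d (Suc k) z)"

lemma measurable_symbol [measurable]: "(\<lambda>z. symbol d \<theta> z) \<in> borel_measurable torus"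
  unfolding symbol_def
  by (intro borel_measurable_suminf borel_measurable_times borel_measurable_const measurable_level_poly)

lemma theta_summable:
  assumes "0 < \<theta>" "\<theta> < (1::real)"
  shows "summable (\<lambda>k. \<theta> ^ Suc k)"
  unfolding power_Suc using assms by (intro summable_mult summable_geometric) auto

text \<open>The squares have mean 1, so weighting by \<open>\<theta> ^ k\<close> makes the total
  expectation finite. Splitting the weight as a product of two square roots then yields absolute
  convergence by Cauchy-Schwarz.\<close>

lemma level_poly_square_summable_AE:
  assumes d: "d > 0" and \<theta>: "0 < \<theta>" "\<theta> < 1"
  shows "AE z in torus. summable (\<lambda>k. \<theta> ^ Suc k * (cmod (level_poly d (Suc k) z))\<^sup>2)"
proof -
  define g where "g k z = \<theta> ^ Suc k * (cmod (level_poly d (Suc k) z))\<^sup>2" for k z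
  have g0: "0 \<le> g k z" for k z using \<theta> by (simp add: g_def)
  have g_meas: "(\<lambda>z. g k z) \<in> borel_measurable torus" for k
    unfolding g_def by measurable
  have g_int: "(\<integral>\<^sup>+z. ennreal (g k z) \<partial>torus) = ennreal (\<theta> ^ Suc k)" for k
  proof -
    have "integrable torus (\<lambda>z. g k z)"
      unfolding g_def by (intro integrable_mult_right level_poly_square_integrable)
    then have "(\<integral>\<^sup>+z. ennreal (g k z) \<partial>torus) = ennreal (\<integral>z. g k z \<partial>torus)"
      using g0 by (intro nn_integral_eq_integral) auto
    also have "(\<integral>z. g k z \<partial>torus) = \<theta> ^ Suc k"
      unfolding g_def using level_poly_square_integral[OF d, of "Suc k"] by simp
    finally show ?thesis .
  qed
  have "(\<integral>\<^sup>+z. (\<Sum>k. ennreal (g k z)) \<partial>torus) = (\<Sum>k. ennreal (\<theta> ^ Suc k))"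
    using g_meas by (subst nn_integral_suminf) (simp_all add: g_int del: power_Suc)
  also have "\<dots> \<noteq> \<infinity>"
    using theta_summable[OF \<theta>] \<theta> by (simp add: ennreal_suminf_neq_top del: power_Suc)
  finally have "AE z in torus. (\<Sum>k. ennreal (g k z)) \<noteq> \<infinity>"
    using g_meas by (intro nn_integral_PInf_AE) auto
  then show ?thesis
  proof eventually_elim
    case (elim z)
    then have "summable (\<lambda>k. g k z)"
      using g0 by (intro summable_suminf_not_top) auto
    then show ?case by (simp only: g_def)
  qed
qed

lemma weighted_Cauchy_Schwarz_suminf:
  fixes w a :: "nat \<Rightarrow> real"
  assumes w: "\<And>k. 0 \<le> w k" "summable w" and a: "summable (\<lambda>k. w k * (a k)\<^sup>2)" "\<And>k. 0 \<le> a k"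
  shows "summable (\<lambda>k. w k * a k)" "(\<Sum>k. w k * a k)\<^sup>2 \<le> (\<Sum>k. w k) * (\<Sum>k. w k * (a k)\<^sup>2)"
proof -
  show s: "summable (\<lambda>k. w k * a k)"
  proof (rule summable_comparison_test')
    show "summable (\<lambda>k. w k + w k * (a k)\<^sup>2)"
      by (intro summable_add w a)
    fix k
    have "2 * a k \<le> 1 + (a k)\<^sup>2"
      using sum_squares_bound[of 1 "a k"] by simp
    then have "a k \<le> 1 + (a k)\<^sup>2" using a(2)[of k] by linarith
    then have "w k * a k \<le> w k * (1 + (a k)\<^sup>2)" using w(1) by (intro mult_left_mono)
    then show "norm (w k * a k) \<le> w k + w k * (a k)\<^sup>2"
      using w(1)[of k] a(2)[of k] by (simp add: ring_distribs)
  qed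
  have "(\<lambda>N. (\<Sum>k<N. w k * a k)\<^sup>2) \<longlonglongrightarrow> (\<Sum>k. w k * a k)\<^sup>2"
    by (intro tendsto_power summable_LIMSEQ s)
  moreover have "(\<Sum>k<N. w k * a k)\<^sup>2 \<le> (\<Sum>k. w k) * (\<Sum>k. w k * (a k)\<^sup>2)" for N
  proof -
    have "(\<Sum>k<N. w k * a k)\<^sup>2 = (\<Sum>k<N. sqrt (w k) * (sqrt (w k) * a k))\<^sup>2"
      using w(1) by (simp add: mult.assoc[symmetric])
    also have "\<dots> \<le> (\<Sum>k<N. (sqrt (w k))\<^sup>2) * (\<Sum>k<N. (sqrt (w k) * a k)\<^sup>2)"
      by (rule Cauchy_Schwarz_ineq_sum)
    also have "\<dots> = (\<Sum>k<N. w k) * (\<Sum>k<N. w k * (a k)\<^sup>2)"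
      using w(1) by (simp add: power_mult_distrib)
    also have "\<dots> \<le> (\<Sum>k. w k) * (\<Sum>k. w k * (a k)\<^sup>2)"
      using w a by (intro mult_mono sum_le_suminf sum_nonneg suminf_nonneg) auto
    finally show ?thesis .
  qed
  ultimately show "(\<Sum>k. w k * a k)\<^sup>2 \<le> (\<Sum>k. w k) * (\<Sum>k. w k * (a k)\<^sup>2)"
    by (intro LIMSEQ_le_const2) auto
qed

lemma symbol_summable_AE:
  assumes d: "d > 0" and \<theta>: "0 < \<theta>" "\<theta> < 1"
  shows "AE z in torus. summable (\<lambda>k. cmod (of_real (\<theta> ^ Suc k) * level_poly d (Suc k) z))"
  using level_poly_square_summable_AE[OF assms]
proof eventually_elim
  case (elim z)
  have "summable (\<lambda>k. \<theta> ^ Suc k * cmod (level_poly d (Suc k) z))"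
    using \<theta> by (intro weighted_Cauchy_Schwarz_suminf(1)[OF _ theta_summable[OF \<theta>] elim]) auto
  then show ?case
    using \<theta> by (simp add: norm_mult norm_power)
qed

lemma symbol_L2:
  assumes d: "d > 0" and \<theta>: "0 < \<theta>" "\<theta> < 1"
  shows "symbol d \<theta> \<in> L2 torus"
proof -
  define G where "G z = (\<Sum>k. \<theta> ^ Suc k * (cmod (level_poly d (Suc k) z))\<^sup>2)" for z
  define C where "C = (\<Sum>k. \<theta> ^ Suc k)"
  have "integrable torus G"
    unfolding G_def[abs_def]
  proof (rule integrable_suminf)
    show "integrable torus (\<lambda>z. \<theta> ^ Suc k * (cmod (level_poly d (Suc k) z))\<^sup>2)" for k
      by (intro integrable_mult_right level_poly_square_integrable)
    show "AE z in torus. summable (\<lambda>k. norm (\<theta> ^ Suc k * (cmod (level_poly d (Suc k) z))\<^sup>2))"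
      using level_poly_square_summable_AE[OF assms] \<theta> by (simp add: abs_mult)
    have "(\<integral>z. norm (\<theta> ^ Suc k * (cmod (level_poly d (Suc k) z))\<^sup>2) \<partial>torus) = \<theta> ^ Suc k" for k
      using level_poly_square_integral[OF d, of "Suc k"] \<theta> by (simp add: abs_mult)
    then show "summable (\<lambda>k. \<integral>z. norm (\<theta> ^ Suc k * (cmod (level_poly d (Suc k) z))\<^sup>2) \<partial>torus)"
      using theta_summable[OF \<theta>] by presburger
  qed
  then have CG: "integrable torus (\<lambda>z. C * G z)" by simp
  \<comment> \<open>Weighted Cauchy-Schwarz: one factor is the total weight \<open>C\<close>, the
    other the integrable function \<open>G\<close>.\<close>
  have "AE z in torus. norm ((cmod (symbol d \<theta> z))\<^sup>2) \<le> norm (C * G z)"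
    using symbol_summable_AE[OF assms] level_poly_square_summable_AE[OF assms]
  proof eventually_elim
    case (elim z)
    have "cmod (symbol d \<theta> z) \<le> (\<Sum>k. cmod (of_real (\<theta> ^ Suc k) * level_poly d (Suc k) z))"
      unfolding symbol_def by (rule summable_norm[OF elim(1)])
    also have "\<dots> = (\<Sum>k. \<theta> ^ Suc k * cmod (level_poly d (Suc k) z))"
      using \<theta> by (simp add: norm_mult norm_power)
    finally have "(cmod (symbol d \<theta> z))\<^sup>2 \<le> (\<Sum>k. \<theta> ^ Suc k * cmod (level_poly d (Suc k) z))\<^sup>2"
      by (intro power_mono) auto
    also have "\<dots> \<le> C * G z"
      unfolding C_def G_def
      using \<theta> by (intro weighted_Cauchy_Schwarz_suminf(2)[OF _ theta_summable[OF \<theta>] elim(2)]) auto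
    finally show ?case by simp
  qed
  then have "integrable torus (\<lambda>z. (cmod (symbol d \<theta> z))\<^sup>2)"
    by (intro Bochner_Integration.integrable_bound[OF CG]) measurable
  then show ?thesis by (simp add: L2_def)
qed

text \<open>For a bounded \<open>f\<close> the L^1 norms of the terms are dominated by a geometric
  series, which permits exchanging sum and integral.\<close>

lemma torus_inner_symbol:
  assumes d: "d > 0" and \<theta>: "0 < \<theta>" "\<theta> < 1"
    and f: "f \<in> borel_measurable torus" "\<And>z. z \<in> space torus \<Longrightarrow> cmod (f z) \<le> B"
  shows "torus_inner f (symbol d \<theta>) = (\<Sum>k. of_real (\<theta> ^ Suc k) * torus_inner f (level_poly d (Suc k)))"
proof -
  define g where "g k z = of_real (\<theta> ^ Suc k) * (f z * cnj (level_poly d (Suc k) z))" for k z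
  have cnj_meas: "(\<lambda>z. cnj (level_poly d k z)) \<in> borel_measurable torus" for k
    by (rule measurable_compose[OF measurable_level_poly measurable_cnj])
  have g_meas: "g k \<in> borel_measurable torus" for k
    unfolding g_def[abs_def]
    by (intro borel_measurable_times borel_measurable_const f cnj_meas)
  have B: "0 \<le> B"
    using f(2) torus.not_empty by (meson ex_in_conv norm_ge_zero order_trans)
  have g_le: "norm (g k z) \<le> norm (B * \<theta> ^ Suc k * cmod (level_poly d (Suc k) z))" if "z \<in> space torus" for k z
  proof -
    have "norm (g k z) = \<theta> ^ Suc k * (cmod (f z) * cmod (level_poly d (Suc k) z))"
      using \<theta> by (simp add: g_def norm_mult norm_power)
    also have "\<dots> \<le> \<theta> ^ Suc k * (B * cmod (level_poly d (Suc k) z))"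
      using f(2)[OF that] \<theta> by (intro mult_left_mono mult_right_mono) auto
    finally show ?thesis using B \<theta> by (simp add: abs_mult mult_ac)
  qed
  have bound_int: "integrable torus (\<lambda>z. B * \<theta> ^ Suc k * cmod (level_poly d (Suc k) z))" for k
    by (intro integrable_mult_right level_poly_integrable)
  have g_int: "integrable torus (g k)" for k
    using g_le by (intro Bochner_Integration.integrable_bound[OF bound_int g_meas] AE_I2)
  have sm: "AE z in torus. summable (\<lambda>k. norm (g k z))"
    using symbol_summable_AE[OF d \<theta>] AE_space
  proof eventually_elim
    case (elim z)
    have "norm (g k z) = cmod (f z) * cmod (of_real (\<theta> ^ Suc k) * level_poly d (Suc k) z)" for k
      by (simp add: g_def norm_mult mult_ac)
    then show ?case using summable_mult[OF elim(1), of "cmod (f z)"] by (simp only:)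
  qed
  \<comment> \<open>A crude bound from \<open>a \<le> 1 + a^2\<close>; only uniformity in
    \<open>k\<close> matters here.\<close>
  have L1: "(\<integral>z. cmod (level_poly d (Suc k) z) \<partial>torus) \<le> 2" for k
  proof -
    have "(\<integral>z. cmod (level_poly d (Suc k) z) \<partial>torus) \<le> (\<integral>z. 1 + (cmod (level_poly d (Suc k) z))\<^sup>2 \<partial>torus)"
    proof (rule integral_mono[OF level_poly_integrable])
      show "integrable torus (\<lambda>z. 1 + (cmod (level_poly d (Suc k) z))\<^sup>2)"
        using level_poly_square_integrable[of d "Suc k"] by simp
      fix z
      have "2 * cmod (level_poly d (Suc k) z) \<le> 1 + (cmod (level_poly d (Suc k) z))\<^sup>2"
        using sum_squares_bound[of 1 "cmod (level_poly d (Suc k) z)"] by simp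
      then show "cmod (level_poly d (Suc k) z) \<le> 1 + (cmod (level_poly d (Suc k) z))\<^sup>2"
        using norm_ge_zero[of "level_poly d (Suc k) z"] by linarith
    qed
    also have "\<dots> = 2"
      using level_poly_square_integrable[of d "Suc k"] level_poly_square_integral[OF d, of "Suc k"]
      by (simp add: torus.prob_space)
    finally show ?thesis .
  qed
  have sums: "summable (\<lambda>k. \<integral>z. norm (g k z) \<partial>torus)"
  proof (rule summable_comparison_test')
    show "summable (\<lambda>k. 2 * B * \<theta> ^ Suc k)"
      by (intro summable_mult theta_summable \<theta>)
    fix k
    have "(\<integral>z. norm (g k z) \<partial>torus) \<le> (\<integral>z. B * \<theta> ^ Suc k * cmod (level_poly d (Suc k) z) \<partial>torus)"
    proof (rule integral_mono[OF integrable_norm[OF g_int] bound_int])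
      fix z assume "z \<in> space torus"
      then show "norm (g k z) \<le> B * \<theta> ^ Suc k * cmod (level_poly d (Suc k) z)"
        using g_le[of z k] B \<theta> by (simp add: abs_mult)
    qed
    also have "\<dots> = B * \<theta> ^ Suc k * (\<integral>z. cmod (level_poly d (Suc k) z) \<partial>torus)"
      by (rule integral_mult_right_zero)
    also have "\<dots> \<le> B * \<theta> ^ Suc k * 2"
      using B \<theta> L1 by (intro mult_left_mono) auto
    finally have "(\<integral>z. norm (g k z) \<partial>torus) \<le> 2 * B * \<theta> ^ Suc k" by (simp add: mult_ac)
    moreover have "0 \<le> (\<integral>z. norm (g k z) \<partial>torus)"
      by (intro Bochner_Integration.integral_nonneg) auto
    ultimately show "norm (\<integral>z. norm (g k z) \<partial>torus) \<le> 2 * B * \<theta> ^ Suc k" by simp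
  qed
  have "torus_inner f (symbol d \<theta>) = (\<integral>z. (\<Sum>k. g k z) \<partial>torus)"
    unfolding torus_inner_def
  proof (rule integral_cong_AE)
    have "(\<lambda>z. cnj (symbol d \<theta> z)) \<in> borel_measurable torus"
      by (rule measurable_compose[OF measurable_symbol measurable_cnj])
    then show "(\<lambda>z. f z * cnj (symbol d \<theta> z)) \<in> borel_measurable torus"
      using f(1) by (intro borel_measurable_times)
    show "(\<lambda>z. \<Sum>k. g k z) \<in> borel_measurable torus"
      using g_meas by (intro borel_measurable_suminf)
    show "AE z in torus. f z * cnj (symbol d \<theta> z) = (\<Sum>k. g k z)"
      using symbol_summable_AE[OF d \<theta>]
    proof eventually_elim
      case (elim z)
      have "(\<lambda>k. of_real (\<theta> ^ Suc k) * level_poly d (Suc k) z) sums symbol d \<theta> z"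
        unfolding symbol_def by (rule summable_sums[OF summable_norm_cancel[OF elim]])
      then have "(\<lambda>k. cnj (of_real (\<theta> ^ Suc k) * level_poly d (Suc k) z)) sums cnj (symbol d \<theta> z)"
        by (simp only: sums_cnj)
      then have "(\<lambda>k. f z * cnj (of_real (\<theta> ^ Suc k) * level_poly d (Suc k) z)) sums (f z * cnj (symbol d \<theta> z))"
        by (rule sums_mult)
      moreover have "f z * cnj (of_real (\<theta> ^ Suc k) * level_poly d (Suc k) z) = g k z" for k
        by (simp add: g_def mult_ac)
      ultimately show ?case by (simp add: sums_iff)
    qed
  qed
  also have "\<dots> = (\<Sum>k. \<integral>z. g k z \<partial>torus)"
    by (rule integral_suminf[OF g_int sm sums])
  also have "\<dots> = (\<Sum>k. of_real (\<theta> ^ Suc k) * torus_inner f (level_poly d (Suc k)))"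
    unfolding g_def torus_inner_def by (intro suminf_cong integral_mult_right_zero)
  finally show ?thesis .
qed

lemma hankel_coeff_symbol:
  assumes "d > 0" "0 < \<theta>" "\<theta> < 1" "n > 0"
  shows "hankel_coeff (symbol d \<theta>) n = symbol_coeff d \<theta> n"
proof -
  have "hankel_coeff (symbol d \<theta>) n =
      (\<Sum>k. of_real (\<theta> ^ Suc k) * torus_inner (torus_monomial n) (level_poly d (Suc k)))"
    unfolding hankel_coeff_def
    by (rule torus_inner_symbol[OF assms(1-3), where B = 1])
       (simp_all add: measurable_torus_monomial norm_torus_monomial)
  also have "\<dots> = symbol_coeff d \<theta> n"
    unfolding symbol_coeff_def level_poly_monomial_inner[OF assms(4)]
    by (intro suminf_cong) (simp only: of_real_mult[symmetric] mult.assoc[symmetric], simp)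
  finally show ?thesis .
qed

lemma level_poly_inner_symbol:
  assumes "d > 0" "0 < \<theta>" "\<theta> < 1"
  shows "torus_inner (level_poly d (Suc k)) (symbol d \<theta>) = of_real (\<theta> ^ Suc k)"
proof -
  obtain B where B: "\<forall>z\<in>space torus. cmod (level_poly d (Suc k) z) \<le> B"
    using level_poly_bounded[of d "Suc k"] ..
  have "torus_inner (level_poly d (Suc k)) (symbol d \<theta>) =
      (\<Sum>l. of_real (\<theta> ^ Suc l) * torus_inner (level_poly d (Suc k)) (level_poly d (Suc l)))"
    using B by (intro torus_inner_symbol[OF assms, where B = B] measurable_level_poly) auto
  also have "\<dots> = (\<Sum>l. if l = k then of_real (\<theta> ^ Suc l) else 0)"
    by (intro suminf_cong) (simp add: level_poly_inner assms del: power_Suc)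
  also have "\<dots> = of_real (\<theta> ^ Suc k)"
    using sums_single[of k "\<lambda>l. of_real (\<theta> ^ Suc l)"] by (rule sums_unique[symmetric])
  finally show ?thesis .
qed

text \<open>Duality of L^1 and L^infinity: equal forms agree on the pair of a level polynomial and
  1, which reads off \<open>\<theta> ^ k\<close>, while a bounded symbol pairs with that polynomial
  to at most \<open>C\<close> times its L^1 norm.\<close>

lemma bounded_symbol_estimate:
  assumes d: "d > 0" and \<theta>: "0 < \<theta>" "\<theta> < 1"
    and \<psi>: "\<psi> \<in> Linf torus" and same: "same_hankel_form \<psi> (symbol d \<theta>)"
  shows "\<exists>C. \<forall>k. \<theta> ^ Suc k \<le> C * ((\<integral>z. cmod (\<Sum>i<d. z i) \<partial>torus) / sqrt (real d)) ^ Suc k"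
proof -
  obtain C where \<psi>_meas: "\<psi> \<in> borel_measurable torus" and C: "AE z in torus. cmod (\<psi> z) \<le> C"
    using \<psi> by (auto simp: Linf_def)
  have "(\<lambda>_. 1) \<in> torus_polynomials"
    unfolding torus_polynomials_def
    by (rule CollectI, rule exI[of _ "{1}"], rule exI[of _ "\<lambda>_. 1"]) (simp add: torus_monomial_def fun_eq_iff)
  then have "hankel_form \<psi> (level_poly d k) (\<lambda>_. 1) = hankel_form (symbol d \<theta>) (level_poly d k) (\<lambda>_. 1)" for k
    using same level_poly_torus_polynomial unfolding same_hankel_form_def by blast
  then have eq: "torus_inner (level_poly d k) \<psi> = torus_inner (level_poly d k) (symbol d \<theta>)" for k
    by (simp add: hankel_form_def)
  have "\<theta> ^ Suc k \<le> C * ((\<integral>z. cmod (\<Sum>i<d. z i) \<partial>torus) / sqrt (real d)) ^ Suc k" for k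
  proof -
    have int: "integrable torus (\<lambda>z. C * cmod (level_poly d (Suc k) z))"
      by (intro integrable_mult_right level_poly_integrable)
    have AE: "AE z in torus. norm (level_poly d (Suc k) z * cnj (\<psi> z)) \<le> C * cmod (level_poly d (Suc k) z)"
      using C
    proof eventually_elim
      case (elim z)
      then show ?case
        using mult_right_mono[OF elim, of "cmod (level_poly d (Suc k) z)"] by (simp add: norm_mult mult.commute)
    qed
    have meas: "(\<lambda>z. level_poly d (Suc k) z * cnj (\<psi> z)) \<in> borel_measurable torus"
      by (intro borel_measurable_times measurable_level_poly measurable_compose[OF \<psi>_meas measurable_cnj])
    have int': "integrable torus (\<lambda>z. level_poly d (Suc k) z * cnj (\<psi> z))"
      by (rule Bochner_Integration.integrable_bound[OF int meas]) (use AE in \<open>auto elim!: eventually_mono\<close>)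
    have "\<theta> ^ Suc k = cmod (torus_inner (level_poly d (Suc k)) \<psi>)"
      unfolding eq level_poly_inner_symbol[OF d \<theta>] using \<theta> by (simp add: norm_mult norm_power)
    also have "\<dots> \<le> (\<integral>z. norm (level_poly d (Suc k) z * cnj (\<psi> z)) \<partial>torus)"
      unfolding torus_inner_def by (rule integral_norm_bound)
    also have "\<dots> \<le> (\<integral>z. C * cmod (level_poly d (Suc k) z) \<partial>torus)"
      by (rule integral_mono_AE[OF integrable_norm[OF int'] int AE])
    also have "\<dots> = C * (\<integral>z. cmod (level_poly d (Suc k) z) \<partial>torus)"
      by (rule integral_mult_right_zero)
    finally show ?thesis unfolding level_poly_L1_norm .
  qed
  then show ?thesis by blast
qed

section \<open>The critical exponent and the conclusion\<close>

lemma exponent_threshold: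
  assumes "p > inverse (1 - ln pi / ln 4)"
  shows "p > 0" "sqrt pi / 2 < 2 powr (- (1 / p))"
proof -
  \<comment> \<open>Since \<open>pi < 4\<close>, the threshold is the inverse of a positive number,
    so the inequality for \<open>p\<close> can be inverted.\<close>
  have l: "ln pi < ln (4::real)" "0 < ln (4::real)" using pi_less_4 by simp_all
  then have q: "1 - ln pi / ln 4 > 0" by (simp add: field_simps)
  then show p: "p > 0" using assms by (meson inverse_positive_iff_positive less_trans)
  have "inverse p < 1 - ln pi / ln 4"
    using assms q p by (metis inverse_inverse_eq inverse_less_iff_less inverse_positive_iff_positive)
  then have "1 / p < 1 - ln pi / (2 * ln 2)"
    using ln_realpow[of 2 2] by (simp add: inverse_eq_divide)
  then have "- (1 / p) * ln 2 > (ln pi / (2 * ln 2) - 1) * ln 2"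
    by (intro mult_strict_right_mono) auto
  also have "(ln pi / (2 * ln 2) - 1) * ln 2 = ln pi / 2 - ln (2::real)"
    by (simp add: field_simps)
  finally have "exp (ln pi / 2 - ln 2) < exp (- (1 / p) * ln 2)" by simp
  moreover have "exp (ln pi / 2 - ln 2) = sqrt pi / 2"
  proof -
    have "exp (ln pi / 2) = sqrt pi"
      by (rule real_sqrt_unique[symmetric]) (simp_all add: power2_eq_square flip: exp_add)
    then show ?thesis by (simp add: exp_diff)
  qed
  ultimately show "sqrt pi / 2 < 2 powr (- (1 / p))"
    by (simp add: powr_def)
qed

theorem theorem3:
  fixes p :: real
  assumes "p > inverse (1 - ln pi / ln 4)"
  shows "\<exists>\<phi>\<in>L2 torus. schatten_class p (hankel_matrix \<phi>) \<and>
           \<not> (\<exists>\<psi>\<in>Linf torus. same_hankel_form \<psi> \<phi>)"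
proof -
  note p = exponent_threshold[OF assms]
  define c where "c = 2 powr (- (1 / p))"
  have c1: "c < 1"
    using p(1) powr_less_mono[of "- (1 / p)" 0 2] by (simp add: c_def)
  have "eventually (\<lambda>d. (\<integral>z. cmod (\<Sum>i<d. z i) \<partial>torus) / sqrt (real d) < c \<and> 0 < d) sequentially"
    using coordinate_sum_mean_norm_limit[of c] p(2) eventually_gt_at_top[of 0]
    by (intro eventually_conj) (auto simp: c_def)
  then obtain d where d: "d > 0" and r_less: "(\<integral>z. cmod (\<Sum>i<d. z i) \<partial>torus) / sqrt (real d) < c"
    by (auto simp: eventually_sequentially)
  define r where "r = (\<integral>z. cmod (\<Sum>i<d. z i) \<partial>torus) / sqrt (real d)"
  \<comment> \<open>Any value strictly between \<open>r\<close> and \<open>c\<close> would do: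
    \<open>\<theta> < c\<close> gives the Schatten bound and \<open>r < \<theta>\<close> excludes
    bounded symbols.\<close>
  define \<theta> where "\<theta> = (r + c) / 2"
  have r: "0 \<le> r" "r < c"
    using r_less by (auto simp: r_def intro!: divide_nonneg_nonneg Bochner_Integration.integral_nonneg)
  have \<theta>: "0 < \<theta>" "\<theta> < 1" "r < \<theta>" "\<theta> < c"
    using r c1 by (auto simp: \<theta>_def)
  have "\<theta> powr p < c powr p"
    using \<theta> p(1) by (intro powr_less_mono2) auto
  also have "c powr p = 2 powr (- (1 / p) * p)"
    by (simp only: c_def powr_powr)
  also have "\<dots> = 1 / 2"
    using p(1) by (simp add: powr_minus_divide)
  finally have \<theta>p: "2 * \<theta> powr p < 1" by simp
  have "hankel_matrix (symbol d \<theta>) = (\<lambda>m n. symbol_coeff d \<theta> (Suc m * Suc n))"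
    unfolding hankel_matrix_def[abs_def]
    by (intro ext hankel_coeff_symbol d \<theta>) simp
  then have "schatten_class p (hankel_matrix (symbol d \<theta>))"
    using symbol_coeff_schatten[OF d \<theta>(1,2) \<theta>p] by simp
  moreover have "\<not> (\<exists>\<psi>\<in>Linf torus. same_hankel_form \<psi> (symbol d \<theta>))"
  proof
    assume "\<exists>\<psi>\<in>Linf torus. same_hankel_form \<psi> (symbol d \<theta>)"
    then obtain C where C: "\<And>k. \<theta> ^ Suc k \<le> C * r ^ Suc k"
      using bounded_symbol_estimate[OF d \<theta>(1,2)] unfolding r_def by blast
    \<comment> \<open>Divided by \<open>\<theta> ^ Suc k\<close>, the estimate bounds 1 by a
      sequence that tends to 0.\<close>
    have "(\<lambda>k. C * (r / \<theta>) ^ Suc k) \<longlonglongrightarrow> C * 0"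
      using r \<theta> by (intro tendsto_mult tendsto_const LIMSEQ_Suc LIMSEQ_realpow_zero) auto
    moreover have "1 \<le> C * (r / \<theta>) ^ Suc k" for k
      using C[of k] \<theta>(1) by (simp add: power_divide field_simps)
    ultimately have "1 \<le> C * 0"
      by (intro LIMSEQ_le_const) auto
    then show False by simp
  qed
  ultimately show ?thesis
    using symbol_L2[OF d \<theta>(1,2)] by blast
qed

end
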